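(* Let $X$ be a smooth oriented surface of genus one with a hole, with base point $x_0$. If a continuous mapping $f:X\to\mathfrak{P}_3$ has the Gromov-Oka property, then $\mathcal{M}(\hat f_e)=\infty$ whenever $e$ is a primitive element of $\pi_1(X,x_0)$ or $e$ is the commutator of two elements that form a basis of $\pi_1(X,x_0)$.
   Context: $\mathfrak{P}_n$ is the complex manifold of monic complex polynomials of degree $n$ without multiple zeros (the complement in $\mathbb{C}^n$ of the discriminant hypersurface), identified with the symmetrized configuration space $C_n(\mathbb{C})/\mathcal{S}_n$. Its fundamental group is the braid group $\mathcal{B}_n$; conjugacy classes of braids correspond to free homotopy classes of loops in $\mathfrak{P}_n$. The conformal module of a round annulus $\{r<|z|<R\}$, $0\le r<R\le\infty$, is $m=\frac1{2\pi}\log\frac Rr\in(0,\infty]$. For a conjugacy class $\hat b$ of $n$-braids, $\mathcal{M}(\hat b)$ is the supremum of $m(A)$ over all annuli $A$ admitting a holomorphic mapping $A\to\mathfrak{P}_n$ whose restriction to a (positively oriented) circle $\{|z|=\rho\}\subset A$ represents $\hat b$. For a map $f:X\to\mathfrak{P}_n$ and $e\in\pi_1(X,x_0)$, $\hat f_e$ denotes the conjugacy class of braids represented by the restriction of $f$ to a loop representing the conjugacy class $\hat e$ of $e$. A surface of genus one with a hole is a torus with one hole; its fundamental group is free of rank two. Every finite open Riemann surface (i.e. non-compact, with finitely generated fundamental group) is conformally equivalent to a domain $X$ on a closed Riemann surface $X^c$ such that each connected component of $X^c\setminus X$ (called a hole) is a point or a closed topological disc with smooth boundary; it has only thick ends if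 all holes are closed discs. A conformal structure on a smooth oriented surface $X$ is an orientation preserving homeomorphism $\omega:X\to\omega(X)$ onto a Riemann surface. A continuous map $f:X\to Y$ to a complex manifold has the Gromov-Oka property if for every conformal structure $\omega$ on $X$ such that $\omega(X)$ has only thick ends, $f\circ\omega^{-1}$ is homotopic to a holomorphic mapping $\omega(X)\to Y$. *)

theory Defs
  imports
    "HOL-Complex_Analysis.Complex_Analysis"
    "HOL-Algebra.Generated_Groups"
    "HOL-Computational_Algebra.Polynomial"
begin

definition config_polys :: "nat \<Rightarrow> complex poly set" where
  "config_polys n = {p. degree p = n \<and> lead_coeff p = 1 \<and> rsquarefree p}"

text \<open>The topology and the complex structure are those of \<open>\<complex>\<^sup>n\<close>, the coefficients being the
  coordinates. Below, \<open>nat \<Rightarrow> complex\<close> carries the product topology.\<close>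

definition config_space :: "nat \<Rightarrow> complex poly topology" where
  "config_space n = pullback_topology (config_polys n) coeff euclidean"

definition holomorphic_family :: "nat \<Rightarrow> complex set \<Rightarrow> (complex \<Rightarrow> complex poly) \<Rightarrow> bool" where
  "holomorphic_family n S g \<longleftrightarrow>
     g ` S \<subseteq> config_polys n \<and> (\<forall>i. (\<lambda>z. coeff (g z) i) holomorphic_on S)"

definition freely_homotopic :: "'a topology \<Rightarrow> (real \<Rightarrow> 'a) \<Rightarrow> (real \<Rightarrow> 'a) \<Rightarrow> bool" where
  "freely_homotopic X = homotopic_with (\<lambda>c. c 0 = c 1) (top_of_set {0..1}) X"

definition based_homotopic :: "'a topology \<Rightarrow> 'a \<Rightarrow> (real \<Rightarrow> 'a) \<Rightarrow> (real \<Rightarrow> 'a) \<Rightarrow> bool" where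
  "based_homotopic X x0 = homotopic_with (\<lambda>c. c 0 = x0 \<and> c 1 = x0) (top_of_set {0..1}) X"

text \<open>As \<^const>\<open>joinpaths\<close>, but without a type class constraint on the points.\<close>

definition join_loops :: "(real \<Rightarrow> 'a) \<Rightarrow> (real \<Rightarrow> 'a) \<Rightarrow> real \<Rightarrow> 'a" where
  "join_loops c d = (\<lambda>t. if t \<le> 1/2 then c (2 * t) else d (2 * t - 1))"

definition fundamental_group :: "'a topology \<Rightarrow> 'a \<Rightarrow> (real \<Rightarrow> 'a) set monoid" where
  "fundamental_group X x0 =
     \<lparr>carrier = {{d. based_homotopic X x0 c d} | c. pathin X c \<and> c 0 = x0 \<and> c 1 = x0},
      monoid.mult = (\<lambda>a b. {d. \<exists>c1\<in>a. \<exists>c2\<in>b. based_homotopic X x0 (join_loops c1 c2) d}),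
      one = {d. based_homotopic X x0 (\<lambda>_. x0) d}\<rparr>"

text \<open>A word is a list of pairs \<open>(x, s)\<close>, standing for \<open>x\<close> if \<open>s\<close> is true and for the inverse
  of \<open>x\<close> otherwise.\<close>

definition word_value :: "('a, 'm) monoid_scheme \<Rightarrow> ('a \<times> bool) list \<Rightarrow> 'a" where
  "word_value G w =
     foldr (\<lambda>(x, s) y. (if s then x else inv\<^bsub>G\<^esub> x) \<otimes>\<^bsub>G\<^esub> y) w \<one>\<^bsub>G\<^esub>"

definition reduced_word :: "('a \<times> bool) list \<Rightarrow> bool" where
  "reduced_word = successively (\<lambda>(x, s) (y, t). \<not> (x = y \<and> s \<noteq> t))"

definition free_basis :: "('a, 'm) monoid_scheme \<Rightarrow> 'a set \<Rightarrow> bool" where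
  "free_basis G B \<longleftrightarrow>
     B \<subseteq> carrier G \<and> generate G B = carrier G \<and>
     (\<forall>w. w \<noteq> [] \<and> set w \<subseteq> B \<times> UNIV \<and> reduced_word w \<longrightarrow> word_value G w \<noteq> \<one>\<^bsub>G\<^esub>)"

definition primitive_element :: "('a, 'm) monoid_scheme \<Rightarrow> 'a \<Rightarrow> bool" where
  "primitive_element G e \<longleftrightarrow> (\<exists>B. free_basis G B \<and> e \<in> B)"

definition group_commutator :: "('a, 'm) monoid_scheme \<Rightarrow> 'a \<Rightarrow> 'a \<Rightarrow> 'a" where
  "group_commutator G a b = a \<otimes>\<^bsub>G\<^esub> b \<otimes>\<^bsub>G\<^esub> inv\<^bsub>G\<^esub> a \<otimes>\<^bsub>G\<^esub> inv\<^bsub>G\<^esub> b"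

text \<open>A conjugacy class of \<open>n\<close>-braids is represented as a free homotopy class of loops in
  \<^term>\<open>config_space n\<close>.\<close>

definition braid_class ::
  "nat \<Rightarrow> 'a topology \<Rightarrow> ('a \<Rightarrow> complex poly) \<Rightarrow> (real \<Rightarrow> 'a) set \<Rightarrow> (real \<Rightarrow> complex poly) set" where
  "braid_class n X f e =
     {d. \<exists>c\<in>e. \<exists>c'. freely_homotopic X c c' \<and> freely_homotopic (config_space n) (f \<circ> c') d}"

definition round_annulus :: "real \<Rightarrow> ereal \<Rightarrow> complex set" where
  "round_annulus r R = {z. r < norm z \<and> ereal (norm z) < R}"

definition annulus_module :: "real \<Rightarrow> ereal \<Rightarrow> ereal" where
  "annulus_module r R =
     (if r = 0 \<or> R = \<infinity> then \<infinity> else ereal (ln (real_of_ereal R / r) / (2 * pi)))"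

definition conformal_module :: "nat \<Rightarrow> (real \<Rightarrow> complex poly) set \<Rightarrow> ereal" where
  "conformal_module n b =
     Sup {annulus_module r R | r R. 0 \<le> r \<and> ereal r < R \<and>
            (\<exists>g. holomorphic_family n (round_annulus r R) g \<and>
               (\<exists>\<rho>. r < \<rho> \<and> ereal \<rho> < R \<and> g \<circ> circlepath 0 \<rho> \<in> b))}"

text \<open>An atlas is a set of pairs \<open>(U, \<phi>)\<close> of a coordinate domain and a complex-valued coordinate.\<close>

type_synonym 'a atlas = "('a set \<times> ('a \<Rightarrow> complex)) set"

definition surface :: "'a topology \<Rightarrow> 'a atlas \<Rightarrow> bool" where
  "surface X A \<longleftrightarrow>
     Hausdorff_space X \<and> second_countable X \<and> connected_space X \<and>
     (\<Union>(U, \<phi>)\<in>A. U) = topspace X \<and>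
     (\<forall>(U, \<phi>)\<in>A. openin X U \<and> open (\<phi> ` U) \<and>
        homeomorphic_map (subtopology X U) (top_of_set (\<phi> ` U)) \<phi>)"

text \<open>The expression of a map \<open>h\<close> in coordinates, and the set where it is defined.\<close>

definition local_dom :: "('a set \<times> ('a \<Rightarrow> complex)) \<Rightarrow> ('a \<Rightarrow> 'b) \<Rightarrow> ('b set \<times> ('b \<Rightarrow> complex))
    \<Rightarrow> complex set" where
  "local_dom c h d = snd c ` (fst c \<inter> h -` fst d)"

definition local_rep :: "('a set \<times> ('a \<Rightarrow> complex)) \<Rightarrow> ('a \<Rightarrow> 'b) \<Rightarrow> ('b set \<times> ('b \<Rightarrow> complex))
    \<Rightarrow> complex \<Rightarrow> complex" where
  "local_rep c h d = snd d \<circ> h \<circ> inv_into (fst c) (snd c)"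

text \<open>Real differentiability of class \<open>C\<^sup>k\<close> on an open set, via iterated directional derivatives.\<close>

primrec Ck_on :: "nat \<Rightarrow> complex set \<Rightarrow> (complex \<Rightarrow> 'b::real_normed_vector) \<Rightarrow> bool" where
  "Ck_on 0 S h \<longleftrightarrow> continuous_on S h"
| "Ck_on (Suc k) S h \<longleftrightarrow>
     h differentiable_on S \<and> (\<forall>v. Ck_on k S (\<lambda>z. frechet_derivative h (at z) v))"

definition smooth_on :: "complex set \<Rightarrow> (complex \<Rightarrow> 'b::real_normed_vector) \<Rightarrow> bool" where
  "smooth_on S h \<longleftrightarrow> (\<forall>k. Ck_on k S h)"

definition real_jacobian :: "(complex \<Rightarrow> complex) \<Rightarrow> complex \<Rightarrow> real" where
  "real_jacobian h z =
     (let D = frechet_derivative h (at z) in Re (D 1) * Im (D \<i>) - Re (D \<i>) * Im (D 1))"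

definition smooth_oriented_surface :: "'a topology \<Rightarrow> 'a atlas \<Rightarrow> bool" where
  "smooth_oriented_surface X A \<longleftrightarrow>
     surface X A \<and>
     (\<forall>c\<in>A. \<forall>d\<in>A. smooth_on (local_dom c id d) (local_rep c id d) \<and>
        (\<forall>z\<in>local_dom c id d. real_jacobian (local_rep c id d) z > 0))"

definition riemann_surface :: "'a topology \<Rightarrow> 'a atlas \<Rightarrow> bool" where
  "riemann_surface X A \<longleftrightarrow>
     surface X A \<and> (\<forall>c\<in>A. \<forall>d\<in>A. local_rep c id d holomorphic_on local_dom c id d)"

definition closed_disc_in :: "'a topology \<Rightarrow> 'a set \<Rightarrow> bool" where
  "closed_disc_in X K \<longleftrightarrow>
     K \<subseteq> topspace X \<and> subtopology X K homeomorphic_space top_of_set (cball (0::complex) 1)"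

definition torus :: "(complex \<times> complex) topology" where
  "torus = top_of_set (sphere 0 1 \<times> sphere 0 1)"

definition torus_with_hole :: "'a topology \<Rightarrow> bool" where
  "torus_with_hole X \<longleftrightarrow>
     (\<exists>K. ((\<exists>p\<in>topspace torus. K = {p}) \<or> closed_disc_in torus K) \<and>
          X homeomorphic_space subtopology torus (topspace torus - K))"

text \<open>Local degree 1 of an injective continuous map of a plane open set, by winding numbers of
  images of small positively oriented circles.\<close>

definition orientation_preserving_on :: "complex set \<Rightarrow> (complex \<Rightarrow> complex) \<Rightarrow> bool" where
  "orientation_preserving_on S h \<longleftrightarrow>
     (\<forall>z\<in>S. \<forall>r>0. cball z r \<subseteq> S \<longrightarrow> winding_number (h \<circ> circlepath z r) (h z) = 1)"

definition conformal_structure ::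
  "'a topology \<Rightarrow> 'a atlas \<Rightarrow> 'b topology \<Rightarrow> 'b atlas \<Rightarrow> ('a \<Rightarrow> 'b) \<Rightarrow> bool" where
  "conformal_structure X A Y B \<omega> \<longleftrightarrow>
     riemann_surface Y B \<and> homeomorphic_map X Y \<omega> \<and>
     (\<forall>c\<in>A. \<forall>d\<in>B. orientation_preserving_on (local_dom c \<omega> d) (local_rep c \<omega> d))"

definition conformal_embedding ::
  "'a topology \<Rightarrow> 'a atlas \<Rightarrow> 'b topology \<Rightarrow> 'b atlas \<Rightarrow> ('a \<Rightarrow> 'b) \<Rightarrow> bool" where
  "conformal_embedding Y B Z C j \<longleftrightarrow>
     embedding_map Y Z j \<and> openin Z (j ` topspace Y) \<and>
     (\<forall>c\<in>B. \<forall>d\<in>C. local_rep c j d holomorphic_on local_dom c j d)"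

text \<open>\<open>K\<close> has smooth boundary: near each boundary point, it is the sublevel set of a smooth real
  function with non-vanishing differential.\<close>

definition smooth_boundary_in :: "'a topology \<Rightarrow> 'a atlas \<Rightarrow> 'a set \<Rightarrow> bool" where
  "smooth_boundary_in Z C K \<longleftrightarrow>
     (\<forall>p \<in> Z frontier_of K. \<exists>(U, \<phi>)\<in>C. p \<in> U \<and>
        (\<exists>W (s :: complex \<Rightarrow> real). open W \<and> W \<subseteq> \<phi> ` U \<and> \<phi> p \<in> W \<and> smooth_on W s \<and>
           (\<forall>z\<in>W. \<exists>v. frechet_derivative s (at z) v \<noteq> 0) \<and>
           \<phi> ` (U \<inter> K) \<inter> W = {z\<in>W. s z \<le> 0}))"

text \<open>Only used for open (non-compact) \<open>Y\<close>. The points of the closed surface \<open>Z\<close> are taken from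
  the type \<^typ>\<open>complex\<close>, with an arbitrary topology: every Riemann surface has the cardinality of
  the continuum, so it is isomorphic to one of this kind. The same applies to the target of a
  conformal structure in the Gromov-Oka property.\<close>

definition only_thick_ends :: "'a topology \<Rightarrow> 'a atlas \<Rightarrow> bool" where
  "only_thick_ends Y B \<longleftrightarrow>
     (\<exists>(Z :: complex topology) C j.
        riemann_surface Z C \<and> compact_space Z \<and> conformal_embedding Y B Z C j \<and>
        (let holes = connected_components_of (subtopology Z (topspace Z - j ` topspace Y))
         in finite holes \<and> (\<forall>K\<in>holes. closed_disc_in Z K \<and> smooth_boundary_in Z C K)))"

definition holomorphic_to_config ::
  "nat \<Rightarrow> 'a topology \<Rightarrow> 'a atlas \<Rightarrow> ('a \<Rightarrow> complex poly) \<Rightarrow> bool" where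
  "holomorphic_to_config n Y B g \<longleftrightarrow>
     (\<forall>(U, \<phi>)\<in>B. holomorphic_family n (\<phi> ` U) (g \<circ> inv_into U \<phi>))"

definition gromov_oka ::
  "nat \<Rightarrow> 'a topology \<Rightarrow> 'a atlas \<Rightarrow> ('a \<Rightarrow> complex poly) \<Rightarrow> bool" where
  "gromov_oka n X A f \<longleftrightarrow>
     (\<forall>(Y :: complex topology) B \<omega>.
        conformal_structure X A Y B \<omega> \<and> only_thick_ends Y B \<longrightarrow>
        (\<exists>g. holomorphic_to_config n Y B g \<and>
             homotopic_with (\<lambda>_. True) Y (config_space n) (f \<circ> inv_into (topspace X) \<omega>) g))"

end

theory Submission
  imports Defs
begin

text \<open>Let \<open>T\<close> be the torus with one point removed and \<open>a\<close>, \<open>b\<close> its two coordinate circles. The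
  surface \<open>X\<close> is homeomorphic to \<open>T\<close>, and \<open>T\<close> carries complex structures with thick ends for which
  the class in question contains the core circle of a round annulus of arbitrarily large module:

  \<^item> On \<open>\<complex> / (\<int> + \<i> L \<int>)\<close> with a small round hole, a horizontal strip of height \<open>L/2\<close> that avoids
    the hole projects to an annulus of module \<open>L/2\<close> whose core circle is \<open>a\<close>; let \<open>L\<close> tend to infinity.
  \<^item> On the square torus with a hole of radius \<open>\<delta>\<close>, the points at distance between \<open>\<delta>\<close> and \<open>1/2\<close> from
    the centre of the hole form an annulus of module \<open>ln (1 / (2 \<delta>)) / (2 \<pi>)\<close>, whose circles are freely
    homotopic to the boundary of the unit square, that is, to the commutator of \<open>a\<close> and \<open>b\<close>; let \<open>\<delta>\<close>
    tend to zero.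

  For each such structure the Gromov-Oka property makes \<open>f\<close> homotopic to a holomorphic map, and
  composing it with the inclusion of the annulus gives the lower bounds \<open>module_primitive\<close> and
  \<open>module_commutator\<close> for the conformal module of the braid class.

  What remains is to choose the homeomorphism \<open>X \<rightarrow> T\<close> such that a given primitive element becomes
  \<open>a\<close>, respectively a given basis becomes \<open>(a, b)\<close>. A hole that is a closed disc is cellular in the
  torus, so it can be collapsed to a point (\<open>cellular_complement\<close>), which gives some homeomorphism to
  \<open>T\<close> (\<open>torus_with_hole_homeomorphic\<close>). Since \<open>a\<close> and \<open>b\<close> generate the fundamental group
  (\<open>puncT_generated\<close>), the homeomorphism takes some generating pair of the group of \<open>X\<close> to \<open>(a, b)\<close>. By
  Nielsen's theorem (\<open>nielsen_basis\<close>) elementary moves lead from this pair to a pair that contains,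
  up to inversion, the elements of the given basis. Each elementary move is realised by a
  homeomorphism of \<open>T\<close>: a reflection, the exchange of the coordinates, or a Dehn twist
  (\<open>marking_nielsen\<close>).

  A homeomorphism may reverse the orientation. On the flat tori this is repaired by passing to the
  complex conjugate structure (\<open>conformal_structure_some_sign\<close>), since a homeomorphism
  of connected surfaces preserves the orientation everywhere or nowhere (\<open>orientation_dichotomy\<close>).\<close>

section \<open>Nielsen equivalence in free groups\<close>

text \<open>The moves are chained at the end: each step of an induction performs one more move on a pair
  that has already been reached from \<open>p\<close>.\<close>

inductive nielsen :: "('a, 'm) monoid_scheme \<Rightarrow> 'a \<times> 'a \<Rightarrow> 'a \<times> 'a \<Rightarrow> bool"
  for G :: "('a, 'm) monoid_scheme" and p :: "'a \<times> 'a" where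
  refl: "nielsen G p p"
| swap: "nielsen G p (x, y) \<Longrightarrow> nielsen G p (y, x)"
| inv: "nielsen G p (x, y) \<Longrightarrow> nielsen G p (inv\<^bsub>G\<^esub> x, y)"
| mult: "nielsen G p (x, y) \<Longrightarrow> nielsen G p (x \<otimes>\<^bsub>G\<^esub> y, y)"

lemma nielsen_trans:
  assumes "nielsen G q r" "nielsen G p q"
  shows "nielsen G p r"
  using assms by (induction rule: nielsen.induct) (auto intro: nielsen.intros)

context group
begin

lemma nielsen_carrier:
  assumes "nielsen G (u, v) p" "u \<in> carrier G" "v \<in> carrier G"
  shows "fst p \<in> carrier G \<and> snd p \<in> carrier G"
  using assms by (induction rule: nielsen.induct) auto

lemma nielsen_inv2:
  assumes "nielsen G p (x, y)" shows "nielsen G p (x, inv y)"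
  using nielsen.swap[OF nielsen.inv[OF nielsen.swap[OF assms]]] .

lemma nielsen_mult2:
  assumes "nielsen G p (x, y)" "x \<in> carrier G" "y \<in> carrier G"
  shows "nielsen G p (x, x \<otimes> y)"
proof -
  have "nielsen G p (inv x, inv y)"
    using nielsen_inv2[OF nielsen.inv[OF assms(1)]] .
  from nielsen.mult[OF nielsen.swap[OF this]] have "nielsen G p (inv y \<otimes> inv x, inv x)" .
  then have "nielsen G p (inv (inv y \<otimes> inv x), inv x)"
    by (rule nielsen.inv)
  then have "nielsen G p (x \<otimes> y, inv x)"
    using assms by (simp add: inv_mult_group)
  from nielsen_inv2[OF this] have "nielsen G p (x \<otimes> y, x)"
    unfolding inv_inv[OF assms(2)] .
  then show ?thesis by (rule nielsen.swap)
qed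

lemma nielsen_conj1:
  assumes "nielsen G p (x, y)" "x \<in> carrier G" "y \<in> carrier G"
  shows "nielsen G p (x, x \<otimes> y \<otimes> inv x)"
proof -
  have 1: "nielsen G p (x, x \<otimes> y)"
    using assms by (rule nielsen_mult2)
  have "nielsen G p ((x \<otimes> y) \<otimes> inv x, inv x)"
    using nielsen.mult[OF nielsen.swap[OF nielsen.inv[OF 1]]] .
  from nielsen_inv2[OF this] have "nielsen G p (x \<otimes> y \<otimes> inv x, x)"
    unfolding inv_inv[OF assms(2)] .
  then show ?thesis by (rule nielsen.swap)
qed

lemma generate_mono_elems:
  assumes "A \<subseteq> generate G H" "H \<subseteq> carrier G"
  shows "generate G A \<subseteq> generate G H"
  by (rule generate_subgroup_incl[OF assms(1) generate_is_subgroup[OF assms(2)]])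

lemma nielsen_generate:
  assumes "nielsen G (u, v) p" "u \<in> carrier G" "v \<in> carrier G"
  shows "generate G {u, v} \<subseteq> generate G {fst p, snd p}"
  using assms
proof (induction rule: nielsen.induct)
  case refl then show ?case by simp
next
  case (swap x y) then show ?case by (simp add: insert_commute)
next
  case (inv x y)
  have c: "x \<in> carrier G" "y \<in> carrier G"
    using nielsen_carrier[OF inv.hyps inv.prems] by auto
  have "inv (inv x) \<in> generate G {inv x, y}" by (rule generate.inv) simp
  then have "generate G {x, y} \<subseteq> generate G {inv x, y}"
    using c by (intro generate_mono_elems) (auto intro: generate.incl)
  with inv show ?case by auto
next
  case (mult x y)
  have c: "x \<in> carrier G" "y \<in> carrier G"
    using nielsen_carrier[OF mult.hyps mult.prems] by auto
  have "(x \<otimes> y) \<otimes> inv y \<in> generate G {x \<otimes> y, y}"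
    by (rule generate.eng[OF generate.incl generate.inv]) auto
  moreover have "(x \<otimes> y) \<otimes> inv y = x" using c by (simp add: m_assoc)
  ultimately have "generate G {x, y} \<subseteq> generate G {x \<otimes> y, y}"
    using c by (intro generate_mono_elems) (auto intro: generate.incl)
  with mult show ?case by auto
qed

lemma nielsen_map_conj:
  assumes "nielsen G (u, v) p" "u \<in> carrier G" "v \<in> carrier G" "g \<in> carrier G"
  shows "nielsen G (g \<otimes> u \<otimes> inv g, g \<otimes> v \<otimes> inv g)
           (g \<otimes> fst p \<otimes> inv g, g \<otimes> snd p \<otimes> inv g)"
  using assms
proof (induction rule: nielsen.induct)
  case refl then show ?case by (simp add: nielsen.refl)
next
  case (swap x y) then show ?case by (auto intro: nielsen.swap)
next
  case (inv x y)
  have c: "x \<in> carrier G" "y \<in> carrier G"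
    using nielsen_carrier[OF inv.hyps] inv.prems by auto
  have "inv (g \<otimes> x \<otimes> inv g) = g \<otimes> inv x \<otimes> inv g"
    using c inv.prems by (simp add: inv_mult_group m_assoc)
  with nielsen.inv[OF inv.IH[OF inv.prems, simplified]] show ?case by simp
next
  case (mult x y)
  have c: "x \<in> carrier G" "y \<in> carrier G"
    using nielsen_carrier[OF mult.hyps] mult.prems by auto
  have "(g \<otimes> x \<otimes> inv g) \<otimes> (g \<otimes> y \<otimes> inv g) = g \<otimes> (x \<otimes> y) \<otimes> inv g"
    using c mult.prems by (simp add: m_assoc inv_solve_left flip: m_assoc[of "inv g" g])
  with nielsen.mult[OF mult.IH[OF mult.prems, simplified]] show ?case by simp
qed

text \<open>It suffices to conjugate by generators, and conjugating the pair \<open>(u, v)\<close> by \<open>u\<close> only changes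
  \<open>v\<close>, into a product of moves.\<close>

lemma nielsen_conj:
  assumes "g \<in> generate G {u, v}" "u \<in> carrier G" "v \<in> carrier G"
  shows "nielsen G (u, v) (g \<otimes> u \<otimes> inv g, g \<otimes> v \<otimes> inv g)"
  using assms
proof (induction rule: generate.induct)
  case one then show ?case by (simp add: nielsen.refl)
next
  case (incl h)
  have 1: "nielsen G (u, v) (u, u \<otimes> v \<otimes> inv u)"
    using incl by (intro nielsen_conj1 nielsen.refl)
  have "nielsen G (u, v) (v, v \<otimes> u \<otimes> inv v)"
    using incl by (intro nielsen_conj1[OF nielsen.swap[OF nielsen.refl]])
  from 1 nielsen.swap[OF this] show ?case
    using incl by (auto simp: m_assoc)
next
  case (inv h)
  have *: "nielsen G (x, y) (x, inv x \<otimes> y \<otimes> x)" if "x \<in> carrier G" "y \<in> carrier G" for x y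
  proof -
    have "nielsen G (x, y) (inv x, inv x \<otimes> y \<otimes> inv (inv x))"
      using that by (intro nielsen_conj1[OF nielsen.inv[OF nielsen.refl]]) auto
    from nielsen.inv[OF this] that show ?thesis by simp
  qed
  have 1: "nielsen G (u, v) (u, inv u \<otimes> v \<otimes> u)"
    using inv by (intro *)
  have "nielsen G (v, u) (v, inv v \<otimes> u \<otimes> v)"
    using inv by (intro *)
  from nielsen_trans[OF nielsen.swap[OF this] nielsen.swap[OF nielsen.refl[of G "(u, v)"]]]
  have "nielsen G (u, v) (inv v \<otimes> u \<otimes> v, v)" .
  with 1 show ?case
    using inv by (auto simp: m_assoc)
next
  case (eng h1 h2)
  have c: "h1 \<in> carrier G" "h2 \<in> carrier G"
    using eng generate_in_carrier[of "{u,v}"] by auto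
  have "nielsen G (h1 \<otimes> u \<otimes> inv h1, h1 \<otimes> v \<otimes> inv h1)
      (h1 \<otimes> (h2 \<otimes> u \<otimes> inv h2) \<otimes> inv h1, h1 \<otimes> (h2 \<otimes> v \<otimes> inv h2) \<otimes> inv h1)"
    using nielsen_map_conj[OF eng.IH(2)] eng.prems c by simp
  from nielsen_trans[OF this eng.IH(1)] show ?case
    using c eng.prems by (simp add: m_assoc inv_mult_group)
qed

end

text \<open>Word lengths in a free group are controlled by the longest common prefix of reduced words.
  It satisfies an ultrametric inequality, since words are branches of a tree.\<close>

fun lcp :: "'a list \<Rightarrow> 'a list \<Rightarrow> nat" where
  "lcp (x # xs) (y # ys) = (if x = y then Suc (lcp xs ys) else 0)"
| "lcp _ _ = 0"

lemma lcp_commute: "lcp xs ys = lcp ys xs"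
  by (induction xs ys rule: lcp.induct) auto

lemma lcp_le: "lcp xs ys \<le> length xs" "lcp xs ys \<le> length ys"
  by (induction xs ys rule: lcp.induct) auto

lemma lcp_same [simp]: "lcp xs xs = length xs"
  by (induction xs) auto

lemma lcp_ultrametric: "min (lcp xs ys) (lcp ys zs) \<le> lcp xs zs"
proof (induction xs zs arbitrary: ys rule: lcp.induct)
  case (1 x xs z zs)
  then show ?case by (cases ys) auto
next
  case ("2_1" zs) then show ?case by (cases ys) auto
next
  case ("2_2" xs) then show ?case by (cases ys) (auto split: list.splits)
qed

lemma lcp_take: "take (lcp xs ys) xs = take (lcp xs ys) ys"
  by (induction xs ys rule: lcp.induct) auto

lemma take_lcp: "n \<le> lcp xs ys \<Longrightarrow> take n xs = take n ys"
  by (metis lcp_take min.absorb2 take_take min.commute)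

lemma lcp_nth: "n < lcp xs ys \<Longrightarrow> xs ! n = ys ! n"
  by (metis lcp_take nth_take)

lemma lcp_hd_drop:
  assumes "drop (lcp xs ys) xs = a # as" "drop (lcp xs ys) ys = b # bs"
  shows "a \<noteq> b"
  using assms by (induction xs ys rule: lcp.induct) (auto split: if_splits)

definition word_inv :: "('a \<times> bool) list \<Rightarrow> ('a \<times> bool) list" where
  "word_inv w = rev (map (apsnd Not) w)"

lemma length_word_inv [simp]: "length (word_inv w) = length w"
  by (simp add: word_inv_def)

lemma word_inv_word_inv [simp]: "word_inv (word_inv w) = w"
  by (simp add: word_inv_def rev_map o_def apsnd_compose apsnd_def map_prod_def case_prod_beta)

lemma word_inv_nth: "i < length w \<Longrightarrow> word_inv w ! i = apsnd Not (w ! (length w - 1 - i))"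
  by (simp add: word_inv_def rev_nth)

lemma take_word_inv: "take n (word_inv w) = word_inv (drop (length w - n) w)"
  by (simp add: word_inv_def take_rev drop_map)

lemma set_word_inv: "set w \<subseteq> A \<times> UNIV \<Longrightarrow> set (word_inv w) \<subseteq> A \<times> UNIV"
  by (auto simp: word_inv_def)

lemma reduced_word_inv:
  assumes "reduced_word w" shows "reduced_word (word_inv w)"
  using assms
  unfolding reduced_word_def word_inv_def
  by (auto simp: successively_map intro: successively_mono split: prod.splits)

lemma reduced_word_append:
  "reduced_word (v @ w) \<longleftrightarrow> reduced_word v \<and> reduced_word w \<and>
     (v \<noteq> [] \<and> w \<noteq> [] \<longrightarrow> apsnd Not (last v) \<noteq> hd w)"
  unfolding reduced_word_def successively_append_iff
  by (cases "v = []"; cases "w = []") (auto split: prod.splits simp: apsnd_def)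

locale free_group = group G for G (structure) +
  fixes B :: "'a set"
  assumes free_basis: "free_basis G B"
begin

lemma basis_carrier: "B \<subseteq> carrier G"
  using free_basis by (simp add: free_basis_def)

lemma word_value_Nil [simp]: "word_value G [] = \<one>"
  by (simp add: word_value_def)

lemma word_value_Cons:
  "word_value G ((x, s) # w) = (if s then x else inv x) \<otimes> word_value G w"
  by (simp add: word_value_def)

lemma word_value_carrier [simp]:
  "set w \<subseteq> B \<times> UNIV \<Longrightarrow> word_value G w \<in> carrier G"
  using basis_carrier by (induction w) (auto simp: word_value_Cons)

lemma word_value_append:
  assumes "set v \<subseteq> B \<times> UNIV" "set w \<subseteq> B \<times> UNIV"
  shows "word_value G (v @ w) = word_value G v \<otimes> word_value G w"
  using assms(1)
proof (induction v)
  case Nil then show ?case using assms by simp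
next
  case (Cons a v)
  obtain x s where a: "a = (x, s)" by force
  show ?case
    using Cons assms basis_carrier by (auto simp: a word_value_Cons m_assoc)
qed

lemma word_value_inv:
  assumes "set w \<subseteq> B \<times> UNIV"
  shows "word_value G (word_inv w) = inv (word_value G w)"
  using assms
proof (induction w)
  case Nil then show ?case by (simp add: word_inv_def)
next
  case (Cons a w)
  obtain x s where a: "a = (x, s)" by force
  have x: "x \<in> carrier G" using Cons.prems basis_carrier by (auto simp: a)
  have eq: "word_inv (a # w) = word_inv w @ [(x, \<not> s)]"
    by (simp add: a word_inv_def)
  have "word_value G (word_inv (a # w)) = word_value G (word_inv w) \<otimes> word_value G [(x, \<not> s)]"
    unfolding eq using Cons.prems set_word_inv[of w B]
    by (intro word_value_append) (auto simp: a)
  then show ?case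
    using Cons x by (auto simp: a word_value_Cons inv_mult_group)
qed

lemma reduced_word_exists:
  assumes "g \<in> carrier G"
  shows "\<exists>w. set w \<subseteq> B \<times> UNIV \<and> reduced_word w \<and> word_value G w = g"
proof -
  have "g \<in> generate G B" using assms free_basis by (simp add: free_basis_def)
  then have "\<exists>w. set w \<subseteq> B \<times> UNIV \<and> word_value G w = g"
  proof (induction rule: generate.induct)
    case one show ?case by (intro exI[of _ "[]"]) auto
  next
    case (incl h) then show ?case
      using basis_carrier by (intro exI[of _ "[(h, True)]"]) (auto simp: word_value_Cons)
  next
    case (inv h) then show ?case
      using basis_carrier by (intro exI[of _ "[(h, False)]"]) (auto simp: word_value_Cons)
  next
    case (eng h1 h2)
    then obtain w1 w2 where "set w1 \<subseteq> B \<times> UNIV" "word_value G w1 = h1"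
      "set w2 \<subseteq> B \<times> UNIV" "word_value G w2 = h2" by blast
    then show ?case
      using word_value_append[of w1 w2] by (intro exI[of _ "w1 @ w2"]) auto
  qed
  then obtain w where "set w \<subseteq> B \<times> UNIV" "word_value G w = g" by blast
  then show ?thesis
  proof (induction w arbitrary: g)
    case Nil then show ?case by (intro exI[of _ "[]"]) (auto simp: reduced_word_def)
  next
    case (Cons a w)
    obtain x s where a: "a = (x, s)" by force
    have x: "x \<in> carrier G" "x \<in> B" using Cons.prems basis_carrier by (auto simp: a)
    obtain w' where w': "set w' \<subseteq> B \<times> UNIV" "reduced_word w'" "word_value G w' = word_value G w"
      using Cons by fastforce
    show ?case
    proof (cases "w' \<noteq> [] \<and> hd w' = (x, \<not> s)")
      case True
      then obtain w'' where w'': "w' = (x, \<not> s) # w''" by (cases w') auto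
      have c: "word_value G w'' \<in> carrier G" using w' w'' by auto
      have "g = (if s then x else inv x) \<otimes> word_value G w'"
        using Cons.prems w' by (simp add: a word_value_Cons)
      also have "\<dots> = word_value G w''"
        using c x unfolding w'' by (auto simp: word_value_Cons simp flip: m_assoc)
      finally show ?thesis
        using w' w'' by (intro exI[of _ w'']) (auto simp: reduced_word_def successively_Cons)
    next
      case False
      then have "reduced_word (a # w')"
        using w' reduced_word_append[of "[a]" w'] by (auto simp: a reduced_word_def apsnd_def)
      then show ?thesis
        using w' Cons.prems x by (intro exI[of _ "a # w'"]) (auto simp: a word_value_Cons)
    qed
  qed
qed

lemma quotient_reduced:
  assumes "reduced_word v" "reduced_word w"
  shows "reduced_word (word_inv (drop (lcp v w) v) @ drop (lcp v w) w)"
proof -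
  have r: "reduced_word (drop (lcp v w) v)" "reduced_word (drop (lcp v w) w)"
    using assms by (metis append_take_drop_id reduced_word_append)+
  have "apsnd Not (last (word_inv (drop (lcp v w) v))) \<noteq> hd (drop (lcp v w) w)"
    if ne: "word_inv (drop (lcp v w) v) \<noteq> []" "drop (lcp v w) w \<noteq> []"
  proof -
    obtain a as where a: "drop (lcp v w) v = a # as"
      using ne by (cases "drop (lcp v w) v") (auto simp: word_inv_def)
    obtain b bs where b: "drop (lcp v w) w = b # bs"
      using ne by (cases "drop (lcp v w) w") auto
    show ?thesis
      using lcp_hd_drop[OF a b] unfolding a b by (cases a) (auto simp: word_inv_def)
  qed
  with r show ?thesis
    unfolding reduced_word_append using reduced_word_inv by blast
qed

lemma quotient_value:
  assumes "set v \<subseteq> B \<times> UNIV" "set w \<subseteq> B \<times> UNIV"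
  shows "word_value G (word_inv (drop (lcp v w) v) @ drop (lcp v w) w) =
    inv (word_value G v) \<otimes> word_value G w"
proof -
  define p where "p = take (lcp v w) v"
  define v' where "v' = drop (lcp v w) v"
  define w' where "w' = drop (lcp v w) w"
  have v: "v = p @ v'" by (simp add: p_def v'_def)
  have w: "w = p @ w'" by (metis append_take_drop_id lcp_take p_def w'_def)
  have s: "set p \<subseteq> B \<times> UNIV" "set v' \<subseteq> B \<times> UNIV" "set w' \<subseteq> B \<times> UNIV"
    using assms v w by auto
  have c: "word_value G p \<in> carrier G" "word_value G v' \<in> carrier G" "word_value G w' \<in> carrier G"
    using s by auto
  have "word_value G (word_inv v' @ w') = inv (word_value G v') \<otimes> word_value G w'"
    using s set_word_inv[OF s(2)] by (simp add: word_value_append word_value_inv)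
  also have "\<dots> = inv (word_value G v) \<otimes> word_value G w"
    unfolding v w using s c
    by (simp add: word_value_append inv_mult_group m_assoc flip: m_assoc[of "inv word_value G p" "word_value G p"])
  finally show ?thesis by (simp add: v'_def w'_def)
qed

text \<open>Two different reduced words would leave a nonempty reduced word with value \<open>\<one>\<close> after their
  common prefix is cancelled.\<close>

lemma reduced_word_unique:
  assumes "set v \<subseteq> B \<times> UNIV" "set w \<subseteq> B \<times> UNIV" "reduced_word v" "reduced_word w"
    "word_value G v = word_value G w"
  shows "v = w"
proof -
  let ?u = "word_inv (drop (lcp v w) v) @ drop (lcp v w) w"
  have "word_value G ?u = \<one>"
    using quotient_value[OF assms(1,2)] assms by simp
  moreover have "reduced_word ?u" by (rule quotient_reduced) fact+
  moreover have "set ?u \<subseteq> B \<times> UNIV"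
    using assms set_word_inv[of "drop (lcp v w) v" B] by (auto dest: in_set_dropD)
  ultimately have "?u = []"
    using free_basis unfolding free_basis_def by blast
  then have "drop (lcp v w) v = []" "drop (lcp v w) w = []"
    by (auto simp: word_inv_def)
  then show ?thesis
    by (metis append_take_drop_id append_Nil2 lcp_take)
qed

definition nf :: "'a \<Rightarrow> ('a \<times> bool) list" where
  "nf g = (THE w. set w \<subseteq> B \<times> UNIV \<and> reduced_word w \<and> word_value G w = g)"

lemma nf:
  assumes "g \<in> carrier G"
  shows "set (nf g) \<subseteq> B \<times> UNIV" "reduced_word (nf g)" "word_value G (nf g) = g"
proof -
  have "\<exists>!w. set w \<subseteq> B \<times> UNIV \<and> reduced_word w \<and> word_value G w = g"
    using reduced_word_exists[OF assms] reduced_word_unique by blast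
  from theI'[OF this] show "set (nf g) \<subseteq> B \<times> UNIV" "reduced_word (nf g)" "word_value G (nf g) = g"
    unfolding nf_def by auto
qed

lemma nf_eqI:
  assumes "set w \<subseteq> B \<times> UNIV" "reduced_word w" "word_value G w = g"
  shows "nf g = w"
  using assms nf[of g] reduced_word_unique by (metis word_value_carrier)

definition len :: "'a \<Rightarrow> nat" where "len g = length (nf g)"

text \<open>The Gromov product of the Cayley tree, based at \<open>\<one>\<close>: the number of letters of
  each factor that cancel in \<open>inv g \<otimes> h\<close>.\<close>

definition gp :: "'a \<Rightarrow> 'a \<Rightarrow> nat" where "gp g h = lcp (nf g) (nf h)"

lemma gp_commute: "gp g h = gp h g" by (simp add: gp_def lcp_commute)

lemma gp_ultrametric: "min (gp f g) (gp g h) \<le> gp f h"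
  by (simp add: gp_def lcp_ultrametric)

lemma nf_inv: "g \<in> carrier G \<Longrightarrow> nf (inv g) = word_inv (nf g)"
  using nf[of g] by (intro nf_eqI set_word_inv reduced_word_inv) (auto simp: word_value_inv)

lemma len_inv [simp]: "g \<in> carrier G \<Longrightarrow> len (inv g) = len g"
  by (simp add: len_def nf_inv)

lemma len_quotient:
  assumes "g \<in> carrier G" "h \<in> carrier G"
  shows "len (inv g \<otimes> h) + 2 * gp g h = len g + len h"
proof -
  let ?v = "nf g" and ?w = "nf h"
  let ?u = "word_inv (drop (lcp ?v ?w) ?v) @ drop (lcp ?v ?w) ?w"
  have "nf (inv g \<otimes> h) = ?u"
  proof (rule nf_eqI)
    show "set ?u \<subseteq> B \<times> UNIV"
      using nf(1)[OF assms(1)] nf(1)[OF assms(2)] set_word_inv[of "drop (lcp ?v ?w) ?v" B]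
      by (auto dest: in_set_dropD)
  next
    show "reduced_word ?u" by (rule quotient_reduced) (use nf assms in auto)
  next
    show "word_value G ?u = inv g \<otimes> h"
      using quotient_value[of ?v ?w] nf assms by auto
  qed
  then show ?thesis
    using lcp_le[of ?v ?w] by (simp add: len_def gp_def)
qed

lemma len_eq_0: "g \<in> carrier G \<Longrightarrow> len g = 0 \<longleftrightarrow> g = \<one>"
  using nf[of g] nf_eqI[of "[]" g] by (auto simp: len_def reduced_word_def)

lemma len_word_le:
  assumes "set w \<subseteq> B \<times> UNIV"
  shows "len (word_value G w) \<le> length w"
  using assms
proof (induction w)
  case Nil
  have "len \<one> = 0" by (simp add: len_eq_0)
  then show ?case by simp
next
  case (Cons a w)
  obtain x s where a: "a = (x, s)" by force
  have x: "x \<in> carrier G" "x \<in> B" using Cons.prems basis_carrier by (auto simp: a)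
  have "nf x = [(x, True)]"
    using x by (intro nf_eqI) (auto simp: reduced_word_def word_value_Cons)
  then have l: "len x = 1" by (simp add: len_def)
  have w: "word_value G w \<in> carrier G" using Cons.prems by auto
  have "len ((if s then x else inv x) \<otimes> word_value G w) \<le> 1 + len (word_value G w)"
    using len_quotient[of "inv x" "word_value G w"] len_quotient[of x "word_value G w"] x w l
    by auto
  then show ?case
    using Cons by (auto simp: a word_value_Cons)
qed

lemma len_basis: "x \<in> B \<Longrightarrow> len x = 1"
  using nf_eqI[of "[(x, True)]" x] basis_carrier
  by (auto simp: reduced_word_def word_value_Cons len_def)

text \<open>No nonempty reduced word cancels half of itself when it is squared: the letters at mirror
  positions would be inverse to each other, which fails in the middle of the word.\<close>

lemma gp_square:
  assumes g: "g \<in> carrier G" "g \<noteq> \<one>"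
  shows "2 * gp (inv g) g < len g"
proof (rule ccontr)
  assume "\<not> ?thesis"
  then have c: "len g \<le> 2 * lcp (word_inv (nf g)) (nf g)"
    using g by (simp add: gp_def nf_inv)
  define w where "w = nf g"
  define n where "n = length w"
  have n0: "n > 0" using g len_eq_0[of g] by (auto simp: n_def w_def len_def)
  have sym: "apsnd Not (w ! (n - 1 - i)) = w ! i" if "i < lcp (word_inv w) w" for i
    using lcp_nth[OF that] word_inv_nth[of i w] that lcp_le(2)[of "word_inv w" w]
    by (simp add: n_def)
  have c': "n \<le> 2 * lcp (word_inv w) w" using c by (simp add: n_def w_def len_def)
  have red: "reduced_word w" using nf g by (simp add: w_def)
  show False
  proof (cases "even n")
    case True
    then obtain k where k: "n = 2 * Suc k"
      using n0 by (metis dvdE mult_0_right not0_implies_Suc not_gr_zero)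
    have "apsnd Not (w ! Suc k) = w ! k"
      using sym[of k] c' k by (simp add: numeral_2_eq_2)
    moreover have "\<not> (fst (w ! k) = fst (w ! Suc k) \<and> snd (w ! k) \<noteq> snd (w ! Suc k))"
      using red k unfolding reduced_word_def successively_conv_nth
      by (auto simp: n_def case_prod_beta)
    ultimately show False by (metis fst_apsnd snd_apsnd)
  next
    case False
    then obtain k where k: "n = 2 * k + 1" by (rule oddE)
    have "apsnd Not (w ! k) = w ! k"
      using sym[of k] c' k by simp
    then show False by (metis snd_apsnd)
  qed
qed

text \<open>The list is multiplied from the left, so that appending a factor on the right is one step of
  the induction in \<open>little_cancellation_product\<close>.\<close>

definition prod_list_G :: "'a list \<Rightarrow> 'a" where
  "prod_list_G w = foldl (\<otimes>) \<one> w"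

lemma prod_list_G_snoc: "prod_list_G (w @ [a]) = prod_list_G w \<otimes> a"
  by (simp add: prod_list_G_def)

lemma prod_list_G_carrier: "set w \<subseteq> carrier G \<Longrightarrow> prod_list_G w \<in> carrier G"
  by (induction w rule: rev_induct) (auto simp: prod_list_G_snoc, simp add: prod_list_G_def)

lemma prod_list_G_append:
  assumes "set v \<subseteq> carrier G" "set w \<subseteq> carrier G"
  shows "prod_list_G (v @ w) = prod_list_G v \<otimes> prod_list_G w"
  using assms(2)
proof (induction w rule: rev_induct)
  case Nil then show ?case using prod_list_G_carrier[OF assms(1)] by (simp add: prod_list_G_def)
next
  case (snoc a w)
  then show ?case
    using prod_list_G_carrier[of v] prod_list_G_carrier[of w] assms
    by (simp add: prod_list_G_snoc m_assoc flip: append_assoc)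
qed

text \<open>The conditions of Nielsen reduced sets: a factor loses at most half of its length to each of
  its neighbours, and it is never eaten up by both of them together.\<close>

definition little_cancellation :: "'a set \<Rightarrow> bool" where
  "little_cancellation L \<longleftrightarrow> L \<subseteq> carrier G \<and> \<one> \<notin> L \<and>
     (\<forall>a\<in>L. \<forall>b\<in>L. a \<otimes> b \<noteq> \<one> \<longrightarrow> 2 * gp (inv a) b \<le> len a \<and> 2 * gp (inv a) b \<le> len b) \<and>
     (\<forall>a\<in>L. \<forall>b\<in>L. \<forall>c\<in>L. a \<otimes> b \<noteq> \<one> \<longrightarrow> b \<otimes> c \<noteq> \<one> \<longrightarrow> gp (inv a) b + gp (inv b) c < len b)"

lemma gp_isosceles:
  assumes "gp f h < gp f g" shows "gp g h = gp f h"
  using gp_ultrametric[of f g h] gp_ultrametric[of g f h] assms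
  by (auto simp: gp_commute min_def split: if_splits)

lemma gp_right_cancel:
  assumes "g \<in> carrier G" "a \<in> carrier G"
  shows "gp (inv (g \<otimes> a)) (inv a) + gp (inv g) a = len a"
proof -
  have 1: "len (g \<otimes> a) + 2 * gp (inv g) a = len g + len a"
    using len_quotient[of "inv g" a] assms by simp
  have "len (inv (inv (g \<otimes> a)) \<otimes> inv a) + 2 * gp (inv (g \<otimes> a)) (inv a) = len (inv (g \<otimes> a)) + len (inv a)"
    using assms by (intro len_quotient) auto
  moreover have "inv (inv (g \<otimes> a)) \<otimes> inv a = g"
    using assms by (simp add: m_assoc)
  ultimately show ?thesis using 1 assms by simp
qed

text \<open>At least one letter of each factor survives in a product without trivial cancellations. The
  induction also keeps track of the end of the product: it cancels against a further factor exactly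
  as its last factor does.\<close>

lemma little_cancellation_product:
  assumes L: "little_cancellation L"
    and w: "set w \<subseteq> L" "successively (\<lambda>a b. a \<otimes> b \<noteq> \<one>) w" "w \<noteq> []"
  shows "length w \<le> len (prod_list_G w) \<and>
    (\<forall>c\<in>L. last w \<otimes> c \<noteq> \<one> \<longrightarrow>
       gp (inv (prod_list_G w)) c = gp (inv (last w)) c \<and>
       length w + gp (inv (last w)) c \<le> len (prod_list_G w))"
  using w
proof (induction w rule: rev_induct)
  case Nil then show ?case by simp
next
  case (snoc a w)
  have LC: "L \<subseteq> carrier G" "\<one> \<notin> L" using L by (auto simp: little_cancellation_def)
  have N1: "2 * gp (inv x) y \<le> len x" "2 * gp (inv x) y \<le> len y"
    if "x \<in> L" "y \<in> L" "x \<otimes> y \<noteq> \<one>" for x y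
    using L that by (auto simp: little_cancellation_def)
  have N2: "gp (inv x) y + gp (inv y) z < len y"
    if "x \<in> L" "y \<in> L" "z \<in> L" "x \<otimes> y \<noteq> \<one>" "y \<otimes> z \<noteq> \<one>" for x y z
    using L that by (auto simp: little_cancellation_def)
  have a: "a \<in> L" "a \<in> carrier G" using snoc.prems LC by auto
  have la: "len a \<noteq> 0" using a LC len_eq_0 by auto
  show ?case
  proof (cases "w = []")
    case True
    have "prod_list_G [a] = a" using a by (simp add: prod_list_G_def)
    moreover have "Suc (gp (inv a) c) \<le> len a" if "c \<in> L" "a \<otimes> c \<noteq> \<one>" for c
      using N1(1)[OF a(1) that] la by arith
    ultimately show ?thesis using True la by simp
  next
    case False
    let ?g = "prod_list_G w" and ?l = "last w"
    have g: "?g \<in> carrier G" using snoc.prems LC by (intro prod_list_G_carrier) auto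
    have l: "?l \<in> L" using snoc.prems False by auto
    have la1: "?l \<otimes> a \<noteq> \<one>" "successively (\<lambda>a b. a \<otimes> b \<noteq> \<one>) w"
      using snoc.prems False by (auto simp: successively_append_iff)
    have IH: "gp (inv ?g) a = gp (inv ?l) a" "length w + gp (inv ?l) a \<le> len ?g"
      using snoc.IH[OF _ la1(2) False] a la1 snoc.prems by auto
    have len1: "len (?g \<otimes> a) + 2 * gp (inv ?l) a = len ?g + len a"
      using len_quotient[of "inv ?g" a] g a IH by simp
    have cancel: "gp (inv (?g \<otimes> a)) (inv a) + gp (inv ?l) a = len a"
      using gp_right_cancel[OF g a(2)] IH by simp
    have *: "gp (inv (?g \<otimes> a)) c = gp (inv a) c \<and> length (w @ [a]) + gp (inv a) c \<le> len (?g \<otimes> a)"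
      if c: "c \<in> L" "a \<otimes> c \<noteq> \<one>" for c
    proof -
      have n2: "gp (inv ?l) a + gp (inv a) c < len a"
        using N2[OF l a(1) c(1) la1(1) c(2)] .
      then have "gp (inv a) c < gp (inv a) (inv (?g \<otimes> a))"
        using cancel by (simp add: gp_commute)
      from gp_isosceles[OF this] show ?thesis
        using n2 len1 IH by simp
    qed
    have "gp (inv ?l) a < len a"
      using N1(2)[OF l a(1) la1(1)] la by arith
    then have "length (w @ [a]) \<le> len (?g \<otimes> a)"
      using len1 IH by simp
    with * show ?thesis by (simp add: prod_list_G_snoc)
  qed
qed

text \<open>Write the basis element as a shortest product of elements of \<open>L\<close>. It has length one,
  so by \<open>little_cancellation_product\<close> there is only one factor.\<close>

lemma little_cancellation_basis:
  assumes L: "little_cancellation L" and inv: "\<And>a. a \<in> L \<Longrightarrow> inv a \<in> L"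
    and gen: "b \<in> generate G L" and b: "b \<in> B"
  shows "b \<in> L"
proof -
  have LC: "L \<subseteq> carrier G" using L by (auto simp: little_cancellation_def)
  have "\<exists>w. set w \<subseteq> L \<and> prod_list_G w = b"
    using gen
  proof (induction rule: generate.induct)
    case one show ?case by (intro exI[of _ "[]"]) (auto simp: prod_list_G_def)
  next
    case (incl h) then show ?case using LC by (intro exI[of _ "[h]"]) (auto simp: prod_list_G_def)
  next
    case (inv h) then show ?case using LC assms(2) by (intro exI[of _ "[inv h]"]) (auto simp: prod_list_G_def)
  next
    case (eng h1 h2)
    then obtain w1 w2 where "set w1 \<subseteq> L" "prod_list_G w1 = h1" "set w2 \<subseteq> L" "prod_list_G w2 = h2"
      by blast
    then show ?case using LC by (intro exI[of _ "w1 @ w2"]) (auto simp: prod_list_G_append)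
  qed
  then obtain w0 where "set w0 \<subseteq> L \<and> prod_list_G w0 = b" ..
  from ex_has_least_nat[of "\<lambda>w. set w \<subseteq> L \<and> prod_list_G w = b", OF this, of length]
  obtain w where w: "set w \<subseteq> L" "prod_list_G w = b"
    and min: "\<And>v. set v \<subseteq> L \<Longrightarrow> prod_list_G v = b \<Longrightarrow> length w \<le> length v"
    by auto
  have succ: "successively (\<lambda>a b. a \<otimes> b \<noteq> \<one>) w"
    unfolding successively_conv_nth
  proof (intro allI impI notI)
    fix i assume i: "Suc i < length w" and eq: "w ! i \<otimes> w ! Suc i = \<one>"
    have split: "w = take i w @ [w ! i, w ! Suc i] @ drop (Suc (Suc i)) w"
      using i by (metis Cons_nth_drop_Suc Suc_lessD append_Cons append_Nil id_take_nth_drop)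
    have c: "set (take i w) \<subseteq> L" "set (drop (Suc (Suc i)) w) \<subseteq> L" "w ! i \<in> L" "w ! Suc i \<in> L"
      using w i by (auto dest: in_set_takeD in_set_dropD)
    have "prod_list_G w = prod_list_G (take i w) \<otimes> (prod_list_G [w ! i, w ! Suc i] \<otimes> prod_list_G (drop (Suc (Suc i)) w))"
      by (subst split, subst prod_list_G_append, use c LC in force, use c LC in force,
          subst prod_list_G_append, use c LC in force, use c LC in force, rule HOL.refl)
    also have "prod_list_G [w ! i, w ! Suc i] = \<one>"
      using eq c LC by (auto simp: prod_list_G_def)
    also have "prod_list_G (take i w) \<otimes> (\<one> \<otimes> prod_list_G (drop (Suc (Suc i)) w)) =
        prod_list_G (take i w @ drop (Suc (Suc i)) w)"
      using c LC prod_list_G_carrier[of "drop (Suc (Suc i)) w"] by (subst prod_list_G_append) auto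
    finally have "length w \<le> length (take i w @ drop (Suc (Suc i)) w)"
      using c w by (intro min) auto
    then show False using i by simp
  qed
  have "w \<noteq> []"
  proof
    assume "w = []"
    then have "b = \<one>" using w by (simp add: prod_list_G_def)
    then show False using len_basis[OF b] len_eq_0[of b] by simp
  qed
  with little_cancellation_product[OF L w(1) succ] w len_basis[OF b] have "length w = 1"
    by (cases w) auto
  then obtain a where "w = [a]" by (cases w) auto
  then show ?thesis using w LC by (auto simp: prod_list_G_def)
qed

lemma word_value_quotient_len:
  assumes "set v \<subseteq> B \<times> UNIV" "set w \<subseteq> B \<times> UNIV"
  shows "len (inv (word_value G v) \<otimes> word_value G w) \<le> length v + length w"
  using len_word_le[of "word_inv v @ w"] assms set_word_inv[OF assms(1)]
  by (simp add: word_value_append word_value_inv)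

text \<open>If the middle factor of \<open>d\<^sup>-\<^sup>1 b d\<close> is eaten up completely from both sides, then
  \<open>b = p q\<^sup>-\<^sup>1\<close> and \<open>d = q w p\<^sup>-\<^sup>1\<close>, and \<open>(b, b d)\<close> is conjugate by \<open>p\<close> to the shorter
  pair \<open>(q\<^sup>-\<^sup>1 p, w)\<close>.\<close>

lemma shorter_conjugate_pair:
  assumes c: "b \<in> carrier G" "d \<in> carrier G" and gen: "generate G {b, d} = carrier G"
    and h: "gp (inv d) b = h" "gp (inv b) d = h" "len b = 2 * h" "2 * h \<le> len d"
  shows "\<exists>x y. nielsen G (b, d) (x, y) \<and> len x + len y \<le> len d"
proof -
  define P where "P = take h (nf b)"
  define Q where "Q = take h (nf (inv b))"
  have lb: "length (nf b) = 2 * h" using h by (simp add: len_def)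
  have ld: "length (nf d) = len d" by (simp add: len_def)
  have nfb: "nf b = P @ word_inv Q"
  proof -
    have "word_inv Q = drop h (nf b)"
      using lb c by (simp add: Q_def nf_inv take_word_inv)
    then show ?thesis by (simp add: P_def)
  qed
  have td: "take h (nf d) = Q"
    using take_lcp[of h "nf (inv b)" "nf d"] h by (simp add: gp_def Q_def)
  have ti: "take h (nf (inv d)) = P"
    using take_lcp[of h "nf (inv d)" "nf b"] h by (simp add: gp_def P_def)
  define W where "W = drop h (take (len d - h) (nf d))"
  have nfd: "nf d = Q @ W @ word_inv P"
  proof -
    have "word_inv P = drop (len d - h) (nf d)"
      unfolding ti[symmetric] using c ld by (simp add: nf_inv take_word_inv)
    moreover have "take (len d - h) (nf d) = Q @ W"
    proof -
      have "take h (take (len d - h) (nf d)) = Q"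
      proof -
        have "h \<le> len d - h" using h(4) by arith
        then show ?thesis by (simp add: td[symmetric] min_def)
      qed
      then show ?thesis unfolding W_def by (metis append_take_drop_id)
    qed
    ultimately show ?thesis by (metis append_assoc append_take_drop_id)
  qed
  have s: "set P \<subseteq> B \<times> UNIV" "set Q \<subseteq> B \<times> UNIV" "set W \<subseteq> B \<times> UNIV"
    using nf(1)[OF c(1)] nf(1)[OF c(2)] unfolding nfb nfd by (auto simp: P_def dest: in_set_takeD)
  define p q w where "p = word_value G P" and "q = word_value G Q" and "w = word_value G W"
  have pc: "p \<in> carrier G" "q \<in> carrier G" "w \<in> carrier G"
    using s by (auto simp: p_def q_def w_def)
  have b: "b = p \<otimes> inv q"
    using nf(3)[OF c(1)] s set_word_inv[OF s(2)] unfolding nfb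
    by (simp add: word_value_append word_value_inv p_def q_def)
  have d: "d = q \<otimes> w \<otimes> inv p"
    using nf(3)[OF c(2)] s set_word_inv[OF s(1)] pc unfolding nfd
    by (simp add: word_value_append word_value_inv p_def q_def w_def m_assoc)
  have bd: "b \<otimes> d = p \<otimes> w \<otimes> inv p"
    unfolding b d using pc by (simp add: m_assoc flip: m_assoc[of "inv q" q])
  have "inv p \<in> generate G {b, b \<otimes> d}"
  proof -
    have "carrier G \<subseteq> generate G {b, b \<otimes> d}"
      using nielsen_generate[OF nielsen_mult2[OF nielsen.refl c] c] gen by simp
    then show ?thesis using pc by blast
  qed
  from nielsen_conj[OF this] have
    "nielsen G (b, b \<otimes> d) (inv p \<otimes> b \<otimes> inv (inv p), inv p \<otimes> (b \<otimes> d) \<otimes> inv (inv p))"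
    using c by simp
  also have "inv p \<otimes> b \<otimes> inv (inv p) = inv q \<otimes> p"
    unfolding b using pc by (simp add: m_assoc flip: m_assoc[of "inv p" p])
  also have "inv p \<otimes> (b \<otimes> d) \<otimes> inv (inv p) = w"
    unfolding bd using pc by (simp add: m_assoc flip: m_assoc[of "inv p" p])
  finally have "nielsen G (b, d) (inv q \<otimes> p, w)"
    using nielsen_trans nielsen_mult2[OF nielsen.refl c] by blast
  moreover have "len (inv q \<otimes> p) \<le> 2 * h"
    using word_value_quotient_len[OF s(2,1)] lb nfb by (simp add: p_def q_def)
  moreover have "len w \<le> len d - 2 * h"
    using len_word_le[OF s(3)] ld by (simp add: w_def W_def)
  ultimately show ?thesis using h(4) by (intro exI[of _ "inv q \<otimes> p"] exI[of _ w]) auto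
qed

text \<open>Among all Nielsen equivalent pairs, take one of minimal total length. Minimality gives the first
  condition of little cancellation directly. If the second failed, then the lengths would be as in
  \<open>shorter_conjugate_pair\<close>, which yields a shorter pair, or a square would cancel too much
  (\<open>gp_square\<close>). Hence the basis lies in the set of the elements of the pair and their inverses.\<close>

lemma nielsen_basis:
  assumes uv: "u \<in> carrier G" "v \<in> carrier G" and gen: "generate G {u, v} = carrier G"
  obtains x y where "nielsen G (u, v) (x, y)" "x \<in> carrier G" "y \<in> carrier G"
    "B \<subseteq> {x, inv x, y, inv y}"
proof -
  define M where "M p = len (fst p) + len (snd p)" for p
  obtain p where p: "nielsen G (u, v) p" and min: "\<And>q. nielsen G (u, v) q \<Longrightarrow> M p \<le> M q"
    using ex_has_least_nat[of "nielsen G (u, v)", OF nielsen.refl, of M] by auto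
  define minp where "minp x y \<longleftrightarrow> nielsen G (u, v) (x, y) \<and> M (x, y) = M p" for x y
  have car: "x \<in> carrier G" "y \<in> carrier G" if "minp x y" for x y
    using nielsen_carrier[of u v "(x, y)"] that uv by (auto simp: minp_def)
  have le: "M (x, y) \<le> M q" if "minp x y" "nielsen G (x, y) q" for x y q
    using that min nielsen_trans[of G "(x, y)" q "(u, v)"] by (auto simp: minp_def)
  have sym: "minp y x" if "minp x y" for x y
    using that nielsen.swap by (auto simp: minp_def M_def)
  have inv1: "minp (inv x) y" if "minp x y" for x y
    using that nielsen.inv car[OF that] by (auto simp: minp_def M_def)
  have inv2: "minp x (inv y)" if "minp x y" for x y
    using sym inv1 that by blast
  have N1: "2 * gp (inv a) b \<le> len a \<and> 2 * gp (inv a) b \<le> len b" if m: "minp a b" for a b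
  proof -
    note c = car[OF m]
    have "len b \<le> len (a \<otimes> b)" "len a \<le> len (a \<otimes> b)"
      using le[OF m nielsen_mult2[OF nielsen.refl c]] le[OF m nielsen.mult[OF nielsen.refl]]
      by (auto simp: M_def)
    then show ?thesis
      using len_quotient[of "inv a" b] c by simp
  qed
  have key: "gp (inv d) b + gp (inv b) c < len b"
    if m: "minp b d" and c: "c = d \<or> c = inv d" and b1: "b \<noteq> \<one>" for b c d
  proof (rule ccontr)
    note bd = car[OF m]
    assume ge: "\<not> ?thesis"
    define h where "h = gp (inv d) b"
    have n1: "2 * gp (inv d) b \<le> len b" "2 * gp (inv d) b \<le> len d"
      using N1[OF sym[OF m]] by auto
    have n2: "2 * gp (inv b) c \<le> len b"
      using N1[OF m] N1[OF inv2[OF m]] c by auto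
    have h: "gp (inv d) b = h" "gp (inv b) c = h" "len b = 2 * h" "2 * h \<le> len d"
      using ge n1 n2 by (auto simp: h_def)
    show False
      using c
    proof
      assume "c = d"
      then obtain x y where xy: "nielsen G (b, d) (x, y)" "len x + len y \<le> len d"
        using shorter_conjugate_pair[OF bd _ h(1) _ h(3,4)] h(2) gen
          nielsen_generate[of u v "(b, d)"] m uv generate_incl[of "{b, d}"] bd
        by (auto simp: minp_def)
      from le[OF m xy(1)] xy(2) have "len b = 0" by (simp add: M_def)
      then show False using b1 bd len_eq_0 by simp
    next
      assume "c = inv d"
      then have "h \<le> gp (inv b) b"
        using gp_ultrametric[of "inv b" "inv d" b] h by simp
      then show False using gp_square[of b] b1 bd h by simp
    qed
  qed
  obtain x y where p_eq: "p = (x, y)" by force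
  have m: "minp x y" using p by (simp add: minp_def p_eq)
  note xy = car[OF m]
  define L where "L = {x, inv x, y, inv y} - {\<one>}"
  have pairs: "a = b \<or> a = inv b \<or> minp a b" if "a \<in> L" "b \<in> L" for a b
    using that m sym inv1 inv2 xy unfolding L_def by (auto; metis inv_inv)
  have N1': "2 * gp (inv a) b \<le> len a \<and> 2 * gp (inv a) b \<le> len b"
    if "a \<in> L" "b \<in> L" "a \<otimes> b \<noteq> \<one>" for a b
  proof -
    have ac: "a \<in> carrier G" "b \<in> carrier G" "a \<noteq> \<one>" using that xy by (auto simp: L_def)
    then have "a = b \<or> minp a b" using pairs[OF that(1,2)] that(3) by auto
    then show ?thesis using N1[of a b] gp_square[of a] ac by auto
  qed
  have N2': "gp (inv a) b + gp (inv b) c < len b"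
    if abc: "a \<in> L" "b \<in> L" "c \<in> L" "a \<otimes> b \<noteq> \<one>" "b \<otimes> c \<noteq> \<one>" for a b c
  proof -
    have ac: "a \<in> carrier G" "b \<in> carrier G" "c \<in> carrier G" "a \<noteq> \<one>" "b \<noteq> \<one>"
      using that xy by (auto simp: L_def)
    have sq: "2 * gp (inv b) b < len b" using gp_square ac by blast
    show ?thesis
    proof (cases "a = b \<or> c = b")
      case True
      then show ?thesis
        using sq N1'[OF abc(1,2,4)] N1'[OF abc(2,3,5)] by auto
    next
      case False
      have "a \<noteq> inv b" "c \<noteq> inv b" using abc ac by auto
      then have "minp b a" "c = a \<or> c = inv a"
        using False abc pairs[OF abc(1,2)] sym ac xy unfolding L_def by auto
      from key[OF this ac(5)] show ?thesis .
    qed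
  qed
  have LC: "little_cancellation L"
    unfolding little_cancellation_def using N1' N2' xy by (auto simp: L_def)
  have Linv: "inv a \<in> L" if "a \<in> L" for a
    using that xy by (auto simp: L_def)
  have "carrier G \<subseteq> generate G L"
  proof -
    have "z \<in> generate G L" if "z \<in> {x, y}" for z
      using that generate.one[of G L] generate.incl[of z L G] by (cases "z = \<one>") (auto simp: L_def)
    then have "generate G {x, y} \<subseteq> generate G L"
      using xy by (intro generate_mono_elems) (auto simp: L_def)
    then show ?thesis
      using nielsen_generate[of u v "(x, y)"] m uv gen by (auto simp: minp_def)
  qed
  then have "B \<subseteq> L"
    using little_cancellation_basis[OF LC Linv] basis_carrier by blast
  then show ?thesis using that[of x y] m xy by (auto simp: minp_def L_def)
qed

end

section \<open>The fundamental group of a topological space\<close>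

definition based_loop :: "'a topology \<Rightarrow> 'a \<Rightarrow> (real \<Rightarrow> 'a) \<Rightarrow> bool" where
  "based_loop X x c \<longleftrightarrow> pathin X c \<and> c 0 = x \<and> c 1 = x"

definition loop_class :: "'a topology \<Rightarrow> 'a \<Rightarrow> (real \<Rightarrow> 'a) \<Rightarrow> (real \<Rightarrow> 'a) set" where
  "loop_class X x c = {d. based_homotopic X x c d}"

lemma based_homotopic_loops:
  assumes "based_homotopic X x c d"
  shows "based_loop X x c" "based_loop X x d"
  using assms unfolding based_homotopic_def based_loop_def pathin_def
  by (auto dest: homotopic_with_imp_continuous_maps homotopic_with_imp_property)

lemma based_homotopic_eqI:
  assumes "based_loop X x c" "\<And>t. t \<in> {0..1} \<Longrightarrow> c t = d t"
  shows "based_homotopic X x c d"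
  unfolding based_homotopic_def
  using assms by (intro homotopic_with_equal) (auto simp: based_loop_def pathin_def)

lemma based_homotopic_refl: "based_loop X x c \<Longrightarrow> based_homotopic X x c c"
  by (rule based_homotopic_eqI) auto

lemma based_homotopic_sym: "based_homotopic X x c d \<Longrightarrow> based_homotopic X x d c"
  unfolding based_homotopic_def by (rule homotopic_with_symD)

lemma based_homotopic_trans:
  "based_homotopic X x c d \<Longrightarrow> based_homotopic X x d e \<Longrightarrow> based_homotopic X x c e"
  unfolding based_homotopic_def by (rule homotopic_with_trans)

lemma based_homotopic_imp_freely:
  "based_homotopic X x c d \<Longrightarrow> freely_homotopic X c d"
  unfolding based_homotopic_def freely_homotopic_def by (erule homotopic_with_mono) auto

lemma loop_class_eq_iff:
  assumes "based_loop X x c"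
  shows "loop_class X x c = loop_class X x d \<longleftrightarrow> based_homotopic X x c d"
  using based_homotopic_refl[OF assms] based_homotopic_sym[of X x] based_homotopic_trans[of X x]
  unfolding loop_class_def by blast

lemma loop_class_eqI:
  assumes "based_homotopic X x c d" shows "loop_class X x c = loop_class X x d"
  using assms based_homotopic_loops(1)[OF assms] by (simp add: loop_class_eq_iff)

lemma loop_class_self: "based_loop X x c \<Longrightarrow> c \<in> loop_class X x c"
  by (simp add: loop_class_def based_homotopic_refl)

lemma based_loop_map:
  assumes "continuous_map X Y h" "based_loop X x c" "h x = y"
  shows "based_loop Y y (h \<circ> c)"
  using assms by (auto simp: based_loop_def pathin_def intro: continuous_map_compose)

lemma based_homotopic_map:
  assumes "continuous_map X Y h" "based_homotopic X x c d" "h x = y"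
  shows "based_homotopic Y y (h \<circ> c) (h \<circ> d)"
  using assms(2) unfolding based_homotopic_def
  by (rule homotopic_with_compose_continuous_map_left[OF _ assms(1)]) (use assms(3) in auto)

lemma freely_homotopic_map:
  assumes "continuous_map X Y h" "freely_homotopic X c d"
  shows "freely_homotopic Y (h \<circ> c) (h \<circ> d)"
  using assms(2) unfolding freely_homotopic_def
  by (rule homotopic_with_compose_continuous_map_left[OF _ assms(1)]) auto

text \<open>Two ways of running along the same path are homotopic, since the parameter interval is
  convex. All group laws are instances of this.\<close>

lemma based_homotopic_reparam:
  assumes c: "pathin X c"
    and "continuous_on {0..1} \<phi>" "\<phi> ` {0..1} \<subseteq> {0..1}"
    and "continuous_on {0..1} \<psi>" "\<psi> ` {0..1} \<subseteq> {0..1}"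
    and "\<phi> 0 = \<psi> 0" "\<phi> 1 = \<psi> 1" "c (\<phi> 0) = x" "c (\<phi> 1) = x"
  shows "based_homotopic X x (c \<circ> \<phi>) (c \<circ> \<psi>)"
proof -
  have "homotopic_with (\<lambda>k. k 0 = \<phi> 0 \<and> k 1 = \<phi> 1) (top_of_set {0..1}) (top_of_set {0..1::real}) \<phi> \<psi>"
    unfolding homotopic_with_def
  proof (intro exI[of _ "\<lambda>(s, t). (1 - s) * \<phi> t + s * \<psi> t"] conjI allI ballI)
    have "continuous_on ({0..1} \<times> {0..1}) (\<lambda>z::real \<times> real. \<phi> (snd z))"
      by (rule continuous_on_compose2[OF assms(2) continuous_on_snd[OF continuous_on_id]]) auto
    moreover have "continuous_on ({0..1} \<times> {0..1}) (\<lambda>z::real \<times> real. \<psi> (snd z))"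
      by (rule continuous_on_compose2[OF assms(4) continuous_on_snd[OF continuous_on_id]]) auto
    ultimately have "continuous_on ({0..1} \<times> {0..1}) (\<lambda>(s, t). (1 - s) * \<phi> t + s * \<psi> t)"
      unfolding case_prod_beta by (intro continuous_intros)
    moreover have "(1 - s) * \<phi> t + s * \<psi> t \<in> {0..1}" if "s \<in> {0..1}" "t \<in> {0..1}" for s t
      using convexD_alt[OF convex_real_interval(5)[of 0 1], of "\<phi> t" "\<psi> t" s] assms that
      by (auto simp: image_subset_iff)
    ultimately show "continuous_map (prod_topology (top_of_set {0..1}) (top_of_set {0..1}))
        (top_of_set {0..1}) (\<lambda>(s, t). (1 - s) * \<phi> t + s * \<psi> t)"
      by (auto simp: prod_topology_subtopology_eu continuous_map_subtopology_eu image_subset_iff Pi_iff)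
  qed (use assms in \<open>auto simp: algebra_simps\<close>)
  then show ?thesis
    unfolding based_homotopic_def
    by (rule homotopic_with_compose_continuous_map_left) (use assms in \<open>auto simp: pathin_def\<close>)
qed

lemma continuous_map_join_loops:
  assumes c: "continuous_map (prod_topology Z (top_of_set {0..1})) X (\<lambda>(s, t). h s t)"
    and d: "continuous_map (prod_topology Z (top_of_set {0..1})) X (\<lambda>(s, t). k s t)"
    and eq: "\<And>s. s \<in> topspace Z \<Longrightarrow> h s 1 = k s 0"
  shows "continuous_map (prod_topology Z (top_of_set {0..1})) X (\<lambda>(s, t). join_loops (h s) (k s) t)"
proof -
  let ?P = "prod_topology Z (top_of_set {0..1::real})"
  have snd: "continuous_map (subtopology ?P S) (top_of_set {0..1}) (\<lambda>z. f (snd z))"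
    if "continuous_on {0..1} f" "\<And>z. z \<in> S \<Longrightarrow> snd z \<in> {0..1} \<Longrightarrow> f (snd z) \<in> {0..1}" for f :: "real \<Rightarrow> real" and S
  proof (intro continuous_map_into_subtopology)
    have "continuous_map (top_of_set {0..1}) euclideanreal f" using that by simp
    from continuous_map_compose[OF continuous_map_snd this, of Z]
    show "continuous_map (subtopology ?P S) euclidean (\<lambda>z. f (snd z))"
      by (simp add: o_def continuous_map_from_subtopology)
    show "(\<lambda>z. f (snd z)) \<in> topspace (subtopology ?P S) \<rightarrow> {0..1}"
      using that(2) by auto
  qed
  have fst: "continuous_map (subtopology ?P S) Z fst" for S
    by (simp add: continuous_map_from_subtopology continuous_map_fst)
  have "continuous_map ?P X (\<lambda>z. if snd z \<le> 1/2 then h (fst z) (2 * snd z)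
          else k (fst z) (2 * snd z - 1))"
  proof (rule continuous_map_cases_le)
    show "continuous_map ?P euclideanreal snd"
      by (meson continuous_map_into_fulltopology continuous_map_snd)
    show "continuous_map (subtopology ?P {x \<in> topspace ?P. snd x \<le> 1/2}) X (\<lambda>z. h (fst z) (2 * snd z))"
    proof -
      have "continuous_map (subtopology ?P {x \<in> topspace ?P. snd x \<le> 1/2}) ?P (\<lambda>z. (fst z, 2 * snd z))"
        by (intro continuous_map_pairedI fst snd continuous_intros) auto
      from continuous_map_compose[OF this c] show ?thesis by (simp add: o_def)
    qed
    show "continuous_map (subtopology ?P {x \<in> topspace ?P. 1/2 \<le> snd x}) X (\<lambda>z. k (fst z) (2 * snd z - 1))"
    proof -
      have "continuous_map (subtopology ?P {x \<in> topspace ?P. 1/2 \<le> snd x}) ?P (\<lambda>z. (fst z, 2 * snd z - 1))"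
        by (intro continuous_map_pairedI fst snd continuous_intros) auto
      from continuous_map_compose[OF this d] show ?thesis by (simp add: o_def)
    qed
  next
    fix z assume "z \<in> topspace ?P" and z: "snd z = 1/2"
    then have "fst z \<in> topspace Z" by auto
    then show "h (fst z) (2 * snd z) = k (fst z) (2 * snd z - 1)"
      using eq unfolding z by simp
  qed simp
  then show ?thesis
    by (simp add: join_loops_def case_prod_unfold)
qed

lemma based_homotopicD:
  assumes "based_homotopic X x c d"
  shows "\<exists>h. continuous_map (prod_topology (top_of_set {0..1::real}) (top_of_set {0..1::real})) X h \<and>
      (\<forall>t. h (0, t) = c t) \<and> (\<forall>t. h (1, t) = d t) \<and> (\<forall>s\<in>{0..1}. h (s, 0) = x \<and> h (s, 1) = x)"
  using assms unfolding based_homotopic_def homotopic_with_def .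

lemma based_homotopic_join:
  assumes "based_homotopic X x c c'" "based_homotopic X x d d'"
  shows "based_homotopic X x (join_loops c d) (join_loops c' d')"
proof -
  obtain h where h: "continuous_map (prod_topology (top_of_set {0..1::real}) (top_of_set {0..1::real})) X h"
    "\<forall>t. h (0, t) = c t" "\<forall>t. h (1, t) = c' t" "\<forall>s\<in>{0..1}. h (s, 0) = x \<and> h (s, 1) = x"
    using based_homotopicD[OF assms(1)] by blast
  obtain k where k: "continuous_map (prod_topology (top_of_set {0..1::real}) (top_of_set {0..1::real})) X k"
    "\<forall>t. k (0, t) = d t" "\<forall>t. k (1, t) = d' t" "\<forall>s\<in>{0..1}. k (s, 0) = x \<and> k (s, 1) = x"
    using based_homotopicD[OF assms(2)] by blast
  show ?thesis
    unfolding based_homotopic_def homotopic_with_def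
  proof (intro exI[of _ "\<lambda>(s, t). join_loops (\<lambda>t. h (s, t)) (\<lambda>t. k (s, t)) t"] conjI allI ballI)
    show "continuous_map (prod_topology (top_of_set {0..1}) (top_of_set {0..1})) X
        (\<lambda>(s, t). join_loops (\<lambda>t. h (s, t)) (\<lambda>t. k (s, t)) t)"
      by (rule continuous_map_join_loops) (use h k in auto)
  qed (use h k in \<open>auto simp: join_loops_def\<close>)
qed

lemma based_loop_join:
  "based_loop X x c \<Longrightarrow> based_loop X x d \<Longrightarrow> based_loop X x (join_loops c d)"
  using based_homotopic_join based_homotopic_refl based_homotopic_loops by metis

lemma map_join_loops: "h \<circ> join_loops c d = join_loops (h \<circ> c) (h \<circ> d)"
  by (auto simp: join_loops_def)

definition rev_loop :: "(real \<Rightarrow> 'a) \<Rightarrow> real \<Rightarrow> 'a" where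
  "rev_loop c = c \<circ> (\<lambda>t. 1 - t)"

lemma based_loop_rev:
  assumes "based_loop X x c" shows "based_loop X x (rev_loop c)"
proof -
  have "continuous_map (top_of_set {0..1}) (top_of_set {0..1}) (\<lambda>t::real. 1 - t)"
    by (auto simp: continuous_map_in_subtopology intro!: continuous_intros)
  from continuous_map_compose[OF this, of X c] assms show ?thesis
    by (simp add: based_loop_def pathin_def rev_loop_def)
qed

lemma based_homotopic_rev:
  assumes "based_homotopic X x c d"
  shows "based_homotopic X x (rev_loop c) (rev_loop d)"
  using assms unfolding based_homotopic_def rev_loop_def
  by (rule homotopic_with_compose_continuous_map_right)
    (auto intro!: continuous_intros)

lemma based_loop_const: "x \<in> topspace X \<Longrightarrow> based_loop X x (\<lambda>_. x)"
  by (simp add: based_loop_def pathin_def)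

lemma join_loops_assoc:
  assumes "based_loop X x c" "based_loop X x d" "based_loop X x e"
  shows "based_homotopic X x (join_loops (join_loops c d) e) (join_loops c (join_loops d e))"
proof -
  let ?z = "join_loops c (join_loops d e)"
  let ?\<phi> = "\<lambda>t::real. min (2 * t) (min (t + 1/4) ((t + 1) / 2))"
  have z: "based_loop X x ?z" using assms by (intro based_loop_join)
  have "based_homotopic X x (?z \<circ> ?\<phi>) (?z \<circ> (\<lambda>t. t))"
    using z by (intro based_homotopic_reparam continuous_intros) (auto simp: based_loop_def min_def)
  moreover have "based_homotopic X x (join_loops (join_loops c d) e) (?z \<circ> ?\<phi>)"
  proof (rule based_homotopic_eqI)
    show "based_loop X x (join_loops (join_loops c d) e)"
      using assms by (intro based_loop_join)
    fix t :: real assume t: "t \<in> {0..1}"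
    consider "t \<le> 1/4" | "1/4 < t" "t \<le> 1/2" | "1/2 < t" by linarith
    then show "join_loops (join_loops c d) e t = (?z \<circ> ?\<phi>) t"
    proof cases
      case 1
      then have "?\<phi> t = 2 * t" by (auto simp: min_def)
      then show ?thesis using 1 by (simp add: join_loops_def)
    next
      case 2
      then have "?\<phi> t = t + 1/4" by (auto simp: min_def)
      then show ?thesis using 2 by (simp add: join_loops_def algebra_simps)
    next
      case 3
      then have "?\<phi> t = (t + 1) / 2" using t by (auto simp: min_def)
      then show ?thesis using 3 by (simp add: join_loops_def field_simps)
    qed
  qed
  ultimately show ?thesis using based_homotopic_trans[of X x _ "?z \<circ> ?\<phi>" ?z] by (simp add: o_def)
qed

lemma join_loops_const:
  assumes "based_loop X x c"
  shows "based_homotopic X x (join_loops (\<lambda>_. x) c) c"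
proof -
  let ?\<phi> = "\<lambda>t::real. max 0 (2 * t - 1)"
  have x: "x \<in> topspace X" using assms unfolding based_loop_def pathin_def
    by (metis atLeastAtMost_iff continuous_map_funspace funcset_mem order_refl topspace_euclidean_subtopology zero_le_one)
  have "based_homotopic X x (c \<circ> ?\<phi>) (c \<circ> (\<lambda>t. t))"
    using assms by (intro based_homotopic_reparam continuous_intros) (auto simp: based_loop_def)
  moreover have "based_homotopic X x (join_loops (\<lambda>_. x) c) (c \<circ> ?\<phi>)"
    by (rule based_homotopic_eqI[OF based_loop_join[OF based_loop_const[OF x] assms]])
      (use assms in \<open>auto simp: join_loops_def based_loop_def max_absorb1 max_absorb2\<close>)
  ultimately show ?thesis using based_homotopic_trans[of X x _ "c \<circ> ?\<phi>" c] by (simp add: o_def)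
qed

lemma join_loops_rev:
  assumes "based_loop X x c"
  shows "based_homotopic X x (join_loops (rev_loop c) c) (\<lambda>_. x)"
proof -
  let ?\<phi> = "\<lambda>t::real. \<bar>1 - 2 * t\<bar>"
  have 1: "based_homotopic X x (c \<circ> ?\<phi>) (c \<circ> (\<lambda>t. 1))"
    using assms by (intro based_homotopic_reparam continuous_intros) (auto simp: based_loop_def)
  have "based_homotopic X x (join_loops (rev_loop c) c) (c \<circ> ?\<phi>)"
    by (rule based_homotopic_eqI[OF based_loop_join[OF based_loop_rev[OF assms] assms]])
      (auto simp: join_loops_def rev_loop_def abs_if)
  note 2 = this
  have "c \<circ> (\<lambda>t. 1) = (\<lambda>_. x)" using assms by (auto simp: based_loop_def)
  from based_homotopic_trans[OF 2 1[unfolded this]] show ?thesis .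
qed

lemma fundamental_group_carrier:
  "carrier (fundamental_group X x) = {loop_class X x c | c. based_loop X x c}"
  by (auto simp: fundamental_group_def loop_class_def based_loop_def)

lemma fundamental_group_one: "\<one>\<^bsub>fundamental_group X x\<^esub> = loop_class X x (\<lambda>_. x)"
  by (simp add: fundamental_group_def loop_class_def)

lemma fundamental_group_mult:
  assumes "based_loop X x c" "based_loop X x d"
  shows "loop_class X x c \<otimes>\<^bsub>fundamental_group X x\<^esub> loop_class X x d = loop_class X x (join_loops c d)"
proof -
  have "(\<exists>c1\<in>loop_class X x c. \<exists>c2\<in>loop_class X x d. based_homotopic X x (join_loops c1 c2) e)
      \<longleftrightarrow> based_homotopic X x (join_loops c d) e" (is "?l \<longleftrightarrow> ?r") for e
  proof
    assume ?l
    then obtain c1 c2 where "based_homotopic X x c c1" "based_homotopic X x d c2"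
      "based_homotopic X x (join_loops c1 c2) e" by (auto simp: loop_class_def)
    then show ?r by (metis based_homotopic_join based_homotopic_trans)
  next
    assume ?r
    then show ?l using loop_class_self[OF assms(1)] loop_class_self[OF assms(2)] by blast
  qed
  then show ?thesis by (simp add: fundamental_group_def loop_class_def)
qed

lemma fundamental_group_is_group:
  assumes "x \<in> topspace X"
  shows "group (fundamental_group X x)"
proof (rule groupI)
  let ?G = "fundamental_group X x"
  show "\<one>\<^bsub>?G\<^esub> \<in> carrier ?G"
    using based_loop_const[OF assms] unfolding fundamental_group_one fundamental_group_carrier by blast
  show "a \<otimes>\<^bsub>?G\<^esub> b \<in> carrier ?G" if "a \<in> carrier ?G" "b \<in> carrier ?G" for a b
    using that based_loop_join fundamental_group_mult unfolding fundamental_group_carrier by fastforce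
  show "a \<otimes>\<^bsub>?G\<^esub> b \<otimes>\<^bsub>?G\<^esub> c = a \<otimes>\<^bsub>?G\<^esub> (b \<otimes>\<^bsub>?G\<^esub> c)"
    if abc: "a \<in> carrier ?G" "b \<in> carrier ?G" "c \<in> carrier ?G" for a b c
  proof -
    obtain a' b' c' where "a = loop_class X x a'" "b = loop_class X x b'" "c = loop_class X x c'"
      and l: "based_loop X x a'" "based_loop X x b'" "based_loop X x c'"
      using abc unfolding fundamental_group_carrier by blast
    then show ?thesis
      using loop_class_eqI[OF join_loops_assoc[OF l]]
      by (simp only: fundamental_group_mult based_loop_join)
  qed
  show "\<one>\<^bsub>?G\<^esub> \<otimes>\<^bsub>?G\<^esub> a = a" if "a \<in> carrier ?G" for a
    using that unfolding fundamental_group_carrier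
    by (clarsimp simp: fundamental_group_mult fundamental_group_one based_loop_const[OF assms])
      (rule loop_class_eqI[OF join_loops_const])
  show "\<exists>b\<in>carrier ?G. b \<otimes>\<^bsub>?G\<^esub> a = \<one>\<^bsub>?G\<^esub>" if a: "a \<in> carrier ?G" for a
  proof -
    obtain c where c: "a = loop_class X x c" "based_loop X x c"
      using a unfolding fundamental_group_carrier by blast
    show ?thesis
      using c based_loop_rev[OF c(2)] loop_class_eqI[OF join_loops_rev[OF c(2)]]
      by (intro bexI[of _ "loop_class X x (rev_loop c)"])
        (auto simp only: fundamental_group_mult fundamental_group_one fundamental_group_carrier mem_Collect_eq)
  qed
qed

lemma based_loop_topspace: "based_loop X x c \<Longrightarrow> x \<in> topspace X"
  unfolding based_loop_def pathin_def
  by (metis atLeastAtMost_iff continuous_map_funspace funcset_mem order_refl topspace_euclidean_subtopology zero_le_one)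

lemma fundamental_group_inv:
  assumes "based_loop X x c"
  shows "inv\<^bsub>fundamental_group X x\<^esub> loop_class X x c = loop_class X x (rev_loop c)"
proof -
  interpret group "fundamental_group X x"
    by (rule fundamental_group_is_group[OF based_loop_topspace[OF assms]])
  show ?thesis
    using assms based_loop_rev[OF assms] loop_class_eqI[OF join_loops_rev[OF assms]]
    by (intro inv_equality) (auto simp only: fundamental_group_mult fundamental_group_one
        fundamental_group_carrier mem_Collect_eq)
qed

text \<open>Stated for representatives, which avoids the induced homomorphism of fundamental groups.\<close>

lemma fundamental_group_generate_map:
  assumes h: "continuous_map X Y h" "h x = y" and c: "based_loop X x c" "based_loop X x d"
    and gen: "\<alpha> \<in> generate (fundamental_group X x) {loop_class X x c, loop_class X x d}"
    and e: "e \<in> \<alpha>"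
  shows "loop_class Y y (h \<circ> e) \<in>
    generate (fundamental_group Y y) {loop_class Y y (h \<circ> c), loop_class Y y (h \<circ> d)}"
proof -
  let ?G = "fundamental_group X x" and ?H = "fundamental_group Y y"
  interpret G: group ?G by (rule fundamental_group_is_group[OF based_loop_topspace[OF c(1)]])
  have y: "y \<in> topspace Y"
    using based_loop_topspace[OF based_loop_map[OF h(1) c(1) h(2)]] .
  interpret H: group ?H by (rule fundamental_group_is_group[OF y])
  let ?L = "{loop_class Y y (h \<circ> c), loop_class Y y (h \<circ> d)}"
  have cls: "loop_class Y y (h \<circ> e) = loop_class Y y (h \<circ> e')" if "based_homotopic X x e e'" for e e'
    using based_homotopic_map[OF h(1) that h(2)]
    by (metis based_homotopic_loops(1) loop_class_eq_iff)
  have mem: "loop_class Y y (h \<circ> e) = loop_class Y y (h \<circ> e')" if "e \<in> loop_class X x e'" for e e'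
    using cls[of e' e] that by (simp add: loop_class_def)
  from gen have "\<forall>e\<in>\<alpha>. loop_class Y y (h \<circ> e) \<in> generate ?H ?L"
  proof (induction rule: generate.induct)
    case one
    have "loop_class Y y (h \<circ> e) = \<one>\<^bsub>?H\<^esub>" if "e \<in> loop_class X x (\<lambda>_. x)" for e
      using mem[OF that] h by (simp add: fundamental_group_one o_def)
    then show ?case unfolding fundamental_group_one[of X] using generate.one[of ?H ?L] by (metis (no_types))
  next
    case (incl a)
    then obtain c' where "c' \<in> {c, d}" "a = loop_class X x c'" by blast
    then have "loop_class Y y (h \<circ> e) = loop_class Y y (h \<circ> c')" if "e \<in> a" for e
      using mem[of e c'] that by (simp only:)
    moreover have "loop_class Y y (h \<circ> c') \<in> generate ?H ?L"
      using \<open>c' \<in> {c, d}\<close> by (intro generate.incl) blast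
    ultimately show ?case by (intro ballI) (simp only: simp_thms)
  next
    case (inv a)
    have *: "loop_class Y y (h \<circ> rev_loop c') = inv\<^bsub>?H\<^esub> loop_class Y y (h \<circ> c')" if "based_loop X x c'" for c'
      using fundamental_group_inv[OF based_loop_map[OF h(1) that h(2)]] by (simp add: rev_loop_def o_assoc)
    from inv obtain c' where c': "c' \<in> {c, d}" "a = loop_class X x c'" by blast
    then have l: "based_loop X x c'" using c by blast
    then have "loop_class Y y (h \<circ> e) = inv\<^bsub>?H\<^esub> loop_class Y y (h \<circ> c')"
      if "e \<in> inv\<^bsub>?G\<^esub> a" for e
      using mem[of e "rev_loop c'"] that by (simp only: c'(2) fundamental_group_inv[OF l] * [OF l])
    moreover have "inv\<^bsub>?H\<^esub> loop_class Y y (h \<circ> c') \<in> generate ?H ?L"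
      using c' by (intro generate.inv) blast
    ultimately show ?case by (intro ballI) (simp only: simp_thms)
  next
    case (eng a b)
    have "a \<in> carrier ?G" "b \<in> carrier ?G"
      using eng.hyps G.generate_in_carrier[of "{loop_class X x c, loop_class X x d}"] c
      unfolding fundamental_group_carrier by blast+
    then obtain a' b' where ab: "a = loop_class X x a'" "based_loop X x a'"
       "b = loop_class X x b'" "based_loop X x b'"
      unfolding fundamental_group_carrier by blast
    have "loop_class Y y (h \<circ> join_loops a' b') = loop_class Y y (h \<circ> a') \<otimes>\<^bsub>?H\<^esub> loop_class Y y (h \<circ> b')"
      unfolding map_join_loops
      by (rule fundamental_group_mult[OF based_loop_map[OF h(1) ab(2) h(2)] based_loop_map[OF h(1) ab(4) h(2)], symmetric])
    also have "\<dots> \<in> generate ?H ?L"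
      by (rule generate.eng[OF bspec[OF eng.IH(1)] bspec[OF eng.IH(2)]])
        (simp_all only: ab(1,3) loop_class_self[OF ab(2)] loop_class_self[OF ab(4)])
    finally have *: "loop_class Y y (h \<circ> join_loops a' b') \<in> generate ?H ?L" .
    show ?case
    proof (intro ballI)
      fix e assume "e \<in> a \<otimes>\<^bsub>?G\<^esub> b"
      then have "e \<in> loop_class X x (join_loops a' b')"
        using ab by (simp only: fundamental_group_mult)
      from mem[OF this] *
      show "loop_class Y y (h \<circ> e) \<in> generate ?H ?L" by (simp only:)
    qed
  qed
  with e show ?thesis by blast
qed

section \<open>The torus and its cellular subsets\<close>

definition torus_set :: "(complex \<times> complex) set" where
  "torus_set = sphere 0 1 \<times> sphere 0 1"

lemma torus_eq: "torus = top_of_set torus_set"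
  by (simp add: torus_def torus_set_def)

lemma topspace_torus: "topspace torus = torus_set"
  by (simp add: torus_eq)

lemma compact_torus: "compact torus_set"
  by (simp add: torus_set_def compact_Times)

definition torus_point :: "complex \<Rightarrow> complex \<times> complex" where
  "torus_point z = (cis (2 * pi * Re z), cis (2 * pi * Im z))"

lemma torus_point_in: "torus_point z \<in> torus_set"
  by (simp add: torus_point_def torus_set_def)

lemma continuous_on_torus_point: "continuous_on S torus_point"
  unfolding torus_point_def cis_conv_exp by (intro continuous_intros)

lemma cis_2pi_eq_iff: "cis (2 * pi * x) = cis (2 * pi * y) \<longleftrightarrow> x - y \<in> \<int>"
proof
  assume "cis (2 * pi * x) = cis (2 * pi * y)"
  then have "sin (2 * pi * x) = sin (2 * pi * y) \<and> cos (2 * pi * x) = cos (2 * pi * y)"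
    by (simp add: complex_eq_iff)
  then obtain n where "2 * pi * x = 2 * pi * y + 2 * pi * of_int n"
    using sin_cos_eq_iff by blast
  then have "2 * pi * (x - y) = 2 * pi * of_int n" by (simp add: algebra_simps)
  then have "x - y = of_int n" by simp
  then show "x - y \<in> \<int>" by simp
next
  assume "x - y \<in> \<int>"
  then obtain n where "x = y + of_int n" by (auto elim!: Ints_cases simp: algebra_simps)
  then show "cis (2 * pi * x) = cis (2 * pi * y)"
    by (simp add: distrib_left flip: cis_mult)
qed

lemma torus_point_eq_iff:
  "torus_point z = torus_point w \<longleftrightarrow> Re z - Re w \<in> \<int> \<and> Im z - Im w \<in> \<int>"
  by (simp add: torus_point_def cis_2pi_eq_iff)

lemma norm_period_ge_1:
  assumes "Re z \<in> \<int>" "Im z \<in> \<int>" "z \<noteq> 0"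
  shows "norm z \<ge> 1"
proof -
  have "\<bar>Re z\<bar> \<ge> 1 \<or> \<bar>Im z\<bar> \<ge> 1"
    using assms Ints_nonzero_abs_ge1 by (auto simp: complex_eq_iff)
  then show ?thesis using abs_Re_le_cmod[of z] abs_Im_le_cmod[of z] by linarith
qed

text \<open>The inverse of the covering map near \<open>torus_point z\<close> that takes values near \<open>z\<close>. Rotating by
  the coordinates of \<open>torus_point z\<close> first moves the discontinuity of \<open>Arg\<close> to the opposite points.\<close>

definition torus_lift :: "complex \<Rightarrow> complex \<times> complex \<Rightarrow> complex" where
  "torus_lift z x = z + Complex (Arg (fst x * cis (- (2 * pi * Re z))) / (2 * pi))
     (Arg (snd x * cis (- (2 * pi * Im z))) / (2 * pi))"

lemma torus_point_lift:
  assumes "x \<in> torus_set" shows "torus_point (torus_lift z x) = x"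
proof -
  have *: "cis (2 * pi * (a + Arg (u * cis (- (2 * pi * a))) / (2 * pi))) = u" if "norm u = 1" for a u
  proof -
    have "cis (Arg (u * cis (- (2 * pi * a)))) = u * cis (- (2 * pi * a))"
      using that by (subst cis_Arg) (auto simp: sgn_eq norm_mult)
    then have "cis (2 * pi * a) * cis (Arg (u * cis (- (2 * pi * a)))) = u"
      by (simp add: cis_mult mult.left_commute)
    then show ?thesis by (simp add: cis_mult distrib_left)
  qed
  show ?thesis
    using assms by (cases x) (auto simp: torus_point_def torus_lift_def torus_set_def *)
qed

lemma torus_lift_point: "torus_lift z (torus_point z) = z"
  by (simp add: torus_lift_def torus_point_def cis_mult complex_eq_iff)

definition lift_domain :: "complex \<Rightarrow> (complex \<times> complex) set" where
  "lift_domain z = {x. fst x * cis (- (2 * pi * Re z)) \<in> - \<real>\<^sub>\<le>\<^sub>0 \<and> snd x * cis (- (2 * pi * Im z)) \<in> - \<real>\<^sub>\<le>\<^sub>0}"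

lemma open_lift_domain: "open (lift_domain z)"
  unfolding lift_domain_def
  by (intro open_Collect_conj open_vimage[unfolded vimage_def] continuous_intros open_Compl closed_nonpos_Reals_complex)

lemma continuous_on_torus_lift: "continuous_on (lift_domain z) (torus_lift z)"
  unfolding torus_lift_def lift_domain_def Complex_eq
  by (intro continuous_intros continuous_on_compose2[OF continuous_on_Arg]) auto

lemma torus_point_in_lift_domain: "torus_point z \<in> lift_domain z"
  by (simp add: torus_point_def lift_domain_def cis_mult)

lemma torus_point_open_map:
  assumes "open S" shows "openin (top_of_set torus_set) (torus_point ` S)"
proof (subst openin_subopen, intro ballI)
  fix x assume "x \<in> torus_point ` S"
  then obtain z where z: "z \<in> S" "x = torus_point z" by blast
  let ?W = "lift_domain z \<inter> torus_lift z -` S"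
  have "open ?W"
    by (rule continuous_open_preimage[OF continuous_on_torus_lift open_lift_domain assms])
  then have "openin (top_of_set torus_set) (torus_set \<inter> ?W)" by auto
  moreover have "x \<in> torus_set \<inter> ?W"
    using z by (simp add: torus_point_in torus_point_in_lift_domain torus_lift_point)
  moreover have "torus_set \<inter> ?W \<subseteq> torus_point ` S"
    using torus_point_lift by (metis Int_iff image_eqI subsetI vimageE)
  ultimately show "\<exists>T. openin (top_of_set torus_set) T \<and> x \<in> T \<and> T \<subseteq> torus_point ` S" by blast
qed

lemma torus_point_homeomorphic:
  assumes "open D" "inj_on torus_point D"
  shows "D homeomorphic torus_point ` D"
proof -
  obtain g where "homeomorphism D (torus_point ` D) torus_point g"
  proof (rule homeomorphism_injective_open_map[OF continuous_on_torus_point HOL.refl assms(2)])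
    fix U assume "openin (top_of_set D) U"
    then have "open U" using assms(1) openin_open_trans by blast
    then have "openin (top_of_set torus_set) (torus_point ` U)" by (rule torus_point_open_map)
    moreover have "torus_point ` U \<subseteq> torus_point ` D" "torus_point ` D \<subseteq> torus_set"
      using openin_imp_subset[OF \<open>openin (top_of_set D) U\<close>] torus_point_in by auto
    ultimately show "openin (top_of_set (torus_point ` D)) (torus_point ` U)"
      by (meson openin_subset_trans)
  qed
  then show ?thesis unfolding homeomorphic_def by blast
qed

text \<open>On a contractible set the coordinates have continuous logarithms, which lift it to the plane.\<close>

lemma lift_contractible:
  assumes K: "K \<subseteq> torus_set" "compact K" "contractible K"
  obtains L where "K homeomorphic L" "inj_on torus_point L" "torus_point ` L = K"
proof -
  have nz: "fst x \<noteq> 0" "snd x \<noteq> 0" "norm (fst x) = 1" "norm (snd x) = 1" if "x \<in> K" for x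
    using that K(1) by (auto simp: torus_set_def)
  obtain g1 where g1: "continuous_on K g1" "\<And>x. x \<in> K \<Longrightarrow> fst x = exp (g1 x)"
    by (rule continuous_logarithm_on_contractible[OF continuous_on_fst[OF continuous_on_id] K(3) nz(1)])
      (auto intro: that)
  obtain g2 where g2: "continuous_on K g2" "\<And>x. x \<in> K \<Longrightarrow> snd x = exp (g2 x)"
    by (rule continuous_logarithm_on_contractible[OF continuous_on_snd[OF continuous_on_id] K(3) nz(2)])
      (auto intro: that)
  define l where "l x = Complex (Im (g1 x) / (2 * pi)) (Im (g2 x) / (2 * pi))" for x
  have re: "Re (g1 x) = 0" "Re (g2 x) = 0" if "x \<in> K" for x
    using nz(3,4)[OF that] g1(2)[OF that] g2(2)[OF that] by (metis norm_exp_eq_Re exp_eq_one_iff)+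
  have l: "torus_point (l x) = x" if "x \<in> K" for x
    using that g1(2)[OF that] g2(2)[OF that] re[OF that]
    by (cases x) (auto simp: torus_point_def l_def exp_eq_polar)
  have "continuous_on K l"
    unfolding l_def Complex_eq by (intro continuous_intros g1 g2) auto
  moreover have "inj_on l K" using l by (metis inj_onI)
  ultimately have "K homeomorphic l ` K"
    using K(2) by (meson homeomorphic_compact)
  moreover have "inj_on torus_point (l ` K)" using l by (auto simp: inj_on_def)
  moreover have "torus_point ` l ` K = K" using l by force
  ultimately show ?thesis using that by blast
qed

text \<open>A compact connected set that does not separate the plane has arbitrarily small simply connected
  neighbourhoods: every point outside the neighbourhood \<open>N\<close> is joined to infinity by a closed connected
  set that avoids \<open>L\<close>; finitely many of these sets suffice, and the component of \<open>L\<close> in the complement of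
  their union has a connected unbounded complement. By the Riemann mapping theorem it is a disc.\<close>

lemma planar_disc_neighbourhood:
  fixes L N :: "complex set"
  assumes L: "compact L" "connected L" "L \<noteq> {}" "connected (- L)" and N: "open N" "L \<subseteq> N"
  obtains D where "open D" "L \<subseteq> D" "D \<subseteq> N" "D homeomorphic ball (0::complex) 1"
proof -
  obtain r where r: "r > 0" "L \<subseteq> ball 0 r"
    using bounded_subset_ballD[OF compact_imp_bounded[OF L(1)]] by blast
  define F where "F = cball 0 r - N"
  have F: "compact F" "F \<subseteq> - L"
    using N by (auto simp: F_def compact_diff)
  have oE: "open (- L)" using L(1) by (simp add: compact_imp_closed open_Compl)
  have pc: "path_connected (- L)"
    using L(4) oE connected_open_path_connected by blast

  have sph: "sphere 0 r \<subseteq> - L" using r by auto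
  define a where "a = complex_of_real r"
  have a: "a \<in> sphere 0 r" using r by (simp add: a_def)
  have "\<exists>T. x \<in> interior T \<and> compact T \<and> connected T \<and> a \<in> T \<and> T \<subseteq> - L" if x: "x \<in> - L" for x
  proof -
    obtain e where e: "e > 0" "cball x e \<subseteq> - L" using x oE open_contains_cball by blast
    obtain g where g: "path g" "path_image g \<subseteq> - L" "pathstart g = x" "pathfinish g = a"
      using pc x a sph unfolding path_connected_def by blast
    show ?thesis
    proof (intro exI conjI)
      show "x \<in> interior (cball x e \<union> path_image g)"
        using e by (metis centre_in_ball interior_cball interior_mono subsetD sup_ge1)
      show "connected (cball x e \<union> path_image g)"
      proof (rule connected_Un)
        have "x \<in> cball x e \<inter> path_image g" using e g pathstart_in_path_image[of g] by simp
        then show "cball x e \<inter> path_image g \<noteq> {}" by blast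
      qed (use g in \<open>auto simp: connected_path_image\<close>)
      show "a \<in> cball x e \<union> path_image g" using g pathfinish_in_path_image[of g] by auto
    qed (use e g in \<open>auto simp: compact_path_image\<close>)
  qed
  then obtain T where T: "\<And>x. x \<in> - L \<Longrightarrow> x \<in> interior (T x) \<and> compact (T x) \<and> connected (T x) \<and> a \<in> T x \<and> T x \<subseteq> - L"
    by metis
  obtain X where X: "X \<subseteq> F" "finite X" "F \<subseteq> (\<Union>x\<in>X. interior (T x))"
  proof -
    have "F \<subseteq> (\<Union>x\<in>F. interior (T x))" using T F(2) by blast
    from compactE_image[OF F(1) open_interior this] show ?thesis using that by metis
  qed
  \<comment> \<open>A closed connected set that contains everything outside \<open>N\<close> and stays away from \<open>L\<close>.\<close>
  define L1 where "L1 = {z. r \<le> norm z} \<union> (\<Union>x\<in>X. T x)"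
  have conn0: "connected {z::complex. r \<le> norm z}"
  proof -
    have "{z::complex. r \<le> norm z} = - ball 0 r" by (auto simp: not_less)
    then show ?thesis by (simp add: connected_complement_bounded_convex)
  qed
  have "L1 = \<Union>(insert {z. r \<le> norm z} ((\<lambda>x. {z. r \<le> norm z} \<union> T x) ` X))"
    by (auto simp: L1_def)
  also have "connected \<dots>"
  proof (rule connected_Union)
    show "connected S" if "S \<in> insert {z. r \<le> norm z} ((\<lambda>x. {z. r \<le> norm z} \<union> T x) ` X)" for S
    proof -
      have "connected ({z. r \<le> norm z} \<union> T x)" if x: "x \<in> X" for x
      proof (rule connected_Un[OF conn0])
        have Tx: "connected (T x)" "a \<in> T x" using T[of x] x X(1) F(2) by auto
        then show "connected (T x)" by blast
        have "a \<in> {z. r \<le> norm z} \<inter> T x" using Tx a by auto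
        then show "{z. r \<le> norm z} \<inter> T x \<noteq> {}" by blast
      qed
      then show ?thesis using that conn0 by blast
    qed
    have "a \<in> \<Inter> (insert {z. r \<le> norm z} ((\<lambda>x. {z. r \<le> norm z} \<union> T x) ` X))"
      using a by auto
    then show "\<Inter> (insert {z. r \<le> norm z} ((\<lambda>x. {z. r \<le> norm z} \<union> T x) ` X)) \<noteq> {}"
      by blast
  qed
  finally have cL1: "connected L1" .
  have "closed (T x)" if "x \<in> X" for x
    using T[of x] that X(1) F(2) by (intro compact_imp_closed) blast
  then have "closed L1"
    unfolding L1_def using X(2)
    by (intro closed_Un closed_UN closed_Collect_le continuous_intros) auto
  then have oW: "open (- L1)" by (simp add: open_Compl)
  have LW: "L \<subseteq> - L1" using r X(1) T F(2) by (force simp: L1_def)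
  have WN: "- L1 \<subseteq> N"
  proof
    fix z assume z: "z \<in> - L1"
    then have "z \<in> cball 0 r" by (auto simp: L1_def)
    moreover have "z \<notin> F" using z X(3) interior_subset unfolding L1_def by fastforce
    ultimately show "z \<in> N" by (simp add: F_def)
  qed
  obtain x where x: "x \<in> L" using L(3) by blast
  define D where "D = connected_component_set (- L1) x"
  have Dc: "D \<in> components (- L1)" unfolding D_def components_def using x LW by blast
  have oD: "open D" unfolding D_def by (rule open_connected_component[OF oW])
  have LD: "L \<subseteq> D" unfolding D_def by (rule connected_component_maximal[OF x L(2) LW])
  have DL: "D \<subseteq> - L1" unfolding D_def by (rule connected_component_subset)
  have "simply_connected D"
    unfolding simply_connected_eq_unbounded_complement_components[OF oD]
  proof
    show "connected D" by (simp add: D_def connected_connected_component)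
    have "connected (- D)" by (rule component_complement_connected[OF cL1 Dc])
    moreover have "- D \<noteq> {}" using DL a by (auto simp: L1_def)
    ultimately have "components (- D) = {- D}" by (simp add: components_eq_sing_iff)
    moreover have "\<not> bounded (- D)"
    proof
      assume "bounded (- D)"
      moreover have "{z. r \<le> norm z} \<subseteq> - D" using DL by (auto simp: L1_def)
      ultimately have "bounded {z::complex. r \<le> norm z}" using bounded_subset by blast
      then obtain B where "\<And>z::complex. r \<le> norm z \<Longrightarrow> norm z \<le> B" by (auto simp: bounded_iff)
      from this[of "of_real (max r (B + 1))"] show False using r by auto
    qed
    ultimately show "\<forall>C\<in>components (- D). \<not> bounded C" by simp
  qed
  then have "D homeomorphic ball (0::complex) 1"
    using simply_connected_eq_homeomorphic_to_disc[OF oD] LD L(3) by blast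
  then show ?thesis using that[OF oD LD _ ] DL WN by blast
qed

text \<open>The notion of M. Brown, for sets in a surface \<open>T\<close>: such a set can be collapsed without changing
  the surface.\<close>

definition cellular :: "'a::topological_space set \<Rightarrow> 'a set \<Rightarrow> bool" where
  "cellular T K \<longleftrightarrow> (\<forall>U. open U \<and> K \<subseteq> U \<longrightarrow>
     (\<exists>D. K \<subseteq> D \<and> D \<subseteq> U \<and> openin (top_of_set T) D \<and> D homeomorphic ball (0::complex) 1))"

text \<open>A thin neighbourhood of \<open>L\<close> in the plane is mapped injectively to the torus, because
  differences of points of \<open>L\<close> have a positive distance from the nonzero periods.\<close>

lemma cellular_torus:
  assumes L: "compact L" "connected L" "L \<noteq> {}" "connected (- L)" "inj_on torus_point L"
  shows "cellular torus_set (torus_point ` L)"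
  unfolding cellular_def
proof (intro allI impI)
  fix U assume U: "open U \<and> torus_point ` L \<subseteq> U"
  \<comment> \<open>the nonzero periods\<close>
  define P where "P = {z. torus_point z = torus_point 0 \<and> norm z \<ge> 1}"
  have "closed P"
  proof -
    have "P = torus_point -` {torus_point 0} \<inter> {z. norm z \<ge> 1}" by (auto simp: P_def)
    then show ?thesis
      by (auto intro!: closed_Int closed_vimage closed_Collect_le continuous_intros continuous_on_torus_point)
  qed
  define M where "M = (\<lambda>(x, y). x - y) ` (L \<times> L)"
  have "compact M"
    unfolding M_def case_prod_beta using L(1)
    by (intro compact_continuous_image continuous_intros compact_Times)
  have "M \<inter> P = {}"
  proof (rule equals0I)
    fix z assume "z \<in> M \<inter> P"
    then obtain x y where xy: "x \<in> L" "y \<in> L" "z = x - y" "torus_point z = torus_point 0" "norm z \<ge> 1"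
      by (auto simp: M_def P_def)
    then have "torus_point x = torus_point y" by (simp add: torus_point_eq_iff)
    then have "x = y" using L(5) xy by (auto dest: inj_onD)
    then show False using xy by simp
  qed
  then obtain d where d: "d > 0" "\<And>z w. z \<in> M \<Longrightarrow> w \<in> P \<Longrightarrow> d \<le> dist z w"
    using separate_compact_closed[OF \<open>compact M\<close> \<open>closed P\<close>] by blast
  define N where "N = (\<Union>x\<in>L. ball x (d / 3)) \<inter> torus_point -` U"
  have "open N"
    unfolding N_def using U by (intro open_Int open_UN open_vimage continuous_on_torus_point) auto
  moreover have "L \<subseteq> N" using U d by (force simp: N_def)
  ultimately obtain D where D: "open D" "L \<subseteq> D" "D \<subseteq> N" "D homeomorphic ball (0::complex) 1"
    using planar_disc_neighbourhood[OF L(1-4)] by metis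
  have "inj_on torus_point D"
  proof (rule inj_onI, rule ccontr)
    fix z w assume zw: "z \<in> D" "w \<in> D" "torus_point z = torus_point w" "z \<noteq> w"
    then have "z \<in> (\<Union>x\<in>L. ball x (d / 3))" "w \<in> (\<Union>x\<in>L. ball x (d / 3))"
      using D(3) unfolding N_def by blast+
    then obtain x y where xy: "x \<in> L" "dist x z < d / 3" "y \<in> L" "dist y w < d / 3"
      unfolding UN_iff mem_ball by blast
    have "z - w \<in> P"
      using zw norm_period_ge_1[of "z - w"] by (auto simp: P_def torus_point_eq_iff)
    moreover have "x - y \<in> M" using xy by (force simp: M_def)
    ultimately have "d \<le> dist (x - y) (z - w)" using d by blast
    also have "\<dots> \<le> dist x z + dist y w"
      using norm_triangle_ineq4[of "x - z" "y - w"] by (simp add: dist_norm algebra_simps)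
    finally show False using xy d by simp
  qed
  from torus_point_homeomorphic[OF D(1) this] have "torus_point ` D homeomorphic ball (0::complex) 1"
    using D(4) homeomorphic_sym homeomorphic_trans by blast
  then show "\<exists>D'. torus_point ` L \<subseteq> D' \<and> D' \<subseteq> U \<and> openin (top_of_set torus_set) D' \<and> D' homeomorphic ball (0::complex) 1"
    using D torus_point_open_map[OF D(1)] by (intro exI[of _ "torus_point ` D"]) (auto simp: N_def)
qed

lemma cellular_disc_torus:
  assumes "K \<subseteq> torus_set" "K homeomorphic cball (0::complex) 1"
  shows "cellular torus_set K" "compact K" "K \<noteq> {}"
proof -
  have K: "compact K" using homeomorphic_compactness[OF assms(2)] by simp
  show "compact K" by fact
  show "K \<noteq> {}" using assms(2) by (auto simp: homeomorphic_empty)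
  have "contractible K"
    using homeomorphic_contractible_eq[OF assms(2)] convex_imp_contractible[OF convex_cball] by blast
  then obtain L where L: "K homeomorphic L" "inj_on torus_point L" "torus_point ` L = K"
    using lift_contractible[OF assms(1) K] by blast
  have Lh: "L homeomorphic cball (0::complex) 1"
    using L(1) assms(2) homeomorphic_sym homeomorphic_trans by blast
  have "connected (- L)"
    using connected_complement_homeomorphic_convex_compact[OF Lh] by simp
  moreover have "compact L" "connected L"
    using homeomorphic_compactness[OF Lh] homeomorphic_connectedness[OF Lh] convex_connected[OF convex_cball]
    by simp_all
  moreover have "L \<noteq> {}" using L(3) \<open>K \<noteq> {}\<close> by auto
  ultimately show "cellular torus_set K"
    using cellular_torus[of L] L by simp
qed

lemma cellular_point_torus:
  assumes "p \<in> torus_set" shows "cellular torus_set {p}"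
proof -
  have "torus_point (torus_lift 0 p) = p" using assms by (rule torus_point_lift)
  moreover have "connected (- {torus_lift 0 p})"
    by (rule connected_punctured_universe) simp
  ultimately show ?thesis using cellular_torus[of "{torus_lift 0 p}"] by simp
qed

text \<open>The factor of a radial homeomorphism of the disc that is the identity near the boundary and
  scales the disc of radius \<open>r\<close> by \<open>a\<close>.\<close>

definition shrink_factor :: "real \<Rightarrow> real \<Rightarrow> real \<Rightarrow> real" where
  "shrink_factor a r t = (let R = (1 + r) / 2 in
     a + (1 - a) * max 0 (min 1 ((t - r) / (R - r))))"

lemma shrink_factor:
  assumes "0 < a" "a \<le> 1" "0 < r" "r < 1"
  shows "t \<le> r \<Longrightarrow> shrink_factor a r t = a"
    and "(1 + r) / 2 \<le> t \<Longrightarrow> shrink_factor a r t = 1"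
    and "s \<le> t \<Longrightarrow> shrink_factor a r s \<le> shrink_factor a r t"
    and "0 < shrink_factor a r t"
    and "continuous_on UNIV (shrink_factor a r)"
proof -
  show "shrink_factor a r t = a" if "t \<le> r"
  proof -
    have "(t - r) / ((1 + r) / 2 - r) \<le> 0" using that assms by (simp add: divide_nonpos_pos field_simps)
    then show ?thesis by (simp add: shrink_factor_def Let_def max_def min_def)
  qed
  show "shrink_factor a r t = 1" if "(1 + r) / 2 \<le> t"
  proof -
    have "1 \<le> (t - r) / ((1 + r) / 2 - r)" using that assms by (simp add: field_simps)
    then show ?thesis by (simp add: shrink_factor_def Let_def)
  qed
  show "shrink_factor a r s \<le> shrink_factor a r t" if "s \<le> t"
  proof -
    have "(s - r) / ((1 + r) / 2 - r) \<le> (t - r) / ((1 + r) / 2 - r)"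
      using that assms by (intro divide_right_mono) auto
    then show ?thesis
      unfolding shrink_factor_def Let_def using assms
      by (intro add_left_mono mult_left_mono max.mono min.mono order_refl) auto
  qed
  have "0 \<le> (1 - a) * max 0 (min 1 ((t - r) / ((1 + r) / 2 - r)))" using assms by simp
  then show "0 < shrink_factor a r t" unfolding shrink_factor_def Let_def using assms(1) by linarith
  show "continuous_on UNIV (shrink_factor a r)"
    unfolding shrink_factor_def Let_def using assms by (intro continuous_intros) auto
qed

definition shrink_disc :: "real \<Rightarrow> real \<Rightarrow> complex \<Rightarrow> complex" where
  "shrink_disc a r z = of_real (shrink_factor a r (norm z)) * z"

lemma shrink_disc:
  assumes ar: "0 < a" "a \<le> 1" "0 < r" "r < 1"
  shows "continuous_on UNIV (shrink_disc a r)" "inj (shrink_disc a r)"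
    and "shrink_disc a r ` ball 0 1 = ball 0 1"
    and "\<And>z. (1 + r) / 2 \<le> norm z \<Longrightarrow> shrink_disc a r z = z"
    and "\<And>z. norm z \<le> r \<Longrightarrow> norm (shrink_disc a r z) \<le> a"
proof -
  note f = shrink_factor[OF ar]
  have norm: "norm (shrink_disc a r z) = norm z * shrink_factor a r (norm z)" for z
    using f(4)[of "norm z"] by (simp add: shrink_disc_def norm_mult)
  have mono: "s * shrink_factor a r s < t * shrink_factor a r t" if "0 \<le> s" "s < t" for s t
  proof -
    have "s * shrink_factor a r s < t * shrink_factor a r s"
      using that f(4)[of s] by (intro mult_strict_right_mono) auto
    also have "\<dots> \<le> t * shrink_factor a r t"
      using that f(3)[of s t] by (intro mult_left_mono) auto
    finally show ?thesis .
  qed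
  show "continuous_on UNIV (shrink_disc a r)"
    unfolding shrink_disc_def by (intro continuous_intros continuous_on_compose2[OF f(5)]) auto
  show inj: "inj (shrink_disc a r)"
  proof (rule injI)
    fix z w assume eq: "shrink_disc a r z = shrink_disc a r w"
    then have "norm z * shrink_factor a r (norm z) = norm w * shrink_factor a r (norm w)"
      using norm by metis
    then have "norm z = norm w"
      using mono[of "norm z" "norm w"] mono[of "norm w" "norm z"] by (metis less_irrefl linorder_neqE_linordered_idom norm_ge_zero)
    then show "z = w" using eq f(4)[of "norm w"] by (auto simp: shrink_disc_def)
  qed
  show far: "shrink_disc a r z = z" if "(1 + r) / 2 \<le> norm z" for z
    using f(2)[OF that] by (simp add: shrink_disc_def)
  show "norm (shrink_disc a r z) \<le> a" if "norm z \<le> r" for z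
    unfolding norm f(1)[OF that] using that ar mult_right_mono[of "norm z" 1 a] by simp
  show "shrink_disc a r ` ball 0 1 = ball 0 1"
  proof
    show "shrink_disc a r ` ball 0 1 \<subseteq> ball 0 1"
      using mono[of _ 1] f(2)[of 1] ar by (auto simp: norm)
    show "ball 0 1 \<subseteq> shrink_disc a r ` ball 0 1"
    proof
      fix w :: complex assume w: "w \<in> ball 0 1"
      have "\<exists>t\<ge>0. t \<le> 1 \<and> t * shrink_factor a r t = norm w"
        by (rule IVT') (use w f(2)[of 1] ar in \<open>auto intro!: continuous_intros continuous_on_subset[OF f(5)]\<close>)
      then obtain t where t: "0 \<le> t" "t \<le> 1" "t * shrink_factor a r t = norm w" by blast
      have "t < 1" using t w f(2)[of 1] ar by (cases "t = 1") auto
      show "w \<in> shrink_disc a r ` ball 0 1"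
      proof (cases "w = 0")
        case True then show ?thesis by (intro image_eqI[of _ _ 0]) (auto simp: shrink_disc_def)
      next
        case False
        define z where "z = of_real (t / norm w) * w"
        have nz: "norm z = t" using False t(1) by (simp add: z_def norm_mult norm_divide)
        have one: "shrink_factor a r t * (t / norm w) = 1" using t False by (simp add: field_simps)
        have "shrink_disc a r z = of_real (shrink_factor a r t * (t / norm w)) * w"
          unfolding shrink_disc_def nz by (simp only: z_def of_real_mult mult.assoc)
        then have "shrink_disc a r z = w" unfolding one by simp
        then show ?thesis using nz \<open>t < 1\<close> by (intro image_eqI[of _ _ z]) auto
      qed
    qed
  qed
qed

text \<open>Read in the disc \<open>D\<close>, the compact set \<open>C\<close> lies in a smaller concentric disc, which is scaled
  down until its image in \<open>T\<close> is small; the extension by the identity is continuous because the scaling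
  is the identity near the boundary of \<open>D\<close>.\<close>

lemma squeeze_into_ball:
  fixes T :: "'a::metric_space set"
  assumes T: "compact T" and D: "openin (top_of_set T) D" "D homeomorphic ball (0::complex) 1"
    and C: "compact C" "C \<subseteq> D" and e: "e > 0"
  obtains g p where "continuous_on T g" "bij_betw g T T" "\<And>x. x \<in> T - D \<Longrightarrow> g x = x" "g ` D = D"
    "g ` C \<subseteq> ball p e"
proof -
  obtain k k' where h: "homeomorphism D (ball (0::complex) 1) k k'"
    using D(2) unfolding homeomorphic_def by blast
  note hc = homeomorphism_cont1[OF h] homeomorphism_cont2[OF h]
  note hi = homeomorphism_image1[OF h] homeomorphism_image2[OF h]
  note ha = homeomorphism_apply1[OF h] homeomorphism_apply2[OF h]
  have DT: "D \<subseteq> T" using D(1) openin_imp_subset by blast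
  have "compact (k ` C)"
    by (intro compact_continuous_image continuous_on_subset[OF hc(1) C(2)] C(1))
  moreover have "k ` C \<subseteq> ball 0 1" using hi C by blast
  ultimately obtain r where r: "0 < r" "r < 1" "k ` C \<subseteq> cball 0 r"
  proof (cases "k ` C = {}")
    case True then show ?thesis using that[of "1/2"] by auto
  next
    case False
    obtain z where z: "z \<in> k ` C" "\<And>w. w \<in> k ` C \<Longrightarrow> norm w \<le> norm z"
      using continuous_attains_sup[OF \<open>compact (k ` C)\<close> False, of norm] by (auto intro: continuous_intros)
    have "norm z < 1" using z(1) \<open>k ` C \<subseteq> ball 0 1\<close> by auto
    then show ?thesis using that[of "(1 + norm z) / 2"] z(2) by (force simp: norm_ge_zero add_pos_nonneg)
  qed
  have "continuous (at 0) k'"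
    using hc(2) by (simp add: continuous_on_eq_continuous_at)
  then obtain d where d: "d > 0" "\<And>z. dist z 0 < d \<Longrightarrow> dist (k' z) (k' 0) < e"
    using e unfolding continuous_at_eps_delta by blast
  define a where "a = min 1 (d / 2)"
  have a: "0 < a" "a \<le> 1" "a < d" using d by (auto simp: a_def)
  note s = shrink_disc[OF a(1,2) r(1,2)]
  define g where "g x = (if x \<in> D then k' (shrink_disc a r (k x)) else x)" for x
  have gD: "g ` D = D"
  proof -
    have "g ` D = k' ` (shrink_disc a r ` (k ` D))" by (auto simp: g_def image_image)
    then show ?thesis using hi s(3) by simp
  qed
  define M where "M = k' ` cball 0 ((1 + r) / 2)"
  have sub: "cball (0::complex) ((1 + r) / 2) \<subseteq> ball 0 1" using r by auto
  have M: "compact M" "M \<subseteq> D"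
  proof -
    show "compact M"
      unfolding M_def by (rule compact_continuous_image[OF continuous_on_subset[OF hc(2) sub] compact_cball])
    show "M \<subseteq> D" unfolding M_def using hi(2) sub by blast
  qed
  have gM: "g x = x" if "x \<notin> M" for x
  proof (cases "x \<in> D")
    case True
    then have "k x \<notin> cball 0 ((1 + r) / 2)" using that ha(1)[OF True] unfolding M_def by (metis image_eqI)
    then show ?thesis using True s(4)[of "k x"] ha(1)[OF True] by (simp add: g_def)
  qed (simp add: g_def)
  have "continuous_on (D \<union> (T - M)) g"
  proof (rule continuous_on_Un_local_open)
    have eq: "D \<union> (T - M) = T" using DT M by auto
    show "openin (top_of_set (D \<union> (T - M))) D" unfolding eq by (rule D(1))
    show "openin (top_of_set (D \<union> (T - M))) (T - M)"
      unfolding eq using M(1) by (simp add: Diff_eq openin_open_Int compact_imp_closed open_Compl)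
    have "continuous_on D (\<lambda>x. k' (shrink_disc a r (k x)))"
      by (rule continuous_on_compose2[OF hc(2) continuous_on_compose2[OF s(1) hc(1)]])
        (use hi s(3) in \<open>auto\<close>)
    then show "continuous_on D g"
      by (rule continuous_on_eq) (simp add: g_def)
    show "continuous_on (T - M) g"
      by (rule continuous_on_eq[OF continuous_on_id]) (use gM in auto)
  qed
  moreover have "D \<union> (T - M) = T" using DT M by auto
  ultimately have cont: "continuous_on T g" by simp
  have off: "g x = x" if "x \<in> T - D" for x using that by (simp add: g_def)
  have "inj_on g T"
  proof (rule inj_onI)
    fix x y assume xy: "x \<in> T" "y \<in> T" "g x = g y"
    have "x \<in> D \<longleftrightarrow> y \<in> D" using xy off gD by (metis DiffI imageI)
    moreover have "x = y" if xD: "x \<in> D" "y \<in> D"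
    proof -
      have b: "shrink_disc a r (k x) \<in> ball 0 1" "shrink_disc a r (k y) \<in> ball 0 1"
        using s(3) hi(1) xD by blast+
      have "k (k' (shrink_disc a r (k x))) = k (k' (shrink_disc a r (k y)))"
        using xy(3) xD by (simp add: g_def)
      then have "shrink_disc a r (k x) = shrink_disc a r (k y)" using ha(2) b by simp
      then have "k x = k y" using s(2) by (auto dest: injD)
      then show ?thesis using ha(1) xD by metis
    qed
    ultimately show "x = y" using xy off by (metis DiffI)
  qed
  moreover have "g ` T = T"
  proof -
    have "g ` T = g ` D \<union> g ` (T - D)" using DT by auto
    also have "g ` (T - D) = T - D" using off by force
    finally show ?thesis using gD DT by auto
  qed
  ultimately have bij: "bij_betw g T T" by (simp add: bij_betw_def)
  have "g ` C \<subseteq> ball (k' 0) e"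
  proof
    fix y assume "y \<in> g ` C"
    then obtain x where x: "x \<in> C" "y = g x" by blast
    have "norm (k x) \<le> r" using r(3) x by auto
    then have "norm (shrink_disc a r (k x)) < d" using s(5) a(3) by fastforce
    then have "dist (k' (shrink_disc a r (k x))) (k' 0) < e" by (intro d(2)) simp
    moreover have "x \<in> D" using x C(2) by blast
    ultimately show "y \<in> ball (k' 0) e" by (simp add: x g_def dist_commute)
  qed
  from that[OF cont bij off gD this] show ?thesis .
qed

text \<open>Brown's argument: the limit of homeomorphisms that squeeze ever smaller discs around a cellular
  set to ever smaller discs is a homeomorphism off the cellular set, which it collapses.\<close>

lemma cellular_complement:
  fixes T :: "'a::heine_borel set"
  assumes T: "compact T" and K: "cellular T K" "compact K" "K \<noteq> {}" and U: "open U" "K \<subseteq> U"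
  obtains p H where "p \<in> T \<inter> U" "homeomorphic_map (top_of_set (T - K)) (top_of_set (T - {p})) H"
    "\<And>x. x \<in> T - U \<Longrightarrow> H x = x"
proof -
  let ?disc = "\<lambda>D. K \<subseteq> D \<and> openin (top_of_set T) D \<and> D homeomorphic ball (0::complex) 1"
  \<comment> \<open>The construction produces pairs of a homeomorphism \<open>h\<close> of \<open>T\<close> and a disc \<open>D\<close> around \<open>K\<close>. The next
    homeomorphism differs from \<open>h\<close> only on \<open>D\<close>, where it squeezes a compact neighbourhood \<open>C\<close> of \<open>K\<close>, and
    the next disc is chosen within \<open>C\<close>.\<close>
  define P where "P n s \<longleftrightarrow> continuous_on T (fst s) \<and> bij_betw (fst s) T T \<and> ?disc (snd s) \<and>
     (n = 0 \<longrightarrow> fst s = id \<and> snd s \<subseteq> U)" for n :: nat and s :: "('a \<Rightarrow> 'a) \<times> 'a set"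
  define Q where "Q n s s' \<longleftrightarrow> (\<forall>x\<in>T - snd s. fst s' x = fst s x) \<and> fst s' ` snd s = fst s ` snd s \<and>
     (\<exists>C p. compact C \<and> snd s' \<subseteq> C \<and> C \<subseteq> snd s \<and> C \<subseteq> {x. infdist x K \<le> 1 / Suc n} \<and>
        fst s' ` C \<subseteq> ball p (1 / Suc n))" for n :: nat and s s' :: "('a \<Rightarrow> 'a) \<times> 'a set"
  have "\<exists>f. \<forall>n. P n (f n) \<and> Q n (f n) (f (Suc n))"
  proof (rule dependent_nat_choice)
    obtain D where "?disc D" "D \<subseteq> U"
      using K(1)[unfolded cellular_def, rule_format, OF conjI[OF U]] by auto
    then have "P 0 (id, D)" by (simp add: P_def)
    then show "\<exists>s. P 0 s" ..
  next
    fix s n assume "P n s"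
    then obtain h D where s: "s = (h, D)" and h: "continuous_on T h" "bij_betw h T T" and D: "?disc D"
      unfolding P_def by (metis prod.collapse)
    obtain V where V: "open V" "D = T \<inter> V" using D by (metis openin_open)
    define W where "W = {x. infdist x K < 1 / Suc n}"
    have "open W" unfolding W_def by (intro open_Collect_less continuous_intros)
    have "K \<subseteq> V \<inter> W" using D V by (auto simp: W_def)
    then obtain d where d: "d > 0" "{x. infdist x K \<le> d} \<subseteq> V \<inter> W"
      using compact_in_open_separated[of K "V \<inter> W"] K \<open>open W\<close> V(1) by (auto intro: open_Int)
    define C where "C = T \<inter> {x. infdist x K \<le> d}"
    have C: "compact C" "C \<subseteq> D" "C \<subseteq> W"
      using d V T by (auto simp: C_def intro!: compact_Int_closed closed_Collect_le continuous_intros)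
    have "open {x. infdist x K < d}" by (intro open_Collect_less continuous_intros)
    moreover have "K \<subseteq> {x. infdist x K < d}" using d by auto
    ultimately obtain D' where D': "?disc D'" "D' \<subseteq> {x. infdist x K < d}"
      using K(1)[unfolded cellular_def, rule_format, OF conjI] by metis
    have D'C: "D' \<subseteq> C" using D' openin_imp_subset by (fastforce simp: C_def)
    have DT: "D \<subseteq> T" using V by auto
    obtain h' where hh: "homeomorphism T T h h'"
      using homeomorphism_compact[OF T h(1)] h(2) unfolding bij_betw_def by blast
    have "homeomorphism D (h ` D) h h'" using hh DT by (rule homeomorphism_of_subsets) auto
    then have "h ` D homeomorphic ball (0::complex) 1"
      using D homeomorphic_def homeomorphic_sym homeomorphic_trans by metis
    moreover have "openin (top_of_set T) (h ` D)"
      using homeomorphism_imp_open_map[OF hh] D by blast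
    moreover have "compact (h ` C)" "h ` C \<subseteq> h ` D"
      using C DT by (auto intro!: compact_continuous_image continuous_on_subset[OF h(1)])
    ultimately obtain g p where g: "continuous_on T g" "bij_betw g T T" "\<And>x. x \<in> T - h ` D \<Longrightarrow> g x = x"
      "g ` h ` D = h ` D" "g ` h ` C \<subseteq> ball p (1 / Suc n)"
      using squeeze_into_ball[OF T, of "h ` D" "h ` C" "1 / Suc n"] by (metis zero_less_divide_1_iff of_nat_0_less_iff zero_less_Suc)
    have hT: "h ` T = T" "inj_on h T" using h(2) by (auto simp: bij_betw_def)
    have "P (Suc n) (g \<circ> h, D')"
      unfolding P_def fst_conv snd_conv
    proof (intro conjI)
      show "continuous_on T (g \<circ> h)" using g(1) hT h(1) by (intro continuous_on_compose) auto
      show "bij_betw (g \<circ> h) T T" by (rule bij_betw_trans[OF h(2) g(2)])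
    qed (use D' in simp_all)
    moreover have "(g \<circ> h) x = h x" if "x \<in> T - D" for x
    proof -
      have "h x \<notin> h ` D" using that hT DT by (metis DiffE inj_on_image_mem_iff)
      then show ?thesis using g(3) that hT by auto
    qed
    then have "Q n s (g \<circ> h, D')"
      unfolding Q_def s fst_conv snd_conv
    proof (intro conjI ballI exI[of _ C] exI[of _ p])
      show "(g \<circ> h) ` D = h ` D" unfolding image_comp[symmetric] by (rule g(4))
      show "(g \<circ> h) ` C \<subseteq> ball p (1 / Suc n)" unfolding image_comp[symmetric] by (rule g(5))
      show "C \<subseteq> {x. infdist x K \<le> 1 / Suc n}" using C(3) unfolding W_def by (auto intro: less_imp_le)
    qed (use C D'C in auto)
    ultimately show "\<exists>s'. P (Suc n) s' \<and> Q n s s'" by blast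
  qed
  then obtain f where f: "\<And>n. P n (f n)" "\<And>n. Q n (f n) (f (Suc n))" by blast
  define h where "h n = fst (f n)" for n
  define D where "D n = snd (f n)" for n
  have h: "continuous_on T (h n)" "bij_betw (h n) T T" and D: "?disc (D n)" for n
    using f(1)[of n] by (auto simp: P_def h_def D_def)
  have h0: "h 0 = id" "D 0 \<subseteq> U" using f(1)[of 0] by (auto simp: P_def h_def D_def)
  have hstep: "h (Suc n) x = h n x" if "x \<in> T - D n" for n x
    using f(2)[of n] that by (auto simp: Q_def h_def D_def)
  have hD: "h (Suc n) ` D n = h n ` D n" for n
    using f(2)[of n] by (auto simp: Q_def h_def D_def)
  obtain C q where C: "\<And>n. compact (C n)" "\<And>n. D (Suc n) \<subseteq> C n" "\<And>n. C n \<subseteq> D n"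
    "\<And>n. C n \<subseteq> {x. infdist x K \<le> 1 / Suc n}" "\<And>n. h (Suc n) ` C n \<subseteq> ball (q n) (1 / Suc n)"
    using f(2) unfolding Q_def h_def D_def by metis
  have DT: "D n \<subseteq> T" for n using D openin_imp_subset by blast
  have KT: "K \<subseteq> T" using D[of 0] DT[of 0] by blast
  have dec: "D n \<subseteq> D m" if "m \<le> n" for m n
    using that by (induction rule: dec_induct) (use C in blast)+
  have inj: "inj_on (h n) T" and im: "h n ` T = T" for n
    using h(2) by (auto simp: bij_betw_def)
  have stable: "h m x = h n x" if "n \<le> m" "x \<in> T - D n" for m n x
    using that(1)
  proof (induction rule: dec_induct)
    case (step m)
    then have "x \<in> T - D m" using that(2) dec by blast
    then show ?case using step hstep by simp
  qed simp
  have outside: "\<exists>n. x \<notin> D n" if x: "x \<in> T - K" for x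
  proof -
    have "infdist x K > 0"
      using x K by (metis DiffE compact_imp_closed in_closed_iff_infdist_zero infdist_nonneg less_eq_real_def)
    then obtain n where "1 / Suc n < infdist x K" using nat_approx_posE by metis
    then have "x \<notin> C n" using C(4)[of n] by auto
    then show ?thesis using C(2) by blast
  qed
  define F where "F n = h (Suc n) ` C n" for n
  have CT: "C n \<subseteq> T" for n using C(3) DT by blast
  have Fc: "compact (F n)" for n
    unfolding F_def by (intro compact_continuous_image continuous_on_subset[OF h(1) CT] C(1))
  have Fne: "F n \<noteq> {}" for n using C(2)[of n] D[of "Suc n"] K(3) by (auto simp: F_def)
  have Fdec1: "F (Suc n) \<subseteq> F n" for n
  proof -
    have "F (Suc n) \<subseteq> h (Suc (Suc n)) ` D (Suc n)" unfolding F_def by (rule image_mono[OF C(3)])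
    also have "\<dots> = h (Suc n) ` D (Suc n)" by (rule hD)
    also have "\<dots> \<subseteq> F n" unfolding F_def by (rule image_mono[OF C(2)])
    finally show ?thesis .
  qed
  have Fdec: "F n \<subseteq> F m" if "m \<le> n" for m n
    using that by (induction rule: dec_induct) (use Fdec1 in blast)+
  \<comment> \<open>The images of the neighbourhoods \<open>C n\<close> decrease and their diameters tend to zero.\<close>
  obtain p where p: "\<And>n. p \<in> F n"
    using compact_nest[of F, OF Fc Fne Fdec] by blast
  have p_unique: "\<exists>n. y \<notin> F n" if "y \<noteq> p" for y
  proof -
    have "0 < dist y p / 2" using that by simp
    then obtain n where n: "1 / Suc n < dist y p / 2"
      using nat_approx_posE by blast
    have "y \<notin> F n"
    proof
      assume "y \<in> F n"
      then have "dist (q n) y < 1 / Suc n" "dist (q n) p < 1 / Suc n"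
        using C(5)[of n] p[of n] unfolding F_def by auto
      then show False using n dist_triangle2[of y p "q n"] by (simp add: dist_commute)
    qed
    then show ?thesis ..
  qed
  \<comment> \<open>The sequence \<open>h n x\<close> is constant once \<open>x\<close> has left the discs.\<close>
  define H where "H x = h (LEAST n. x \<notin> D n) x" for x
  have H: "H x = h n x" if "x \<in> T - D n" for n x
  proof -
    have le: "(LEAST n. x \<notin> D n) \<le> n" using that by (intro Least_le) blast
    have "x \<notin> D n" using that by blast
    then have "x \<notin> D (LEAST n. x \<notin> D n)" by (rule LeastI[of "\<lambda>n. x \<notin> D n" n])
    then show ?thesis unfolding H_def using stable[OF le] that by auto
  qed
  have HF: "H x \<in> T - F n" if "x \<in> T - C n" for n x
  proof -
    have "x \<in> T - D (Suc n)" using that C(2) by blast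
    then have "H x = h (Suc n) x" by (rule H)
    moreover have "h (Suc n) x \<notin> F n"
      unfolding F_def using inj_on_image_mem_iff[OF inj] that CT by blast
    ultimately show ?thesis using im that by auto
  qed
  obtain h' where h': "\<And>n. homeomorphism T T (h n) (h' n)"
    using homeomorphism_compact[OF T h(1) im inj] by metis
  define G where "G y = h' (Suc (LEAST n. y \<notin> F n)) y" for y
  have outC: "\<exists>n. x \<in> T - C n" if "x \<in> T - K" for x
    using outside[OF that] C(3) that by blast
  have GH: "G (H x) = x" if "x \<in> T - K" for x
  proof -
    obtain n0 where n0: "x \<in> T - C n0" using outC \<open>x \<in> T - K\<close> by blast
    define n where "n = (LEAST n. H x \<notin> F n)"
    have Hn: "H x \<notin> F n"
      unfolding n_def by (rule LeastI[of "\<lambda>n. H x \<notin> F n" n0]) (use HF[OF n0] in blast)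
    have "H x \<in> T" using HF[OF n0] by blast
    then obtain z where z: "z \<in> T" "H x = h (Suc n) z" using im by (metis image_iff)
    have "z \<in> T - C n" using Hn z by (auto simp: F_def)
    then have "z \<in> T - D (Suc n)" using C(2) by blast
    moreover from this have "H z = H x" using z H by simp
    moreover have "z \<in> T - K" using calculation D by blast
    have "z = x"
    proof -
      obtain m1 where m1: "x \<notin> D m1" using outside \<open>x \<in> T - K\<close> by blast
      obtain m2 where m2: "z \<notin> D m2" using outside \<open>z \<in> T - K\<close> by blast
      define m where "m = max m1 m2"
      have "x \<in> T - D m" "z \<in> T - D m" using m1 m2 dec[of m1 m] dec[of m2 m] that z by (auto simp: m_def)
      then have "h m x = h m z" using H \<open>H z = H x\<close> by metis
      then show ?thesis using inj that z by (auto dest: inj_onD)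
    qed
    have Gn: "G (H x) = h' (Suc n) (H x)" by (simp only: G_def n_def)
    have "h' (Suc n) (h (Suc n) z) = z" by (rule homeomorphism_apply1[OF h' z(1)])
    then have "h' (Suc n) (H x) = z" by (simp only: z(2))
    then show ?thesis using \<open>z = x\<close> by (simp only: Gn)
  qed
  have G: "G y \<in> T - C n \<and> H (G y) = y \<and> G y = h' (Suc n) y" if y: "y \<in> T - F n" for n y
  proof -
    obtain x where x: "x \<in> T" "y = h (Suc n) x" using im y by (metis DiffE image_iff)
    have xC: "x \<in> T - C n" using x y by (auto simp: F_def)
    then have "x \<in> T - D (Suc n)" "x \<in> T - K" using C(2)[of n] D[of "Suc n"] by blast+
    then have "H x = y" using H x by simp
    then show ?thesis using GH[OF \<open>x \<in> T - K\<close>] xC x homeomorphism_apply1[OF h'] by metis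
  qed
  have UH: "T - K = (\<Union>n. T - C n)"
  proof -
    have KC: "K \<subseteq> C n" for n using subset_trans[OF conjunct1[OF D] C(2)] .
    show ?thesis
    proof (intro subset_antisym subsetI)
      fix x assume "x \<in> T - K"
      then show "x \<in> (\<Union>n. T - C n)" using outC[of x] by blast
    next
      fix x assume "x \<in> (\<Union>n. T - C n)"
      then obtain n where "x \<in> T - C n" by blast
      then show "x \<in> T - K" using KC[of n] by blast
    qed
  qed
  have UG: "T - {p} = (\<Union>n. T - F n)"
    using p p_unique by blast
  have oC: "openin (top_of_set T) (T - C n)" "openin (top_of_set T) (T - F n)" for n
    using C(1) Fc by (simp_all add: Diff_eq openin_open_Int compact_imp_closed open_Compl)
  have contH: "continuous_map (top_of_set (T - K)) (top_of_set T) H"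
  proof (rule pasting_lemma[where I = UNIV and T = "\<lambda>n. T - C n" and f = "\<lambda>n. h (Suc n)"])
    show "openin (top_of_set (T - K)) (T - C n)" for n
      by (rule openin_subset_trans[OF oC(1)]) (use UH in auto)
    show "continuous_map (subtopology (top_of_set (T - K)) (T - C n)) (top_of_set T) (h (Suc n))" for n
      using UH im by (auto simp: subtopology_subtopology intro!: continuous_on_subset[OF h(1)])
    have HC: "H x = h (Suc n) x" if "x \<in> T - C n" for n x
      using H[of x "Suc n"] that C(2) by blast
    show "h (Suc i) x = h (Suc j) x" if "x \<in> topspace (top_of_set (T - K)) \<inter> (T - C i) \<inter> (T - C j)" for i j x
      using HC[of x i] HC[of x j] that by auto
    show "\<exists>j. j \<in> UNIV \<and> x \<in> T - C j \<and> H x = h (Suc j) x" if "x \<in> topspace (top_of_set (T - K))" for x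
      using outC[of x] HC that by auto
  qed
  have contG: "continuous_map (top_of_set (T - {p})) (top_of_set T) G"
  proof (rule pasting_lemma[where I = UNIV and T = "\<lambda>n. T - F n" and f = "\<lambda>n. h' (Suc n)"])
    show "openin (top_of_set (T - {p})) (T - F n)" for n
      by (rule openin_subset_trans[OF oC(2)]) (use UG in auto)
    show "continuous_map (subtopology (top_of_set (T - {p})) (T - F n)) (top_of_set T) (h' (Suc n))" for n
      using UG homeomorphism_cont2[OF h', of "Suc n"] homeomorphism_image2[OF h', of "Suc n"]
      by (auto simp: subtopology_subtopology intro!: continuous_on_subset[OF homeomorphism_cont2[OF h']])
    show "h' (Suc i) x = h' (Suc j) x" if "x \<in> topspace (top_of_set (T - {p})) \<inter> (T - F i) \<inter> (T - F j)" for i j x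
      using G[of x i] G[of x j] that by auto
    show "\<exists>j. j \<in> UNIV \<and> x \<in> T - F j \<and> G x = h' (Suc j) x" if x: "x \<in> topspace (top_of_set (T - {p}))" for x
    proof -
      have "x \<in> (\<Union>n. T - F n)" using x UG by simp
      then show ?thesis using G by blast
    qed
  qed
  have "homeomorphic_maps (top_of_set (T - K)) (top_of_set (T - {p})) H G"
    unfolding homeomorphic_maps_def
  proof (intro conjI ballI)
    have "H x \<in> T - {p}" if x: "x \<in> T - K" for x
    proof -
      obtain n where "x \<in> T - C n" using outC[OF x] ..
      from HF[OF this] show ?thesis unfolding UG by blast
    qed
    then show "continuous_map (top_of_set (T - K)) (top_of_set (T - {p})) H"
      using contH by (simp add: continuous_map_in_subtopology Pi_iff image_subset_iff)
    have "G y \<in> T - K" if y: "y \<in> T - {p}" for y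
    proof -
      have "y \<in> (\<Union>n. T - F n)" using y unfolding UG .
      then obtain n where "y \<in> T - F n" by blast
      from G[OF this] show ?thesis unfolding UH by blast
    qed
    then show "continuous_map (top_of_set (T - {p})) (top_of_set (T - K)) G"
      using contG by (simp add: continuous_map_in_subtopology Pi_iff image_subset_iff)
    show "G (H x) = x" if "x \<in> topspace (top_of_set (T - K))" for x using GH that by simp
    show "H (G y) = y" if "y \<in> topspace (top_of_set (T - {p}))" for y
    proof -
      have "y \<in> (\<Union>n. T - F n)" using that UG by simp
      then show ?thesis using G by blast
    qed
  qed
  then have hom: "homeomorphic_map (top_of_set (T - K)) (top_of_set (T - {p})) H"
    unfolding homeomorphic_map_maps by blast
  have "p \<in> h (Suc 0) ` D 0" using p[of 0] C(3)[of 0] by (auto simp: F_def)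
  then have "p \<in> T \<inter> U" using hD[of 0] h0 DT[of 0] by auto
  moreover have "H x = x" if "x \<in> T - U" for x
    using H[of x 0] h0 that by auto
  ultimately show ?thesis using that hom by blast
qed

lemma homeomorphism_imp_homeomorphic_map:
  assumes "homeomorphism S S' f g"
  shows "homeomorphic_map (top_of_set S) (top_of_set S') f"
  unfolding homeomorphic_map_maps homeomorphic_maps_def
  using assms by (intro exI[of _ g]) (auto simp: homeomorphism_def)

lemma homeomorphic_map_restrict_point:
  assumes "homeomorphism S S' f g" "p \<in> S"
  shows "homeomorphic_map (top_of_set (S - {p})) (top_of_set (S' - {f p})) f"
proof (rule homeomorphism_imp_homeomorphic_map)
  have "f ` (S - {p}) = S' - {f p}"
    using assms unfolding homeomorphism_def by (auto, metis)
  then show "homeomorphism (S - {p}) (S' - {f p}) f g"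
    using homeomorphism_of_subsets[OF assms(1), of "S - {p}" "S' - {f p}"] by blast
qed

text \<open>A parabolic Moebius transformation with fixed point 1. It preserves the unit circle if \<open>k\<close> is
  imaginary, and \<open>k\<close> is additive under composition.\<close>

definition circle_parabolic :: "complex \<Rightarrow> complex \<Rightarrow> complex" where
  "circle_parabolic k z = (z + k * (z - 1)) / (1 + k * (z - 1))"

lemma circle_parabolic:
  assumes k: "cnj k = - k" and z: "norm z = 1"
  shows "1 + k * (z - 1) \<noteq> 0" "norm (circle_parabolic k z) = 1"
    and "circle_parabolic (- k) (circle_parabolic k z) = z"
proof -
  have zz: "z * cnj z = 1" using z by (simp add: complex_norm_square[symmetric])
  have eq: "norm (z + k * (z - 1)) = norm (1 + k * (z - 1))"
  proof -
    have "cnj z * (z + k * (z - 1)) = cnj (1 + k * (z - 1))"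
      using zz k by (simp add: algebra_simps)
    then have "norm (cnj z * (z + k * (z - 1))) = norm (1 + k * (z - 1))"
      by (metis complex_mod_cnj)
    then show ?thesis using z by (simp add: norm_mult)
  qed
  show nz: "1 + k * (z - 1) \<noteq> 0"
  proof
    assume 0: "1 + k * (z - 1) = 0"
    then have "z + k * (z - 1) = 0" using eq by simp
    then have "z = 1" using 0 by (metis add_right_cancel)
    then show False using 0 by simp
  qed
  show "norm (circle_parabolic k z) = 1"
    using eq nz by (simp add: circle_parabolic_def norm_divide)
  let ?d = "1 + k * (z - 1)"
  define w where "w = circle_parabolic k z"
  have wd: "w * ?d = z + k * (z - 1)" using nz by (simp add: w_def circle_parabolic_def)
  have "(w - 1) * ?d = z - 1" using wd by (simp add: algebra_simps)
  then have w1: "w - 1 = (z - 1) / ?d" using nz by (simp add: eq_divide_eq)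
  have a: "(1 + (- k) * (w - 1)) * ?d = 1"
  proof -
    have "(1 + (- k) * (w - 1)) * ?d = ?d - k * ((w - 1) * ?d)" by (simp only: ring_distribs) simp
    then show ?thesis unfolding \<open>(w - 1) * ?d = z - 1\<close> by simp
  qed
  have b: "(w + (- k) * (w - 1)) * ?d = z"
  proof -
    have "(w + (- k) * (w - 1)) * ?d = w * ?d - k * ((w - 1) * ?d)" by (simp only: ring_distribs) simp
    then show ?thesis unfolding \<open>(w - 1) * ?d = z - 1\<close> wd by simp
  qed
  have "1 + (- k) * (w - 1) \<noteq> 0" using a by auto
  moreover have "w + (- k) * (w - 1) = z * (1 + (- k) * (w - 1))"
  proof -
    have "(w + (- k) * (w - 1)) * ?d = (z * (1 + (- k) * (w - 1))) * ?d"
      unfolding b mult.assoc[of z] a by simp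
    from this[unfolded mult_right_cancel[OF nz]] show ?thesis .
  qed
  ultimately show "circle_parabolic (- k) (circle_parabolic k z) = z"
    unfolding w_def[symmetric] unfolding circle_parabolic_def by simp
qed

lemma circle_parabolic_minus_1:
  assumes "norm p = 1" "p \<noteq> 1"
  obtains k where "cnj k = - k" "circle_parabolic k p = -1"
proof -
  define k where "k = - (1 + p) / (2 * (p - 1))"
  have pp: "p * cnj p = 1" using assms by (simp add: complex_norm_square[symmetric])
  have p1: "p - 1 \<noteq> 0" "cnj p - 1 \<noteq> 0"
    using assms by (auto simp: complex_eq_iff)
  have "(1 + cnj p) * (p - 1) = - ((1 + p) * (cnj p - 1))"
    using pp by (simp add: algebra_simps)
  then have k: "cnj k = - k"
    using p1 by (simp add: k_def field_simps)
  have kp: "k * (p - 1) = - (1 + p) / 2" using p1 by (simp add: k_def field_simps)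
  have "1 + k * (p - 1) \<noteq> 0" by (rule circle_parabolic(1)[OF k assms(1)])
  then have "circle_parabolic k p = -1"
    unfolding circle_parabolic_def kp by (simp add: field_simps)
  with k show ?thesis using that by blast
qed

lemma torus_homeomorphismI:
  assumes "continuous_on torus_set f" "continuous_on torus_set g"
    and "\<And>x. x \<in> torus_set \<Longrightarrow> f x \<in> torus_set \<and> g (f x) = x"
    and "\<And>x. x \<in> torus_set \<Longrightarrow> g x \<in> torus_set \<and> f (g x) = x"
  shows "homeomorphism torus_set torus_set f g"
  using assms by (auto simp: homeomorphism_def image_iff) (metis+)

text \<open>First a translation moves \<open>x\<close> to \<open>(1, 1)\<close>. A shear makes both coordinates of the image of \<open>p\<close>
  different from 1 if necessary, and parabolic transformations of the two circles then take it to
  \<open>(-1, -1)\<close> without moving \<open>(1, 1)\<close>.\<close>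

lemma torus_move_points:
  assumes x: "x \<in> torus_set" and p: "p \<in> torus_set" and xp: "x \<noteq> p"
  obtains f where "homeomorphic_map (top_of_set (torus_set - {p})) (top_of_set (torus_set - {(-1, -1)})) f"
    "f x = (1, 1)"
proof -
  define f1 where "f1 y = (fst y * cnj (fst x), snd y * cnj (snd x))" for y
  define g1 where "g1 y = (fst y * fst x, snd y * snd x)" for y
  have un: "fst x * cnj (fst x) = 1" "snd x * cnj (snd x) = 1" "norm (fst x) = 1" "norm (snd x) = 1"
    using x by (auto simp: torus_set_def complex_norm_square[symmetric])
  have h1: "homeomorphism torus_set torus_set f1 g1"
  proof (rule torus_homeomorphismI)
    show "continuous_on torus_set f1" "continuous_on torus_set g1"
      unfolding f1_def g1_def by (intro continuous_intros)+
    show "f1 y \<in> torus_set \<and> g1 (f1 y) = y" "g1 y \<in> torus_set \<and> f1 (g1 y) = y" if "y \<in> torus_set" for y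
      using that un by (auto simp: f1_def g1_def torus_set_def norm_mult mult.assoc mult.commute[of "cnj _"])
  qed
  have f1x: "f1 x = (1, 1)" using un by (simp add: f1_def)
  define p1 where "p1 = f1 p"
  have p1: "p1 \<in> torus_set" "p1 \<noteq> (1, 1)"
  proof -
    show "p1 \<in> torus_set" using h1 p unfolding p1_def homeomorphism_def by blast
    show "p1 \<noteq> (1, 1)" using f1x xp h1 p x unfolding p1_def homeomorphism_def by metis
  qed
  have "\<exists>f2 g2. homeomorphism torus_set torus_set f2 g2 \<and> f2 (1, 1) = (1, 1) \<and> fst (f2 p1) \<noteq> 1 \<and> snd (f2 p1) \<noteq> 1"
  proof -
    have c: "homeomorphism torus_set torus_set (\<lambda>y. (fst y * snd y, snd y)) (\<lambda>y. (fst y * cnj (snd y), snd y))"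
      "homeomorphism torus_set torus_set (\<lambda>y. (fst y, snd y * fst y)) (\<lambda>y. (fst y, snd y * cnj (fst y)))"
      "homeomorphism torus_set torus_set (\<lambda>y. y) (\<lambda>y. y)"
      by (rule torus_homeomorphismI;
          auto intro!: continuous_intros simp: torus_set_def norm_mult mult.assoc complex_norm_square[symmetric] mult.commute[of "cnj _"])+
    consider "fst p1 = 1" "snd p1 \<noteq> 1" | "fst p1 \<noteq> 1" "snd p1 = 1" | "fst p1 \<noteq> 1" "snd p1 \<noteq> 1"
      using p1(2) by (metis prod.collapse)
    then show ?thesis
    proof cases
      case 1 then show ?thesis using c(1) by fastforce
    next
      case 2 then show ?thesis using c(2) by fastforce
    next
      case 3 then show ?thesis using c(3) by fastforce
    qed
  qed
  then obtain f2 g2 where h2: "homeomorphism torus_set torus_set f2 g2" "f2 (1, 1) = (1, 1)"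
    "fst (f2 p1) \<noteq> 1" "snd (f2 p1) \<noteq> 1" by blast
  define p2 where "p2 = f2 p1"
  have p2: "p2 \<in> torus_set" using h2(1) p1 unfolding p2_def homeomorphism_def by blast
  then have n2: "norm (fst p2) = 1" "norm (snd p2) = 1" by (auto simp: torus_set_def)
  obtain k where k: "cnj k = - k" "circle_parabolic k (fst p2) = -1"
    using circle_parabolic_minus_1[OF n2(1)] h2(3) unfolding p2_def by blast
  obtain l where l: "cnj l = - l" "circle_parabolic l (snd p2) = -1"
    using circle_parabolic_minus_1[OF n2(2)] h2(4) unfolding p2_def by blast
  define f3 where "f3 k l y = (circle_parabolic k (fst y), circle_parabolic l (snd y))" for k l y
  have c3: "continuous_on torus_set (f3 k l)" if "cnj k = - k" "cnj l = - l" for k l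
    unfolding f3_def circle_parabolic_def
    using circle_parabolic(1)[OF that(1)] circle_parabolic(1)[OF that(2)]
    by (intro continuous_intros) (auto simp: torus_set_def)
  have h3: "homeomorphism torus_set torus_set (f3 k l) (f3 (- k) (- l))"
  proof (rule torus_homeomorphismI)
    have *: "cnj (- k) = - (- k)" "cnj (- l) = - (- l)" using k l by auto
    show "continuous_on torus_set (f3 k l)" "continuous_on torus_set (f3 (- k) (- l))"
      using c3[OF k(1) l(1)] c3[OF *] by auto
    show "f3 k l y \<in> torus_set \<and> f3 (- k) (- l) (f3 k l y) = y"
      "f3 (- k) (- l) y \<in> torus_set \<and> f3 k l (f3 (- k) (- l) y) = y" if "y \<in> torus_set" for y
      using that circle_parabolic(2,3)[OF k(1)] circle_parabolic(2,3)[OF l(1)]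
        circle_parabolic(2,3)[OF *(1)] circle_parabolic(2,3)[OF *(2)]
      by (auto simp: f3_def torus_set_def)
  qed
  have "f3 k l p2 = (-1, -1)" "f3 k l (1, 1) = (1, 1)"
    using k l by (auto simp: f3_def circle_parabolic_def)
  note f3 = this
  have "homeomorphic_map (top_of_set (torus_set - {p})) (top_of_set (torus_set - {p2})) (f2 \<circ> f1)"
    unfolding p2_def p1_def
    by (rule homeomorphic_map_compose[OF homeomorphic_map_restrict_point[OF h1 p]
        homeomorphic_map_restrict_point[OF h2(1) p1(1)[unfolded p1_def]]])
  from homeomorphic_map_compose[OF this homeomorphic_map_restrict_point[OF h3 p2]]
  have "homeomorphic_map (top_of_set (torus_set - {p})) (top_of_set (torus_set - {(-1, -1)})) (f3 k l \<circ> (f2 \<circ> f1))"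
    unfolding f3(1) .
  moreover have "(f3 k l \<circ> (f2 \<circ> f1)) x = (1, 1)" using f1x h2(2) f3(2) by simp
  ultimately show ?thesis by (rule that)
qed

definition punctured_torus :: "(complex \<times> complex) set" where
  "punctured_torus = torus_set - {(-1, -1)}"

text \<open>Collapsing the hole to a point by a map that is the identity near the base point, and then
  moving the two points to standard position.\<close>

lemma torus_with_hole_homeomorphic:
  assumes X: "torus_with_hole X" and x0: "x0 \<in> topspace X"
  obtains \<omega> where "homeomorphic_map X (top_of_set punctured_torus) \<omega>" "\<omega> x0 = (1, 1)"
proof -
  obtain K where K: "(\<exists>p\<in>topspace torus. K = {p}) \<or> closed_disc_in torus K"
    "X homeomorphic_space subtopology torus (topspace torus - K)"
    using X unfolding torus_with_hole_def by blast
  have cell: "cellular torus_set K \<and> compact K \<and> K \<noteq> {}"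
    using K(1)
  proof
    assume "\<exists>p\<in>topspace torus. K = {p}"
    then show ?thesis using cellular_point_torus by (auto simp: topspace_torus)
  next
    assume "closed_disc_in torus K"
    then have sub: "K \<subseteq> torus_set" and "subtopology torus K homeomorphic_space top_of_set (cball (0::complex) 1)"
      by (auto simp: closed_disc_in_def topspace_torus)
    moreover have "subtopology torus K = top_of_set K"
      using sub by (simp add: torus_eq subtopology_subtopology Int_absorb1)
    ultimately obtain f g where "homeomorphic_maps (top_of_set K) (top_of_set (cball (0::complex) 1)) f g"
      unfolding homeomorphic_space_def by auto
    then have "homeomorphism K (cball 0 1) f g"
      unfolding homeomorphic_maps_def homeomorphism_def
      by (auto simp: continuous_map_in_subtopology image_subset_iff Pi_iff image_iff) (metis mem_cball_0)+
    then have "K homeomorphic cball (0::complex) 1" unfolding homeomorphic_def by blast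
    then show ?thesis using cellular_disc_torus[OF sub] by blast
  qed
  have "subtopology torus (topspace torus - K) = top_of_set (torus_set - K)"
    by (simp add: torus_eq subtopology_subtopology Int_absorb1)
  then obtain f where f: "homeomorphic_map X (top_of_set (torus_set - K)) f"
    using K(2) unfolding homeomorphic_space by auto
  have fx: "f x0 \<in> torus_set - K"
    using homeomorphic_imp_surjective_map[OF f] x0 by auto
  obtain p H where H: "p \<in> torus_set \<inter> - {f x0}"
    "homeomorphic_map (top_of_set (torus_set - K)) (top_of_set (torus_set - {p})) H"
    "\<And>x. x \<in> torus_set - - {f x0} \<Longrightarrow> H x = x"
    using cellular_complement[of torus_set K "- {f x0}"] cell fx compact_torus by (metis Compl_iff DiffE insertE open_delete open_Compl closed_singleton singletonD subsetI)
  obtain g where g: "homeomorphic_map (top_of_set (torus_set - {p})) (top_of_set (torus_set - {(-1, -1)})) g"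
    "g (f x0) = (1, 1)"
    using torus_move_points[of "f x0" p] fx H(1) by blast
  have "homeomorphic_map X (top_of_set punctured_torus) (g \<circ> (H \<circ> f))"
    unfolding punctured_torus_def
    by (rule homeomorphic_map_compose[OF homeomorphic_map_compose[OF f H(2)] g(1)])
  moreover have "(g \<circ> (H \<circ> f)) x0 = (1, 1)" using H(3) fx g(2) by simp
  ultimately show ?thesis using that by blast
qed

section \<open>Local degrees and orientation\<close>

text \<open>A loop in a punctured disc that winds once around the puncture is homotopic there to the
  boundary circle: the homotopy in the punctured plane is pushed into the disc radially.\<close>

lemma homotopic_circlepath_punctured_disc:
  assumes p: "path p" "pathfinish p = pathstart p" "path_image p \<subseteq> cball a r - {a}"
    and w: "winding_number p a = 1" and r: "r > 0"
  shows "homotopic_loops (cball a r - {a}) p (circlepath a r)"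
proof -
  have "homotopic_loops (- {a}) p (circlepath a r)"
    using p w r by (subst winding_number_homotopic_loops_eq[symmetric]) (auto simp: winding_number_circlepath)
  define \<rho> where "\<rho> w = a + (w - a) * of_real (min 1 (r / norm (w - a)))" for w
  have cont: "continuous_on (- {a}) \<rho>"
    unfolding \<rho>_def by (intro continuous_intros) auto
  have norm: "norm (\<rho> w - a) = min (norm (w - a)) r" if "w \<noteq> a" for w
  proof -
    have "norm (\<rho> w - a) = norm (w - a) * \<bar>min 1 (r / norm (w - a))\<bar>"
      by (simp add: \<rho>_def norm_mult del: of_real_divide)
    then show ?thesis using that r by (auto simp: min_def field_simps)
  qed
  have im: "\<rho> ` (- {a}) \<subseteq> cball a r - {a}"
    using norm r by (auto simp: dist_norm norm_minus_commute) (smt (verit) norm_eq_zero right_minus_eq)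
  have id: "\<rho> w = w" if "w \<in> cball a r - {a}" for w
    using that r by (auto simp: \<rho>_def dist_norm norm_minus_commute min_def field_simps)
  have "homotopic_loops (cball a r - {a}) (\<rho> \<circ> p) (\<rho> \<circ> circlepath a r)"
    using \<open>homotopic_loops (- {a}) p (circlepath a r)\<close> cont im
    by (intro homotopic_loops_continuous_image) auto
  moreover have "homotopic_loops (cball a r - {a}) p (\<rho> \<circ> p)"
  proof (rule homotopic_loops_eq)
    show "p t = (\<rho> \<circ> p) t" if "t \<in> {0..1}" for t
      using id[of "p t"] p(3) that unfolding path_image_def by force
  qed (use p in auto)
  moreover have "homotopic_loops (cball a r - {a}) (\<rho> \<circ> circlepath a r) (circlepath a r)"
  proof (rule homotopic_loops_sym[OF homotopic_loops_eq])
    have im: "path_image (circlepath a r) \<subseteq> cball a r - {a}"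
      using r by (auto simp: path_image_circlepath_nonneg)
    then show "path_image (circlepath a r) \<subseteq> cball a r - {a}" .
    show "circlepath a r t = (\<rho> \<circ> circlepath a r) t" if "t \<in> {0..1}" for t
      using id[of "circlepath a r t"] im that unfolding path_image_def by force
  qed (use r in auto)
  ultimately show ?thesis
    by (blast intro: homotopic_loops_trans)
qed

text \<open>The integer that the definition of orientation preserving maps requires to be 1.\<close>

definition circle_degree :: "(complex \<Rightarrow> complex) \<Rightarrow> complex \<Rightarrow> real \<Rightarrow> complex" where
  "circle_degree h z r = winding_number (h \<circ> circlepath z r) (h z)"

lemma path_image_circlepath_pos: "0 < r \<Longrightarrow> path_image (circlepath z r) = sphere z r"
  by (simp add: path_image_circlepath_nonneg)

lemma path_circle_image:
  assumes "continuous_on (cball z r) h" "0 < r"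
  shows "path (h \<circ> circlepath z r)"
  by (intro path_continuous_image continuous_on_subset[OF assms(1)])
    (use assms in \<open>auto simp: path_image_circlepath_pos\<close>)

text \<open>The circle around \<open>z'\<close> can be moved to the boundary of the disc in the complement of its
  centre, by straight lines between points with equal angles. After that the centre is moved to \<open>z\<close>
  within the image of the disc, away from the boundary curve.\<close>

lemma circle_degree_cong:
  assumes h: "continuous_on (cball z R) h" "inj_on h (cball z R)"
    and z': "dist z z' < R" and r: "0 < r" "cball z' r \<subseteq> cball z R"
  shows "circle_degree h z' r = circle_degree h z R"
proof -
  have R: "R > 0" using z' zero_le_dist[of z z'] by linarith
  have z'in: "z' \<in> ball z R" using z' by auto
  have "homotopic_loops (cball z R - {z'}) (circlepath z' r) (circlepath z R)"
  proof (rule homotopic_loops_linear)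
    fix t :: real assume t: "t \<in> {0..1}"
    let ?e = "exp (2 * complex_of_real pi * \<i> * of_real t)"
    have e: "norm ?e = 1" by (simp add: norm_exp_eq_Re)
    have in1: "circlepath z' r t \<in> cball z R" "circlepath z R t \<in> cball z R"
    proof -
      have "circlepath z' r t \<in> cball z' r"
        using r by (simp add: circlepath dist_norm norm_mult e)
      then show "circlepath z' r t \<in> cball z R" using r by blast
      show "circlepath z R t \<in> cball z R"
        using R by (simp add: circlepath dist_norm norm_mult e)
    qed
    have "z' \<notin> closed_segment (circlepath z' r t) (circlepath z R t)"
    proof
      assume "z' \<in> closed_segment (circlepath z' r t) (circlepath z R t)"
      then obtain u where u: "0 \<le> u" "u \<le> 1"
        "z' = (1 - u) *\<^sub>R (z' + of_real r * ?e) + u *\<^sub>R (z + of_real R * ?e)"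
        by (auto simp: closed_segment_def circlepath)
      have "of_real ((1 - u) * r + u * R) * ?e = of_real u * (z' - z)"
        using u(3) by (simp add: scaleR_conv_of_real algebra_simps)
      then have "norm (of_real ((1 - u) * r + u * R) * ?e) = norm (of_real u * (z' - z))" by simp
      then have "\<bar>(1 - u) * r + u * R\<bar> = u * dist z z'"
        using u by (simp only: norm_mult e norm_of_real dist_norm norm_minus_commute) simp
      moreover have "0 < (1 - u) * r + u * (R - dist z z')"
        using u r z' by (cases "u = 0") (auto intro!: add_nonneg_pos)
      moreover have "0 \<le> (1 - u) * r" using u r by simp
      ultimately show False by (simp add: algebra_simps abs_if split: if_splits)
    qed
    then show "closed_segment (circlepath z' r t) (circlepath z R t) \<subseteq> cball z R - {z'}"
      using closed_segment_subset[OF in1] by auto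
  qed auto
  then have "homotopic_loops (- {h z'}) (h \<circ> circlepath z' r) (h \<circ> circlepath z R)"
    by (rule homotopic_loops_continuous_image)
      (use h z'in in \<open>auto intro: continuous_on_subset dest: inj_onD\<close>)
  then have "winding_number (h \<circ> circlepath z' r) (h z') = winding_number (h \<circ> circlepath z R) (h z')"
    by (rule winding_number_homotopic_loops)
  also have "\<dots> = winding_number (h \<circ> circlepath z R) (h z)"
  proof (rule winding_number_eq)
    show "path (h \<circ> circlepath z R)" by (rule path_circle_image[OF h(1) R])
    show "connected (h ` ball z R)"
      using h by (intro connected_continuous_image) (auto intro: continuous_on_subset)
    show "h ` ball z R \<inter> path_image (h \<circ> circlepath z R) = {}"
      unfolding path_image_compose path_image_circlepath_pos[OF R]
      using inj_on_image_Int[OF h(2), of "ball z R" "sphere z R"] by auto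
  qed (use z'in R in \<open>auto simp: pathfinish_compose pathstart_compose\<close>)
  finally show ?thesis by (simp add: circle_degree_def)
qed

text \<open>By invariance of domain the image of the open disc is open. Since the image of the closed disc
  is compact, it is also closed in the complement of the boundary curve, so it is a component of this
  complement, and a bounded one.\<close>

lemma injective_disc_inside:
  fixes h :: "complex \<Rightarrow> complex"
  assumes h: "continuous_on (cball z r) h" "inj_on h (cball z r)" and r: "0 < r"
  shows "h z \<in> inside (path_image (h \<circ> circlepath z r))"
proof -
  have J: "path_image (h \<circ> circlepath z r) = h ` sphere z r"
    using r by (simp add: path_image_compose path_image_circlepath_pos)
  have op: "open (h ` ball z r)"
    by (rule invariance_of_domain[OF continuous_on_subset[OF h(1)] open_ball inj_on_subset[OF h(2)]]) auto
  have disj: "h ` ball z r \<inter> h ` sphere z r = {}"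
    using inj_on_image_Int[OF h(2), of "ball z r" "sphere z r"] by auto
  have conn: "connected (h ` ball z r)"
    using h by (intro connected_continuous_image) (auto intro: continuous_on_subset)
  have comp: "compact (h ` cball z r)"
    using h by (intro compact_continuous_image) auto
  have un: "h ` cball z r = h ` ball z r \<union> h ` sphere z r"
    unfolding image_Un[symmetric] by (intro arg_cong[where f = "image h"]) auto
  have "connected_component_set (- h ` sphere z r) (h z) = h ` ball z r"
  proof (rule connected_component_unique)
    fix c' assume c': "h z \<in> c'" "c' \<subseteq> - h ` sphere z r" "connected c'"
    have "c' \<subseteq> h ` ball z r \<union> - h ` cball z r" using c' un by auto
    moreover have "open (- h ` cball z r)" using comp by (simp add: compact_imp_closed open_Compl)
    moreover have "h ` ball z r \<inter> - h ` cball z r \<inter> c' = {}" using un by auto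
    moreover have "h z \<in> h ` ball z r" using r by simp
    then have "h ` ball z r \<inter> c' \<noteq> {}" using c' by blast
    ultimately have "- h ` cball z r \<inter> c' = {}"
      using connectedD[OF c'(3) op, of "- h ` cball z r"] by blast
    then show "c' \<subseteq> h ` ball z r" using \<open>c' \<subseteq> h ` ball z r \<union> - h ` cball z r\<close> by auto
  qed (use disj conn r in auto)
  moreover have "bounded (h ` ball z r)"
    using comp un by (metis bounded_Un compact_imp_bounded)
  moreover have "h z \<in> h ` ball z r" using r by simp
  then have "h z \<notin> h ` sphere z r" using disj by blast
  ultimately show ?thesis
    unfolding J inside_def by simp
qed

text \<open>The winding number of a Jordan curve about a point inside it is 1 or -1.\<close>

lemma circle_degree_cases:
  assumes h: "continuous_on (cball z r) h" "inj_on h (cball z r)" and r: "0 < r"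
  shows "circle_degree h z r = 1 \<or> circle_degree h z r = -1"
proof -
  have "simple_path (h \<circ> circlepath z r)"
  proof (rule simple_path_continuous_image)
    show "simple_path (circlepath z r)" using r by (simp add: simple_path_circlepath)
    show "continuous_on (path_image (circlepath z r)) h" "inj_on h (path_image (circlepath z r))"
      using continuous_on_subset[OF h(1), of "sphere z r"] inj_on_subset[OF h(2), of "sphere z r"] r
      by (auto simp: path_image_circlepath_pos)
  qed
  note sp = this
  note ins = injective_disc_inside[OF assms]
  have "h z \<notin> path_image (h \<circ> circlepath z r)"
    using ins inside_no_overlap[of "path_image (h \<circ> circlepath z r)"] by blast
  moreover have "pathfinish (h \<circ> circlepath z r) = pathstart (h \<circ> circlepath z r)"
    by (simp add: pathfinish_compose pathstart_compose)
  ultimately have "winding_number (h \<circ> circlepath z r) (h z) \<in> {-1, 0, 1}"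
    by (intro simple_closed_path_winding_number_cases sp)
  moreover have "norm (winding_number (h \<circ> circlepath z r) (h z)) = 1"
    by (rule simple_closed_path_norm_winding_number_inside[OF sp ins])
  ultimately show ?thesis unfolding circle_degree_def by auto
qed

text \<open>The image curve under \<open>k\<close> winds once around \<open>k z\<close>, so it may be replaced by a circle.\<close>

lemma circle_degree_compose:
  assumes k: "continuous_on (cball z r) k" "inj_on k (cball z r)" "0 < r" "circle_degree k z r = 1"
    and kR: "k ` cball z r \<subseteq> cball (k z) R" and h: "continuous_on (cball (k z) R) h" "inj_on h (cball (k z) R)"
  shows "circle_degree (h \<circ> k) z r = circle_degree h (k z) R"
proof -
  have zr: "z \<in> cball z r" using k by simp
  obtain y where y: "y \<in> cball z r" "y \<noteq> z"
    using k(3) by (intro that[of "z + of_real r"]) (auto simp: dist_norm)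
  have "k y \<noteq> k z" using inj_onD[OF k(2) _ y(1) zr] y(2) by blast
  moreover have "k y \<in> cball (k z) R" using kR y by blast
  ultimately have R: "R > 0" by (simp add: dist_commute) (metis dist_pos_lt less_le_trans)
  have "homotopic_loops (cball (k z) R - {k z}) (k \<circ> circlepath z r) (circlepath (k z) R)"
  proof (rule homotopic_circlepath_punctured_disc)
    show "path (k \<circ> circlepath z r)" using path_circle_image k by blast
    have "k ` sphere z r \<subseteq> cball (k z) R" using kR by auto
    moreover have "k z \<notin> k ` sphere z r"
    proof
      assume "k z \<in> k ` sphere z r"
      then obtain y where "y \<in> sphere z r" "k y = k z" by force
      moreover from this have "y \<in> cball z r" by auto
      ultimately have "y = z" using inj_onD[OF k(2) _ _ zr] by blast
      then show False using \<open>y \<in> sphere z r\<close> k(3) by auto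
    qed
    ultimately show "path_image (k \<circ> circlepath z r) \<subseteq> cball (k z) R - {k z}"
      unfolding path_image_compose path_image_circlepath_pos[OF k(3)] by blast
    show "winding_number (k \<circ> circlepath z r) (k z) = 1" using k(4) by (simp add: circle_degree_def)
  qed (use R in \<open>auto simp: pathfinish_compose pathstart_compose\<close>)
  then have "homotopic_loops (- {h (k z)}) (h \<circ> (k \<circ> circlepath z r)) (h \<circ> circlepath (k z) R)"
    by (rule homotopic_loops_continuous_image)
      (use h R in \<open>auto intro: continuous_on_subset dest: inj_onD\<close>)
  from winding_number_homotopic_loops[OF this] show ?thesis
    by (simp add: circle_degree_def o_assoc)
qed

lemma circle_degree_cnj:
  assumes h: "continuous_on (cball z r) h" "inj_on h (cball z r)" "0 < r"
  shows "circle_degree (cnj \<circ> h) z r = - cnj (circle_degree h z r)"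
proof -
  have "h z \<notin> path_image (h \<circ> circlepath z r)"
    using injective_disc_inside[OF h] inside_no_overlap[of "path_image (h \<circ> circlepath z r)"] by blast
  from winding_number_cnj[OF path_circle_image[OF h(1,3)] this] show ?thesis
    by (simp add: circle_degree_def o_assoc)
qed

lemma winding_number_circle_complex_radius:
  assumes "a \<noteq> 0"
  shows "winding_number (\<lambda>t. c + a * exp (2 * of_real pi * \<i> * of_real t)) c = 1"
proof -
  define s where "s = Arg2pi a / (2 * pi)"
  have s: "s \<in> {0..1}"
    using Arg2pi_ge_0[of a] Arg2pi_lt_2pi[of a] by (auto simp: s_def field_simps)
  have a: "a = of_real (norm a) * exp (2 * of_real pi * \<i> * of_real s)"
    using Arg2pi_eq[of a] by (simp add: s_def mult_ac)
  have "(\<lambda>t. c + a * exp (2 * of_real pi * \<i> * of_real t)) = shiftpath s (circlepath c (norm a))"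
  proof
    fix t :: real
    have *: "exp (2 * of_real pi * \<i> * of_real (s + t - 1)) = exp (2 * of_real pi * \<i> * of_real (s + t))"
      by (simp add: exp_eq algebra_simps) (intro exI[of _ "-1"], simp)
    have "c + a * exp (2 * of_real pi * \<i> * of_real t) =
      c + of_real (norm a) * exp (2 * of_real pi * \<i> * of_real (s + t))"
      by (subst a) (simp add: exp_add algebra_simps)
    then show "c + a * exp (2 * of_real pi * \<i> * of_real t) = shiftpath s (circlepath c (norm a)) t"
      using * by (simp add: shiftpath_def circlepath)
  qed
  moreover have "winding_number (shiftpath s (circlepath c (norm a))) c = winding_number (circlepath c (norm a)) c"
    using s assms by (intro winding_number_shiftpath) (auto simp: path_image_circlepath_nonneg)
  ultimately show ?thesis using assms by (simp add: winding_number_circlepath_centre)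
qed

text \<open>A real linear map with positive determinant is \<open>v \<mapsto> \<alpha> v + \<beta> cnj v\<close> with
  \<open>norm \<beta> < norm \<alpha>\<close>, so that the term \<open>\<alpha> v\<close> decides about winding numbers.\<close>

lemma circle_degree_positive_jacobian:
  assumes k: "k differentiable (at z)" "real_jacobian k z > 0"
    and cont: "continuous_on (cball z R) k" "R > 0"
  obtains \<delta> where "\<delta> > 0" "\<And>r. 0 < r \<Longrightarrow> r < \<delta> \<Longrightarrow> circle_degree k z r = 1"
proof -
  define D where "D = frechet_derivative k (at z)"
  have der: "(k has_derivative D) (at z)"
    using k(1) by (simp add: D_def frechet_derivative_works)
  interpret D: bounded_linear D by (rule has_derivative_bounded_linear[OF der])
  define \<alpha> where "\<alpha> = (D 1 - \<i> * D \<i>) / 2"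
  define \<beta> where "\<beta> = (D 1 + \<i> * D \<i>) / 2"
  have D: "D v = \<alpha> * v + \<beta> * cnj v" for v
  proof -
    have "D v = D (Re v *\<^sub>R 1 + Im v *\<^sub>R \<i>)"
      by (metis complex_eq scaleR_conv_of_real mult.commute mult.right_neutral)
    also have "\<dots> = Re v *\<^sub>R D 1 + Im v *\<^sub>R D \<i>"
      by (simp only: D.add D.scaleR)
    also have "\<dots> = \<alpha> * v + \<beta> * cnj v"
      by (simp add: \<alpha>_def \<beta>_def complex_eq_iff scaleR_conv_of_real field_simps)
    finally show ?thesis .
  qed
  have "norm \<alpha> ^ 2 - norm \<beta> ^ 2 = real_jacobian k z"
    unfolding cmod_power2 real_jacobian_def Let_def D_def[symmetric] \<alpha>_def \<beta>_def
    by (simp add: power2_eq_square field_simps)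
  then have ab: "norm \<beta> < norm \<alpha>"
    using k(2) by (smt (verit) norm_ge_zero power2_le_iff_abs_le power_mono)
  define e where "e = (norm \<alpha> - norm \<beta>) / 2"
  have e: "e > 0" using ab by (simp add: e_def)
  from der obtain \<delta> where \<delta>: "\<delta> > 0"
    "\<And>y. norm (y - z) < \<delta> \<Longrightarrow> norm (k y - k z - D (y - z)) \<le> e * norm (y - z)"
    using e unfolding has_derivative_at_alt by meson
  show ?thesis
  proof (rule that[of "min \<delta> R"])
    show "min \<delta> R > 0" using \<delta> cont by simp
  next
    fix r :: real assume r: "0 < r" "r < min \<delta> R"
    let ?e = "\<lambda>t. exp (2 * of_real pi * \<i> * of_real t)"
    let ?g = "\<lambda>t. k z + \<alpha> * of_real r * ?e t"
    have "winding_number (k \<circ> circlepath z r) (k z) = winding_number ?g (k z)"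
    proof (rule winding_number_nearby_loops_eq)
      show "path (k \<circ> circlepath z r)"
        using r by (intro path_circle_image continuous_on_subset[OF cont(1)]) auto
      show "path ?g" unfolding path_def by (intro continuous_intros)
      show "pathfinish ?g = pathstart ?g"
        by (simp add: pathfinish_def pathstart_def exp_eq_1)
      fix t :: real assume "t \<in> {0..1}"
      let ?v = "of_real r * ?e t"
      have nv: "norm ?v = r" using r by (simp add: norm_mult norm_exp_eq_Re)
      have "norm (k (z + ?v) - k z - D ?v) \<le> e * r"
        using \<delta>(2)[of "z + ?v"] nv r by simp
      moreover have "k (z + ?v) - ?g t = (k (z + ?v) - k z - D ?v) + \<beta> * cnj ?v"
        by (simp add: D algebra_simps)
      ultimately have "norm (k (z + ?v) - ?g t) \<le> e * r + norm \<beta> * r"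
        using norm_triangle_ineq[of "k (z + ?v) - k z - D ?v" "\<beta> * cnj ?v"] nv
        by (simp only: norm_mult complex_mod_cnj)
      also have "\<dots> < norm \<alpha> * r"
        using r ab unfolding distrib_right[symmetric] by (intro mult_strict_right_mono) (auto simp: e_def field_simps)
      also have "\<dots> = norm (?g t - k z)" using nv by (simp add: norm_mult mult.assoc)
      finally show "norm ((k \<circ> circlepath z r) t - ?g t) < norm (?g t - k z)"
        by (simp add: circlepath)
    qed (auto simp: pathfinish_compose pathstart_compose)
    also have "\<dots> = 1"
    proof (rule winding_number_circle_complex_radius)
      have "\<alpha> \<noteq> 0" using ab norm_ge_zero[of \<beta>] by auto
      then show "\<alpha> * of_real r \<noteq> 0" using r by auto
    qed
    finally show "circle_degree k z r = 1" by (simp add: circle_degree_def)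
  qed
qed

text \<open>By \<open>circle_degree_unique\<close> any radius decides, but the existential form needs no choice.\<close>

definition positive_at :: "(complex \<Rightarrow> complex) \<Rightarrow> complex set \<Rightarrow> complex \<Rightarrow> bool" where
  "positive_at h S z \<longleftrightarrow> (\<exists>r>0. cball z r \<subseteq> S \<and> circle_degree h z r = 1)"

lemma circle_degree_unique:
  assumes h: "continuous_on S h" "inj_on h S" and r: "0 < r" "cball z r \<subseteq> S" "0 < r'" "cball z r' \<subseteq> S"
  shows "circle_degree h z r = circle_degree h z r'"
proof -
  have *: "circle_degree h z r = circle_degree h z r'" if "0 < r" "r \<le> r'" "cball z r' \<subseteq> S" for r r'
    by (rule circle_degree_cong[OF continuous_on_subset[OF h(1) that(3)] inj_on_subset[OF h(2) that(3)] _ that(1)])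
      (use that in auto)
  show ?thesis
  proof (cases "r \<le> r'")
    case True
    show ?thesis by (rule *[OF r(1) True r(4)])
  next
    case False
    then have "r' \<le> r" by simp
    from *[OF r(3) this r(2)] show ?thesis ..
  qed
qed

lemma positive_at_circle:
  assumes h: "continuous_on S h" "inj_on h S" and r: "0 < r" "cball z r \<subseteq> S"
  shows "positive_at h S z \<longleftrightarrow> circle_degree h z r = 1"
  unfolding positive_at_def using circle_degree_unique[OF h] r by metis

lemma positive_at_cong:
  assumes "open W" "z \<in> W" "W \<subseteq> S" "W \<subseteq> S'" "\<And>w. w \<in> W \<Longrightarrow> h w = h' w"
    and h: "continuous_on S h" "inj_on h S" "continuous_on S' h'" "inj_on h' S'"
  shows "positive_at h S z \<longleftrightarrow> positive_at h' S' z"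
proof -
  obtain r where r: "r > 0" "cball z r \<subseteq> W"
    using assms(1,2) open_contains_cball by blast
  have "winding_number (h \<circ> circlepath z r) (h z) = winding_number (h' \<circ> circlepath z r) (h' z)"
  proof -
    have "h (circlepath z r t) = h' (circlepath z r t)" if "t \<in> {0..1}" for t
    proof (rule assms(5))
      have "circlepath z r t \<in> path_image (circlepath z r)" using that by (auto simp: path_image_def)
      then show "circlepath z r t \<in> W" using r by (auto simp: path_image_circlepath_nonneg)
    qed
    then have "winding_number (h \<circ> circlepath z r) (h z) = winding_number (h' \<circ> circlepath z r) (h z)"
      by (intro winding_number_cong) simp
    moreover have "h z = h' z" using assms by auto
    ultimately show ?thesis by simp
  qed
  then have "circle_degree h z r = circle_degree h' z r" by (simp add: circle_degree_def)
  then show ?thesis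
    using positive_at_circle[OF h(1,2) r(1)] positive_at_circle[OF h(3,4) r(1)] r assms by simp
qed

lemma positive_at_nearby:
  assumes h: "continuous_on S h" "inj_on h S" and R: "cball z R \<subseteq> S" "z' \<in> ball z R"
  shows "positive_at h S z' \<longleftrightarrow> positive_at h S z"
proof -
  have R0: "R > 0" using R(2) zero_le_dist[of z z'] by (metis mem_ball order_le_less_trans)
  obtain r where r: "r > 0" "cball z' r \<subseteq> ball z R"
    using R(2) open_ball open_contains_cball by blast
  have "circle_degree h z' r = circle_degree h z R"
    by (rule circle_degree_cong[OF continuous_on_subset[OF h(1) R(1)] inj_on_subset[OF h(2) R(1)] _ r(1)])
      (use R r in auto)
  moreover have "cball z' r \<subseteq> S" using r R by (meson ball_subset_cball order_trans)
  ultimately show ?thesis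
    using positive_at_circle[OF h r(1)] positive_at_circle[OF h R0 R(1)] by simp
qed

lemma positive_at_compose:
  assumes k: "continuous_on S k" "inj_on k S" "positive_at k S z"
    and h: "continuous_on S' h" "inj_on h S'" and S': "open S'" "k z \<in> S'"
    and hk: "continuous_on S'' (h \<circ> k)" "inj_on (h \<circ> k) S''" and S'': "open S''" "z \<in> S''"
  shows "positive_at (h \<circ> k) S'' z \<longleftrightarrow> positive_at h S' (k z)"
proof -
  obtain R where R: "R > 0" "cball (k z) R \<subseteq> S'" using S' open_contains_cball by blast
  obtain r1 where r1: "r1 > 0" "cball z r1 \<subseteq> S"
    using k(3) by (auto simp: positive_at_def)
  obtain r2 where r2: "r2 > 0" "cball z r2 \<subseteq> S''" using S'' open_contains_cball by blast
  have "continuous (at z) k"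
    using continuous_on_interior[OF k(1), of z] r1
    by (meson ball_subset_cball centre_in_ball interiorI open_ball subset_trans)
  then obtain d where d: "d > 0" "\<And>w. dist w z < d \<Longrightarrow> dist (k w) (k z) < R"
    using R(1) unfolding continuous_at_eps_delta by blast
  define r where "r = min (min r1 r2) (d / 2)"
  have r: "r > 0" "cball z r \<subseteq> S" "cball z r \<subseteq> S''" "k ` cball z r \<subseteq> cball (k z) R"
  proof -
    show "r > 0" using r1 r2 d by (simp add: r_def)
    have "cball z r \<subseteq> cball z r1" "cball z r \<subseteq> cball z r2" by (auto simp: r_def)
    then show "cball z r \<subseteq> S" "cball z r \<subseteq> S''" using r1 r2 by blast+
    have "dist (k w) (k z) < R" if "w \<in> cball z r" for w
      using that d by (intro d(2)) (auto simp: r_def dist_commute)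
    then show "k ` cball z r \<subseteq> cball (k z) R" by (auto simp: dist_commute less_imp_le)
  qed
  have "circle_degree (h \<circ> k) z r = circle_degree h (k z) R"
    using positive_at_circle[OF k(1,2) r(1,2)] k(3) r R
    by (intro circle_degree_compose continuous_on_subset[OF k(1)] inj_on_subset[OF k(2)]
        continuous_on_subset[OF h(1)] inj_on_subset[OF h(2)]) auto
  then show ?thesis
    using positive_at_circle[OF hk r(1,3)] positive_at_circle[OF h R] by simp
qed

lemma positive_at_jacobian:
  assumes "continuous_on S k" "inj_on k S" "open S" "z \<in> S" "k differentiable (at z)" "real_jacobian k z > 0"
  shows "positive_at k S z"
proof -
  obtain R where R: "R > 0" "cball z R \<subseteq> S" using assms open_contains_cball by blast
  obtain \<delta> where \<delta>: "\<delta> > 0" "\<And>r. 0 < r \<Longrightarrow> r < \<delta> \<Longrightarrow> circle_degree k z r = 1"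
    using circle_degree_positive_jacobian[OF assms(5,6) continuous_on_subset[OF assms(1) R(2)] R(1)] by blast
  show ?thesis
    unfolding positive_at_def using \<delta> R by (intro exI[of _ "min R (\<delta> / 2)"]) auto
qed

lemma positive_at_holomorphic:
  assumes "g holomorphic_on S" "inj_on g S" "open S" "z \<in> S"
  shows "positive_at g S z"
proof (rule positive_at_jacobian[OF holomorphic_on_imp_continuous_on[OF assms(1)] assms(2-4)])
  have der: "(g has_field_derivative deriv g z) (at z)"
    using assms holomorphic_derivI by blast
  then have hd: "(g has_derivative (*) (deriv g z)) (at z)"
    by (simp add: has_field_derivative_def)
  then show "g differentiable (at z)" by (rule differentiableI)
  have "frechet_derivative g (at z) = (*) (deriv g z)"
    using frechet_derivative_at[OF hd] by simp
  then have "real_jacobian g z = Re (deriv g z) * Re (deriv g z) + Im (deriv g z) * Im (deriv g z)"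
    by (simp add: real_jacobian_def)
  then have "real_jacobian g z = (norm (deriv g z))\<^sup>2"
    unfolding cmod_power2 by (simp add: power2_eq_square)
  moreover have "deriv g z \<noteq> 0"
    using holomorphic_injective_imp_regular assms by blast
  ultimately show "real_jacobian g z > 0" by simp
qed

subsection \<open>Charts\<close>

lemma surface_chart:
  assumes "surface X A" "c \<in> A"
  shows "openin X (fst c)" "open (snd c ` fst c)" "inj_on (snd c) (fst c)"
    and "homeomorphic_map (subtopology X (fst c)) (top_of_set (snd c ` fst c)) (snd c)"
    and "fst c \<subseteq> topspace X"
proof -
  obtain U \<phi> where c: "c = (U, \<phi>)" by force
  show *: "openin X (fst c)" "open (snd c ` fst c)"
     "homeomorphic_map (subtopology X (fst c)) (top_of_set (snd c ` fst c)) (snd c)"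
    using assms unfolding surface_def c by auto
  then show "fst c \<subseteq> topspace X" by (simp add: openin_subset)
  then show "inj_on (snd c) (fst c)"
    using homeomorphic_imp_injective_map[OF *(3)] by (simp add: Int_absorb1)
qed

lemma surface_cover:
  assumes "surface X A" "x \<in> topspace X"
  obtains c where "c \<in> A" "x \<in> fst c"
proof -
  have "x \<in> (\<Union>(U, \<phi>)\<in>A. U)" using assms by (simp add: surface_def)
  then obtain c where "c \<in> A" "x \<in> (case c of (U, \<phi>) \<Rightarrow> U)" by blast
  then show ?thesis using that by (simp add: case_prod_unfold)
qed

lemma chart_image_open:
  assumes "surface X A" "c \<in> A" "openin X W"
  shows "open (snd c ` (fst c \<inter> W))"
proof -
  note ch = surface_chart[OF assms(1,2)]
  have "openin (subtopology X (fst c)) (fst c \<inter> W)"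
    using assms(3) ch(1) by (metis inf_commute openin_subtopology)
  then have "openin (top_of_set (snd c ` fst c)) (snd c ` (fst c \<inter> W))"
    using homeomorphic_imp_open_map[OF ch(4)] unfolding open_map_def by blast
  then show ?thesis using ch(2) openin_open_trans by blast
qed

lemma chart_preimage_open:
  assumes "surface X A" "c \<in> A" "open W"
  shows "openin X {x \<in> fst c. snd c x \<in> W}"
proof -
  note ch = surface_chart[OF assms(1,2)]
  have "openin (top_of_set (snd c ` fst c)) (snd c ` fst c \<inter> W)"
    using assms by auto
  from openin_continuous_map_preimage[OF homeomorphic_imp_continuous_map[OF ch(4)] this]
  have "openin (subtopology X (fst c)) {x \<in> topspace (subtopology X (fst c)). snd c x \<in> snd c ` fst c \<inter> W}" .
  moreover have "{x \<in> topspace (subtopology X (fst c)). snd c x \<in> snd c ` fst c \<inter> W} = {x \<in> fst c. snd c x \<in> W}"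
    using ch(5) by auto
  ultimately have "openin (subtopology X (fst c)) {x \<in> fst c. snd c x \<in> W}" by simp
  then show ?thesis using ch(1) openin_trans_full by blast
qed

lemma local_dom_open:
  assumes "surface X A" "surface Y B" "continuous_map X Y \<omega>" "c \<in> A" "d \<in> B"
  shows "open (local_dom c \<omega> d)"
proof -
  have "openin X {x \<in> topspace X. \<omega> x \<in> fst d}"
    by (rule openin_continuous_map_preimage[OF assms(3) surface_chart(1)[OF assms(2,5)]])
  from chart_image_open[OF assms(1,4) this] have "open (snd c ` (fst c \<inter> {x \<in> topspace X. \<omega> x \<in> fst d}))" .
  moreover have "fst c \<inter> {x \<in> topspace X. \<omega> x \<in> fst d} = fst c \<inter> \<omega> -` fst d"
    using surface_chart(5)[OF assms(1,4)] by auto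
  ultimately show ?thesis by (simp add: local_dom_def)
qed

lemma local_rep_chart:
  assumes "surface X A" "c \<in> A" "x \<in> fst c"
  shows "local_rep c \<omega> d (snd c x) = snd d (\<omega> x)"
  using surface_chart(3)[OF assms(1,2)] assms(3) by (simp add: local_rep_def)

lemma local_rep_continuous:
  assumes "surface X A" "surface Y B" "continuous_map X Y \<omega>" "c \<in> A" "d \<in> B"
  shows "continuous_on (local_dom c \<omega> d) (local_rep c \<omega> d)"
  unfolding continuous_on_open_vimage[OF local_dom_open[OF assms]]
proof (intro allI impI)
  fix W :: "complex set" assume "open W"
  then have "openin Y {y \<in> fst d. snd d y \<in> W}"
    by (rule chart_preimage_open[OF assms(2,5)])
  from openin_continuous_map_preimage[OF assms(3) this]
  have "openin X {x \<in> topspace X. \<omega> x \<in> {y \<in> fst d. snd d y \<in> W}}" .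
  from chart_image_open[OF assms(1,4) this]
  have "open (snd c ` (fst c \<inter> {x \<in> topspace X. \<omega> x \<in> {y \<in> fst d. snd d y \<in> W}}))" .
  moreover have "local_rep c \<omega> d -` W \<inter> local_dom c \<omega> d =
      snd c ` (fst c \<inter> {x \<in> topspace X. \<omega> x \<in> {y \<in> fst d. snd d y \<in> W}})"
    using surface_chart(5)[OF assms(1,4)] local_rep_chart[OF assms(1,4), of _ \<omega> d]
    by (auto simp: local_dom_def)
  ultimately show "open (local_rep c \<omega> d -` W \<inter> local_dom c \<omega> d)" by simp
qed

lemma local_rep_inj:
  assumes "surface X A" "surface Y B" "inj_on \<omega> (topspace X)" "c \<in> A" "d \<in> B"
  shows "inj_on (local_rep c \<omega> d) (local_dom c \<omega> d)"
proof (rule inj_onI)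
  fix z w assume "z \<in> local_dom c \<omega> d" "w \<in> local_dom c \<omega> d"
    and eq: "local_rep c \<omega> d z = local_rep c \<omega> d w"
  then obtain x y where xy: "z = snd c x" "x \<in> fst c" "\<omega> x \<in> fst d" "w = snd c y" "y \<in> fst c" "\<omega> y \<in> fst d"
    by (auto simp: local_dom_def)
  then have "snd d (\<omega> x) = snd d (\<omega> y)"
    using eq local_rep_chart[OF assms(1,4), of _ \<omega> d] by simp
  then have "\<omega> x = \<omega> y"
    using surface_chart(3)[OF assms(2,5)] xy by (auto dest: inj_onD)
  then show "z = w"
    using assms(3) xy surface_chart(5)[OF assms(1,4)] by (auto dest: inj_onD)
qed

text \<open>The rule \<open>circle_degree_compose\<close>, read in charts.\<close>

lemma positive_at_chart_compose:
  assumes S: "surface X A" "surface Y B" "surface Z C"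
    and \<alpha>: "continuous_map X Y \<alpha>" "inj_on \<alpha> (topspace X)"
    and \<beta>: "continuous_map Y Z \<beta>" "inj_on \<beta> (topspace Y)"
    and ch: "c \<in> A" "d \<in> B" "e \<in> C"
    and x: "x \<in> fst c" "\<alpha> x \<in> fst d" "\<beta> (\<alpha> x) \<in> fst e"
    and pos: "positive_at (local_rep c \<alpha> d) (local_dom c \<alpha> d) (snd c x)"
  shows "positive_at (local_rep c (\<beta> \<circ> \<alpha>) e) (local_dom c (\<beta> \<circ> \<alpha>) e) (snd c x) \<longleftrightarrow>
    positive_at (local_rep d \<beta> e) (local_dom d \<beta> e) (snd d (\<alpha> x))"
proof -
  let ?W = "{x \<in> topspace X. \<alpha> x \<in> {y \<in> topspace Y. \<beta> y \<in> fst e} \<inter> fst d}"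
  define S where "S = snd c ` (fst c \<inter> ?W)"
  have "openin Y ({y \<in> topspace Y. \<beta> y \<in> fst e} \<inter> fst d)"
    by (intro openin_Int surface_chart(1)[OF assms(2) ch(2)]
        openin_continuous_map_preimage[OF \<beta>(1) surface_chart(1)[OF assms(3) ch(3)]])
  from chart_image_open[OF assms(1) ch(1) openin_continuous_map_preimage[OF \<alpha>(1) this]]
  have oS: "open S" by (simp add: S_def)
  have \<beta>\<alpha>: "continuous_map X Z (\<beta> \<circ> \<alpha>)" "inj_on (\<beta> \<circ> \<alpha>) (topspace X)"
    using continuous_map_compose[OF \<alpha>(1) \<beta>(1)] comp_inj_on[OF \<alpha>(2) inj_on_subset[OF \<beta>(2)]]
      continuous_map_image_subset_topspace[OF \<alpha>(1)] by auto
  have W: "x \<in> ?W"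
    using x surface_chart(5)[OF assms(1) ch(1)] surface_chart(5)[OF assms(2) ch(2)] by auto
  have zS: "snd c x \<in> S" using W x by (auto simp: S_def)
  have sub: "S \<subseteq> local_dom c (\<beta> \<circ> \<alpha>) e" "S \<subseteq> local_dom c \<alpha> d"
    by (auto simp: S_def local_dom_def)
  have eq: "local_rep c (\<beta> \<circ> \<alpha>) e w = (local_rep d \<beta> e \<circ> local_rep c \<alpha> d) w" if "w \<in> S" for w
    using that local_rep_chart[OF assms(1) ch(1), of _ "\<beta> \<circ> \<alpha>" e]
      local_rep_chart[OF assms(1) ch(1), of _ \<alpha> d] local_rep_chart[OF assms(2) ch(2), of _ \<beta> e]
    by (auto simp: S_def)
  have cont: "continuous_on S (local_rep c (\<beta> \<circ> \<alpha>) e)" "inj_on (local_rep c (\<beta> \<circ> \<alpha>) e) S"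
    using continuous_on_subset[OF local_rep_continuous[OF assms(1,3) \<beta>\<alpha>(1) ch(1,3)] sub(1)]
      inj_on_subset[OF local_rep_inj[OF assms(1,3) \<beta>\<alpha>(2) ch(1,3)] sub(1)] by auto
  then have cont': "continuous_on S (local_rep d \<beta> e \<circ> local_rep c \<alpha> d)"
      "inj_on (local_rep d \<beta> e \<circ> local_rep c \<alpha> d) S"
    using continuous_on_cong[of S S "local_rep c (\<beta> \<circ> \<alpha>) e" "local_rep d \<beta> e \<circ> local_rep c \<alpha> d"]
      inj_on_cong[of S "local_rep c (\<beta> \<circ> \<alpha>) e" "local_rep d \<beta> e \<circ> local_rep c \<alpha> d"] eq by auto
  have r: "local_rep c \<alpha> d (snd c x) = snd d (\<alpha> x)"
    by (rule local_rep_chart[OF assms(1) ch(1) x(1)])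
  have "positive_at (local_rep c (\<beta> \<circ> \<alpha>) e) (local_dom c (\<beta> \<circ> \<alpha>) e) (snd c x) \<longleftrightarrow>
      positive_at (local_rep d \<beta> e \<circ> local_rep c \<alpha> d) S (snd c x)"
    by (rule positive_at_cong[OF oS zS sub(1) order_refl eq
          local_rep_continuous[OF assms(1,3) \<beta>\<alpha>(1) ch(1,3)] local_rep_inj[OF assms(1,3) \<beta>\<alpha>(2) ch(1,3)] cont'])
  also have "\<dots> \<longleftrightarrow> positive_at (local_rep d \<beta> e) (local_dom d \<beta> e) (local_rep c \<alpha> d (snd c x))"
    by (rule positive_at_compose[OF local_rep_continuous[OF assms(1,2) \<alpha>(1) ch(1,2)]
          local_rep_inj[OF assms(1,2) \<alpha>(2) ch(1,2)] pos
          local_rep_continuous[OF assms(2,3) \<beta>(1) ch(2,3)] local_rep_inj[OF assms(2,3) \<beta>(2) ch(2,3)]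
          local_dom_open[OF assms(2,3) \<beta>(1) ch(2,3)] _ cont' oS zS])
      (use x r in \<open>auto simp: local_dom_def\<close>)
  finally show ?thesis using r by simp
qed

text \<open>Whether a homeomorphism preserves the orientation at a point does not depend on the charts,
  since their transition maps have local degree 1. Both alternatives are open conditions on the
  point, so only one of them occurs on a connected surface. If it is the negative one, then conjugating the
  charts of the target changes all local degrees from -1 to 1.\<close>

lemma orientation_dichotomy:
  assumes X: "smooth_oriented_surface X A" and Y: "riemann_surface Y B" and \<omega>: "homeomorphic_map X Y \<omega>"
  shows "(\<forall>c\<in>A. \<forall>d\<in>B. orientation_preserving_on (local_dom c \<omega> d) (local_rep c \<omega> d)) \<or>
    (\<forall>c\<in>A. \<forall>d\<in>B. orientation_preserving_on (local_dom c \<omega> d) (cnj \<circ> local_rep c \<omega> d))"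
proof -
  have S: "surface X A" "surface Y B"
    using X Y by (auto simp: smooth_oriented_surface_def riemann_surface_def)
  have cont: "continuous_map X Y \<omega>" and inj: "inj_on \<omega> (topspace X)"
    using \<omega> homeomorphic_imp_continuous_map homeomorphic_imp_injective_map by blast+
  define pos where "pos c d x \<longleftrightarrow> positive_at (local_rep c \<omega> d) (local_dom c \<omega> d) (snd c x)" for c d x
  have idX: "positive_at (local_rep c id c') (local_dom c id c') (snd c x)"
    if "c \<in> A" "c' \<in> A" "x \<in> fst c" "x \<in> fst c'" for c c' x
  proof -
    have d: "snd c x \<in> local_dom c id c'" using that by (auto simp: local_dom_def)
    have o: "open (local_dom c id c')" by (rule local_dom_open[OF S(1) S(1) continuous_map_id that(1,2)])
    have sm: "smooth_on (local_dom c id c') (local_rep c id c')"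
      "\<And>z. z \<in> local_dom c id c' \<Longrightarrow> real_jacobian (local_rep c id c') z > 0"
      using X that unfolding smooth_oriented_surface_def by blast+
    then have "Ck_on (Suc 0) (local_dom c id c') (local_rep c id c')"
      unfolding smooth_on_def by blast
    then have "local_rep c id c' differentiable_on local_dom c id c'" by simp
    then have "local_rep c id c' differentiable (at (snd c x))"
      using d o by (simp add: differentiable_on_eq_differentiable_at)
    then show ?thesis
      using d o sm(2)
      by (intro positive_at_jacobian local_rep_continuous[OF S(1) S(1) continuous_map_id that(1,2)]
          local_rep_inj[OF S(1) S(1) inj_on_id that(1,2)]) auto
  qed
  have idY: "positive_at (local_rep d id d') (local_dom d id d') (snd d y)"
    if "d \<in> B" "d' \<in> B" "y \<in> fst d" "y \<in> fst d'" for d d' y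
    using that Y unfolding riemann_surface_def
    by (intro positive_at_holomorphic local_dom_open[OF S(2) S(2) continuous_map_id that(1,2)]
          local_rep_inj[OF S(2) S(2) inj_on_id that(1,2)]) (auto simp: local_dom_def)
  have indep: "pos c' d' x" if pos: "pos c d x" and ch: "c \<in> A" "c' \<in> A" "d \<in> B" "d' \<in> B"
      and x: "x \<in> fst c" "x \<in> fst c'" "\<omega> x \<in> fst d" "\<omega> x \<in> fst d'" for c c' d d' x
  proof -
    have "pos c d' x"
      using positive_at_chart_compose[OF S(1,2) S(2) cont inj continuous_map_id inj_on_id ch(1,3,4) x(1,3)]
        pos idY[OF ch(3,4)] x unfolding pos_def by simp
    then show ?thesis
      using positive_at_chart_compose[OF S(1) S(1,2) continuous_map_id inj_on_id cont inj ch(2,1,4) x(2)]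
        idX[OF ch(2,1)] x unfolding pos_def by simp
  qed
  define E where "E = {x \<in> topspace X. \<exists>c\<in>A. \<exists>d\<in>B. x \<in> fst c \<and> \<omega> x \<in> fst d \<and> pos c d x}"
  define N where "N = {x \<in> topspace X. \<exists>c\<in>A. \<exists>d\<in>B. x \<in> fst c \<and> \<omega> x \<in> fst d \<and> \<not> pos c d x}"
  have nbhd: "\<exists>W. openin X W \<and> x \<in> W \<and> (\<forall>y\<in>W. y \<in> fst c \<and> \<omega> y \<in> fst d \<and> (pos c d y \<longleftrightarrow> pos c d x))"
    if ch: "c \<in> A" "d \<in> B" and x: "x \<in> fst c" "\<omega> x \<in> fst d" for c d x
  proof -
    have "snd c x \<in> local_dom c \<omega> d" using x by (auto simp: local_dom_def)
    then obtain R where R: "R > 0" "cball (snd c x) R \<subseteq> local_dom c \<omega> d"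
      using local_dom_open[OF S cont ch] open_contains_cball by blast
    let ?W = "{y \<in> fst c. snd c y \<in> ball (snd c x) R}"
    have near: "y \<in> fst c \<and> \<omega> y \<in> fst d \<and> (pos c d y \<longleftrightarrow> pos c d x)" if y: "y \<in> ?W" for y
    proof -
      have "snd c y \<in> local_dom c \<omega> d" using y R(2) by auto
      then obtain y' where "y' \<in> fst c" "\<omega> y' \<in> fst d" "snd c y = snd c y'"
        by (auto simp: local_dom_def)
      then have "\<omega> y \<in> fst d" using y surface_chart(3)[OF S(1) ch(1)] by (auto dest: inj_onD)
      then show ?thesis
        using y positive_at_nearby[OF local_rep_continuous[OF S cont ch] local_rep_inj[OF S inj ch] R(2)]
        unfolding pos_def by auto
    qed
    show ?thesis
    proof (intro exI[of _ ?W] conjI)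
      show "openin X ?W" by (rule chart_preimage_open[OF S(1) ch(1) open_ball])
      show "x \<in> ?W" using x R(1) by simp
      show "\<forall>y\<in>?W. y \<in> fst c \<and> \<omega> y \<in> fst d \<and> (pos c d y \<longleftrightarrow> pos c d x)"
        using near by (intro ballI)
    qed
  qed
  have oE: "openin X E"
  proof (subst openin_subopen, intro ballI)
    fix x assume "x \<in> E"
    then obtain c d where cd: "c \<in> A" "d \<in> B" "x \<in> fst c" "\<omega> x \<in> fst d" "pos c d x"
      by (auto simp: E_def)
    obtain W where W: "openin X W" "x \<in> W"
      "\<forall>y\<in>W. y \<in> fst c \<and> \<omega> y \<in> fst d \<and> (pos c d y \<longleftrightarrow> pos c d x)"
      using nbhd[OF cd(1-4)] by blast
    have "W \<subseteq> E" using W cd openin_subset[OF W(1)] unfolding E_def by blast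
    then show "\<exists>T. openin X T \<and> x \<in> T \<and> T \<subseteq> E" using W by blast
  qed
  have oN: "openin X N"
  proof (subst openin_subopen, intro ballI)
    fix x assume "x \<in> N"
    then obtain c d where cd: "c \<in> A" "d \<in> B" "x \<in> fst c" "\<omega> x \<in> fst d" "\<not> pos c d x"
      by (auto simp: N_def)
    obtain W where W: "openin X W" "x \<in> W"
      "\<forall>y\<in>W. y \<in> fst c \<and> \<omega> y \<in> fst d \<and> (pos c d y \<longleftrightarrow> pos c d x)"
      using nbhd[OF cd(1-4)] by blast
    have "W \<subseteq> N" using W cd openin_subset[OF W(1)] unfolding N_def by blast
    then show "\<exists>T. openin X T \<and> x \<in> T \<and> T \<subseteq> N" using W by blast
  qed
  have "topspace X \<subseteq> E \<union> N"
  proof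
    fix x assume x: "x \<in> topspace X"
    then have "\<omega> x \<in> topspace Y" using cont continuous_map_image_subset_topspace by blast
    then obtain c d where "c \<in> A" "x \<in> fst c" "d \<in> B" "\<omega> x \<in> fst d"
      using surface_cover[OF S(1) x] surface_cover[OF S(2)] by metis
    then show "x \<in> E \<union> N" using x unfolding E_def N_def by blast
  qed
  moreover have "E \<inter> N = {}"
    using indep unfolding E_def N_def by blast
  moreover have "connected_space X" using S(1) by (simp add: surface_def)
  ultimately have "E = {} \<or> N = {}"
    using oE oN unfolding connected_space_def by blast
  then show ?thesis
  proof
    assume N: "N = {}"
    have "circle_degree (local_rep c \<omega> d) z r = 1"
      if ch: "c \<in> A" "d \<in> B" and z: "z \<in> local_dom c \<omega> d" "r > 0" "cball z r \<subseteq> local_dom c \<omega> d" for c d z r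
    proof -
      obtain x where x: "x \<in> fst c" "\<omega> x \<in> fst d" "z = snd c x" using z by (auto simp: local_dom_def)
      then have "pos c d x" using N ch surface_chart(5)[OF S(1) ch(1)] unfolding N_def by blast
      then show ?thesis
        using positive_at_circle[OF local_rep_continuous[OF S cont ch] local_rep_inj[OF S inj ch] z(2,3)] x
        by (simp add: pos_def)
    qed
    then show ?thesis
      by (intro disjI1) (auto simp: orientation_preserving_on_def circle_degree_def)
  next
    assume E: "E = {}"
    have "circle_degree (cnj \<circ> local_rep c \<omega> d) z r = 1"
      if ch: "c \<in> A" "d \<in> B" and z: "z \<in> local_dom c \<omega> d" "r > 0" "cball z r \<subseteq> local_dom c \<omega> d" for c d z r
    proof -
      note ci = local_rep_continuous[OF S cont ch] local_rep_inj[OF S inj ch]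
      obtain x where x: "x \<in> fst c" "\<omega> x \<in> fst d" "z = snd c x" using z by (auto simp: local_dom_def)
      then have "\<not> pos c d x" using E ch surface_chart(5)[OF S(1) ch(1)] unfolding E_def by blast
      then have "circle_degree (local_rep c \<omega> d) z r \<noteq> 1"
        using positive_at_circle[OF ci z(2,3)] x by (simp add: pos_def)
      then have "circle_degree (local_rep c \<omega> d) z r = -1"
        using circle_degree_cases[OF continuous_on_subset[OF ci(1) z(3)] inj_on_subset[OF ci(2) z(3)] z(2)] by blast
      then show ?thesis
        using circle_degree_cnj[OF continuous_on_subset[OF ci(1) z(3)] inj_on_subset[OF ci(2) z(3)] z(2)] by simp
    qed
    then show ?thesis
      by (intro disjI2) (auto simp: orientation_preserving_on_def circle_degree_def)
  qed
qed

section \<open>Marked punctured tori\<close>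

abbreviation puncT :: "(complex \<times> complex) topology" where
  "puncT \<equiv> top_of_set punctured_torus"

definition loop_a :: "real \<Rightarrow> complex \<times> complex" where
  "loop_a t = (cis (2 * pi * t), 1)"

definition loop_b :: "real \<Rightarrow> complex \<times> complex" where
  "loop_b t = (1, cis (2 * pi * t))"

lemma cis_2pi_eq_minus_1_iff: "cis (2 * pi * x) = -1 \<longleftrightarrow> x - 1/2 \<in> \<int>"
proof -
  have "cis (2 * pi * (1/2)) = -1" by (simp add: cis_pi)
  then show ?thesis using cis_2pi_eq_iff[of x "1/2"] by simp
qed

lemma cis_2pi_ne_minus_1: "\<bar>x\<bar> < 1/2 \<Longrightarrow> cis (2 * pi * x) \<noteq> -1"
proof
  assume x: "\<bar>x\<bar> < 1/2" and "cis (2 * pi * x) = -1"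
  then obtain n :: int where "x - 1/2 = of_int n" by (auto simp: cis_2pi_eq_minus_1_iff elim: Ints_cases)
  then have "real_of_int (-1) < real_of_int n" "real_of_int n < real_of_int 0" using x by simp_all
  then have "-1 < n" "n < 0" by (simp_all only: of_int_less_iff)
  then show False by simp
qed

lemma torus_point_in_punctured:
  "torus_point (Complex x y) \<in> punctured_torus \<longleftrightarrow> \<not> (x - 1/2 \<in> \<int> \<and> y - 1/2 \<in> \<int>)"
  using torus_point_in[of "Complex x y"]
  by (auto simp: punctured_torus_def torus_point_def cis_2pi_eq_minus_1_iff)

text \<open>The linear homotopy in the plane is projected to the torus.\<close>

lemma based_homotopic_lift:
  assumes c: "continuous_on {0..1} p" "continuous_on {0..1} q"
    and ends: "p 0 = q 0" "p 1 = q 1" "torus_point (p 0) = x" "torus_point (p 1) = x"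
    and avoid: "\<And>u t. u \<in> {0..1} \<Longrightarrow> t \<in> {0..1} \<Longrightarrow>
      torus_point ((1 - u) *\<^sub>R p t + u *\<^sub>R q t) \<in> punctured_torus"
  shows "based_homotopic puncT x (torus_point \<circ> p) (torus_point \<circ> q)"
  unfolding based_homotopic_def homotopic_with_def
proof (intro exI[of _ "\<lambda>z. torus_point ((1 - fst z) *\<^sub>R p (snd z) + fst z *\<^sub>R q (snd z))"] conjI allI ballI)
  have 1: "continuous_on ({0..1} \<times> {0..1}) (\<lambda>z::real \<times> real. p (snd z))"
    by (rule continuous_on_compose2[OF c(1) continuous_on_snd[OF continuous_on_id]]) auto
  have 2: "continuous_on ({0..1} \<times> {0..1}) (\<lambda>z::real \<times> real. q (snd z))"
    by (rule continuous_on_compose2[OF c(2) continuous_on_snd[OF continuous_on_id]]) auto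
  have "continuous_on ({0..1} \<times> {0..1}) (\<lambda>z. torus_point ((1 - fst z) *\<^sub>R p (snd z) + fst z *\<^sub>R q (snd z)))"
    by (rule continuous_on_compose2[OF continuous_on_torus_point[of UNIV]]) (auto intro!: continuous_intros 1 2)
  then show "continuous_map (prod_topology (top_of_set {0..1}) (top_of_set {0..1})) puncT
      (\<lambda>z. torus_point ((1 - fst z) *\<^sub>R p (snd z) + fst z *\<^sub>R q (snd z)))"
    using avoid by (auto simp: prod_topology_subtopology_eu continuous_map_in_subtopology Pi_iff image_subset_iff)
next
  fix u :: real assume "u \<in> {0..1}"
  have "(1 - u) *\<^sub>R w + u *\<^sub>R w = w" for w :: complex by (simp flip: scaleR_left.add)
  then show "torus_point ((1 - fst (u, 0)) *\<^sub>R p (snd (u, 0)) + fst (u, 0) *\<^sub>R q (snd (u, 0))) = x"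
    "torus_point ((1 - fst (u, 1)) *\<^sub>R p (snd (u, 1)) + fst (u, 1) *\<^sub>R q (snd (u, 1))) = x"
    using ends by simp_all
qed auto

lemma loop_a_lift: "loop_a = torus_point \<circ> (\<lambda>t. Complex t 0)"
  by (auto simp: loop_a_def torus_point_def)

lemma loop_b_lift: "loop_b = torus_point \<circ> (\<lambda>t. Complex 0 t)"
  by (auto simp: loop_b_def torus_point_def)

lemma torus_point_int: "torus_point (Complex (of_int m) (of_int n)) = (1, 1)"
proof -
  have "torus_point (Complex (of_int m) (of_int n)) = torus_point (Complex 0 0)"
    by (subst torus_point_eq_iff) simp
  then show ?thesis by (simp add: torus_point_def)
qed

lemma not_half_Int: "\<bar>x :: real\<bar> < 1/2 \<Longrightarrow> x - 1/2 \<notin> \<int>"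
  using cis_2pi_ne_minus_1 cis_2pi_eq_minus_1_iff by blast

lemma based_loop_lift:
  assumes "continuous_on {0..1} p" "torus_point (p 0) = x" "torus_point (p 1) = x"
    "\<And>t. t \<in> {0..1} \<Longrightarrow> torus_point (p t) \<in> punctured_torus"
  shows "based_loop puncT x (torus_point \<circ> p)"
proof -
  have "(1 - u) *\<^sub>R w + u *\<^sub>R w = w" for w :: complex and u :: real by (simp flip: scaleR_left.add)
  then have "based_homotopic puncT x (torus_point \<circ> p) (torus_point \<circ> p)"
    using assms by (intro based_homotopic_lift) auto
  then show ?thesis by (rule based_homotopic_loops)
qed

lemma based_loop_a: "based_loop puncT (1, 1) loop_a"
  unfolding loop_a_lift
proof (rule based_loop_lift)
  show "continuous_on {0..1} (\<lambda>t. Complex t 0)" unfolding Complex_eq by (intro continuous_intros)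
  show "torus_point (Complex t 0) \<in> punctured_torus" if "t \<in> {0..1}" for t
    by (simp add: torus_point_in_punctured not_half_Int)
qed (use torus_point_int[of 0 0] torus_point_int[of 1 0] in simp_all)

lemma based_loop_b: "based_loop puncT (1, 1) loop_b"
  unfolding loop_b_lift
proof (rule based_loop_lift)
  show "continuous_on {0..1} (\<lambda>t. Complex 0 t)" unfolding Complex_eq by (intro continuous_intros)
  show "torus_point (Complex 0 t) \<in> punctured_torus" if "t \<in> {0..1}" for t
    by (simp add: torus_point_in_punctured not_half_Int)
qed (use torus_point_int[of 0 0] torus_point_int[of 0 1] in simp_all)

subsection \<open>Homeomorphisms that realise Nielsen moves\<close>

lemma puncT_homeomorphic_mapI:
  assumes "continuous_on torus_set f" "continuous_on torus_set g"
    and "\<And>x. x \<in> torus_set \<Longrightarrow> f x \<in> torus_set \<and> g (f x) = x"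
    and "\<And>x. x \<in> torus_set \<Longrightarrow> g x \<in> torus_set \<and> f (g x) = x"
    and "f (-1, -1) = (-1, -1)"
  shows "homeomorphic_map puncT puncT f"
proof -
  have "(-1, -1) \<in> torus_set" by (simp add: torus_set_def)
  from homeomorphic_map_restrict_point[OF torus_homeomorphismI[OF assms(1-4)] this] assms(5)
  show ?thesis by (simp add: punctured_torus_def)
qed

definition swap_map :: "complex \<times> complex \<Rightarrow> complex \<times> complex" where
  "swap_map x = (snd x, fst x)"

definition flip_map :: "complex \<times> complex \<Rightarrow> complex \<times> complex" where
  "flip_map x = (cnj (fst x), snd x)"

lemma homeomorphic_swap: "homeomorphic_map puncT puncT swap_map"
  by (rule puncT_homeomorphic_mapI[where g = swap_map])
    (auto simp: swap_map_def torus_set_def intro!: continuous_intros)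

lemma homeomorphic_flip: "homeomorphic_map puncT puncT flip_map"
  by (rule puncT_homeomorphic_mapI[where g = flip_map])
    (auto simp: flip_map_def torus_set_def intro!: continuous_intros)

text \<open>A map of degree one of the circle that is constant on the upper half circle. Multiplying the
  second coordinate by it is a Dehn twist that is the identity on the circles over 1 and over -1, so
  that the base point and the puncture stay in place.\<close>

definition half_turn :: "complex \<Rightarrow> complex" where
  "half_turn z = (if Im z \<le> 0 then z\<^sup>2 else 1)"

lemma continuous_on_half_turn: "continuous_on (sphere 0 1) half_turn"
proof -
  have eq: "sphere 0 1 = sphere 0 1 \<inter> {z. Im z \<le> 0} \<union> sphere (0::complex) 1 \<inter> {z. Im z \<ge> 0}" by auto
  have "continuous_on (sphere 0 1 \<inter> {z. Im z \<le> 0} \<union> sphere (0::complex) 1 \<inter> {z. Im z \<ge> 0})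
      (\<lambda>z. if Im z \<le> 0 then z\<^sup>2 else 1)"
  proof (rule continuous_on_cases)
    show "\<forall>z. z \<in> sphere 0 1 \<inter> {z. Im z \<le> 0} \<and> \<not> Im z \<le> 0 \<or> z \<in> sphere 0 1 \<inter> {z. Im z \<ge> 0} \<and> Im z \<le> 0 \<longrightarrow> z\<^sup>2 = 1"
    proof (intro allI impI)
      fix z :: complex
      assume "z \<in> sphere 0 1 \<inter> {z. Im z \<le> 0} \<and> \<not> Im z \<le> 0 \<or> z \<in> sphere 0 1 \<inter> {z. Im z \<ge> 0} \<and> Im z \<le> 0"
      then have z: "norm z = 1" "Im z = 0" by auto
      then have "(Re z)\<^sup>2 = 1" using cmod_power2[of z] by simp
      then show "z\<^sup>2 = 1" using z by (simp add: complex_eq_iff power2_eq_square)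
    qed
  qed (auto intro!: closed_Int closed_Collect_le continuous_intros)
  then show ?thesis unfolding half_turn_def[abs_def] using eq by simp
qed

lemma norm_half_turn: "norm z = 1 \<Longrightarrow> norm (half_turn z) = 1"
  by (simp add: half_turn_def norm_power)

definition twist_map :: "complex \<times> complex \<Rightarrow> complex \<times> complex" where
  "twist_map x = (fst x, snd x * half_turn (fst x))"

definition untwist_map :: "complex \<times> complex \<Rightarrow> complex \<times> complex" where
  "untwist_map x = (fst x, snd x * cnj (half_turn (fst x)))"

lemma untwist_twist: "x \<in> torus_set \<Longrightarrow> untwist_map (twist_map x) = x"
  and twist_untwist: "x \<in> torus_set \<Longrightarrow> twist_map (untwist_map x) = x"
proof -
  have "half_turn z * cnj (half_turn z) = 1" if "norm z = 1" for z
    using norm_half_turn[OF that] by (simp add: complex_norm_square[symmetric])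
  then show "x \<in> torus_set \<Longrightarrow> untwist_map (twist_map x) = x"
    "x \<in> torus_set \<Longrightarrow> twist_map (untwist_map x) = x"
    by (auto simp: untwist_map_def twist_map_def torus_set_def mult.assoc mult.commute[of "cnj _"])
qed

lemma homeomorphic_untwist: "homeomorphic_map puncT puncT untwist_map"
proof (rule puncT_homeomorphic_mapI[where g = twist_map])
  have "continuous_on torus_set (\<lambda>x. half_turn (fst x))"
    by (rule continuous_on_compose2[OF continuous_on_half_turn]) (auto simp: torus_set_def intro!: continuous_intros)
  then show "continuous_on torus_set untwist_map" "continuous_on torus_set twist_map"
    unfolding untwist_map_def twist_map_def by (intro continuous_intros; assumption)+
  show "untwist_map x \<in> torus_set \<and> twist_map (untwist_map x) = x" "twist_map x \<in> torus_set \<and> untwist_map (twist_map x) = x"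
    if "x \<in> torus_set" for x
    using that untwist_twist[OF that] twist_untwist[OF that] norm_half_turn
    by (auto simp: untwist_map_def twist_map_def torus_set_def norm_mult)
qed (simp add: untwist_map_def half_turn_def)

lemma swap_loops: "swap_map \<circ> loop_a = loop_b" "swap_map \<circ> loop_b = loop_a"
  by (auto simp: swap_map_def loop_a_def loop_b_def)

lemma flip_loops: "flip_map \<circ> rev_loop loop_a = loop_a" "flip_map \<circ> loop_b = loop_b"
proof -
  have "cnj (cis (2 * pi * (1 - t))) = cis (2 * pi * t)" for t
    using cis_2pi_eq_iff[of "t - 1" t] by (simp add: cis_cnj algebra_simps)
  then show "flip_map \<circ> rev_loop loop_a = loop_a" "flip_map \<circ> loop_b = loop_b"
    by (auto simp: flip_map_def loop_a_def loop_b_def rev_loop_def)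
qed

lemma half_turn_cis:
  assumes "t \<in> {0..1}"
  shows "half_turn (cis (2 * pi * t)) = cis (2 * pi * max 0 (2 * t - 1))"
proof (cases "t \<le> 1/2")
  case True
  have m: "max 0 (2 * t - 1) = 0" using True by simp
  have "sin (2 * pi * t) \<ge> 0" using assms True by (intro sin_ge_zero) (auto simp: field_simps)
  show ?thesis
  proof (cases "sin (2 * pi * t) = 0")
    case True
    have "cos (2 * pi * t) ^ 2 = 1" using True sin_cos_squared_add[of "2 * pi * t"] by simp
    then have "(cis (2 * pi * t))\<^sup>2 = 1" using True by (simp add: complex_eq_iff power2_eq_square)
    then show ?thesis unfolding m by (simp add: half_turn_def)
  next
    case False
    then show ?thesis using \<open>sin (2 * pi * t) \<ge> 0\<close> unfolding m by (auto simp: half_turn_def)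
  qed
next
  case False
  have "sin (2 * pi * t) = - sin (2 * pi * t - pi)" by (simp add: sin_diff)
  moreover have "sin (2 * pi * t - pi) \<ge> 0"
    using assms False by (intro sin_ge_zero) (auto simp: field_simps)
  ultimately have "half_turn (cis (2 * pi * t)) = cis (2 * pi * (2 * t))"
    by (simp add: half_turn_def power2_eq_square cis_mult algebra_simps)
  also have "\<dots> = cis (2 * pi * (2 * t - 1))" by (subst cis_2pi_eq_iff) simp
  finally show ?thesis using False by (simp add: max_def)
qed

text \<open>The twisted loop lifts to the graph of \<open>max 0 (2 t - 1)\<close>, and \<open>a\<close> followed by \<open>b\<close> lifts to two
  sides of the unit square. The segments between the two paths avoid the centres of the squares: in the
  first three quarters of the time the second coordinate is below 1/2, and after that the first one is
  close to 1.\<close>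

lemma twist_loop_a: "based_homotopic puncT (1, 1) (twist_map \<circ> loop_a) (join_loops loop_a loop_b)"
proof -
  define p where "p t = Complex t (max 0 (2 * t - 1))" for t :: real
  define q where "q t = Complex (min 1 (2 * t)) (max 0 (2 * t - 1))" for t :: real
  have ends: "torus_point (p 0) = (1, 1)" "torus_point (p 1) = (1, 1)" "p 0 = q 0" "p 1 = q 1"
    using torus_point_int[of 0 0] torus_point_int[of 1 1] by (simp_all add: p_def q_def)
  have cont: "continuous_on {0..1} p" "continuous_on {0..1} q"
    unfolding p_def q_def Complex_eq by (intro continuous_intros)+
  have bh: "based_homotopic puncT (1, 1) (torus_point \<circ> p) (torus_point \<circ> q)"
  proof (rule based_homotopic_lift[OF cont ends(3,4,1,2)])
    fix u t :: real assume ut: "u \<in> {0..1}" "t \<in> {0..1}"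
    have eq: "(1 - u) *\<^sub>R p t + u *\<^sub>R q t = Complex ((1 - u) * t + u * min 1 (2 * t)) (max 0 (2 * t - 1))"
      by (simp add: p_def q_def complex_eq_iff algebra_simps)
    show "torus_point ((1 - u) *\<^sub>R p t + u *\<^sub>R q t) \<in> punctured_torus"
      unfolding eq torus_point_in_punctured
    proof (rule notI)
      assume A: "(1 - u) * t + u * min 1 (2 * t) - 1/2 \<in> \<int> \<and> max 0 (2 * t - 1) - 1/2 \<in> \<int>"
      show False
      proof (cases "t < 3/4")
        case True
        then have "\<bar>max 0 (2 * t - 1)\<bar> < 1/2" by (auto simp: max_def)
        then show False using A not_half_Int by blast
      next
        case False
        define s where "s = (1 - u) * t + u * min 1 (2 * t)"
        have "s = 1 - (1 - u) * (1 - t)" using False by (simp add: s_def min_def algebra_simps)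
        moreover have "0 \<le> (1 - u) * (1 - t)" using ut by simp
        moreover have "(1 - u) * (1 - t) \<le> 1 * (1/4)" using ut False by (intro mult_mono) auto
        ultimately have "\<bar>s - 1\<bar> < 1/2" by simp
        then have "s - 1 - 1/2 \<notin> \<int>" by (rule not_half_Int)
        moreover have "s - 1/2 \<in> \<int>" using A by (simp add: s_def)
        from Ints_diff[OF this Ints_1] have "s - 1/2 - 1 \<in> \<int>" .
        moreover have "s - 1 - 1/2 = s - 1/2 - 1" by simp
        ultimately show False by metis
      qed
    qed
  qed
  have "torus_point (p t) = twist_map (loop_a t)" if "t \<in> {0..1}" for t
    using half_turn_cis[OF that] by (simp add: p_def torus_point_def twist_map_def loop_a_def)
  then have 1: "based_homotopic puncT (1, 1) (twist_map \<circ> loop_a) (torus_point \<circ> p)"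
    using based_homotopic_sym[OF based_homotopic_eqI[OF based_homotopic_loops(1)[OF bh], of "twist_map \<circ> loop_a"]] by simp
  have "torus_point (q t) = join_loops loop_a loop_b t" if "t \<in> {0..1}" for t
  proof (cases "t \<le> 1/2")
    case True
    then have "q t = Complex (2 * t) 0" by (simp add: q_def min_def max_def)
    then show ?thesis using True by (simp add: torus_point_def join_loops_def loop_a_def)
  next
    case False
    then have "q t = Complex 1 (2 * t - 1)" by (simp add: q_def min_def max_def)
    then show ?thesis using False by (simp add: torus_point_def join_loops_def loop_b_def)
  qed
  then have 2: "based_homotopic puncT (1, 1) (torus_point \<circ> q) (join_loops loop_a loop_b)"
    by (intro based_homotopic_eqI[OF based_homotopic_loops(2)[OF bh]]) simp
  from based_homotopic_trans[OF based_homotopic_trans[OF 1 bh] 2] show ?thesis .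
qed

lemma continuous_map_untwist: "continuous_map puncT puncT untwist_map"
  by (rule homeomorphic_imp_continuous_map[OF homeomorphic_untwist])

lemma loop_in_torus:
  assumes "based_loop puncT (1, 1) c" "t \<in> {0..1}" shows "c t \<in> torus_set"
  using assms continuous_map_image_subset_topspace[of "top_of_set {0..1}" puncT c]
  by (auto simp: based_loop_def pathin_def punctured_torus_def)

lemma untwist_loops:
  "based_homotopic puncT (1, 1) (untwist_map \<circ> join_loops loop_a loop_b) loop_a"
  "untwist_map \<circ> loop_b = loop_b"
proof -
  have 1: "based_homotopic puncT (1, 1) (untwist_map \<circ> (twist_map \<circ> loop_a)) (untwist_map \<circ> join_loops loop_a loop_b)"
    by (rule based_homotopic_map[OF continuous_map_untwist twist_loop_a]) (simp add: untwist_map_def half_turn_def)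
  have "based_homotopic puncT (1, 1) loop_a (untwist_map \<circ> (twist_map \<circ> loop_a))"
    by (rule based_homotopic_eqI[OF based_loop_a]) (simp add: untwist_twist[OF loop_in_torus[OF based_loop_a]])
  from based_homotopic_trans[OF this 1]
  show "based_homotopic puncT (1, 1) (untwist_map \<circ> join_loops loop_a loop_b) loop_a"
    by (rule based_homotopic_sym)
  show "untwist_map \<circ> loop_b = loop_b"
    by (auto simp: untwist_map_def loop_b_def half_turn_def)
qed

text \<open>A homeomorphism to the punctured torus that identifies a pair of classes with the two
  standard loops.\<close>

definition marking :: "'a topology \<Rightarrow> 'a \<Rightarrow> ('a \<Rightarrow> complex \<times> complex) \<Rightarrow> (real \<Rightarrow> 'a) set \<Rightarrow> (real \<Rightarrow> 'a) set \<Rightarrow> bool" where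
  "marking X x0 \<omega> \<alpha> \<beta> \<longleftrightarrow> homeomorphic_map X puncT \<omega> \<and> \<omega> x0 = (1, 1) \<and>
     (\<forall>c\<in>\<alpha>. based_homotopic puncT (1, 1) (\<omega> \<circ> c) loop_a) \<and>
     (\<forall>c\<in>\<beta>. based_homotopic puncT (1, 1) (\<omega> \<circ> c) loop_b)"

text \<open>The swap is realised by the exchange of the coordinates, the inversion by a reflection, and
  \<open>(x, y) \<mapsto> (x y, y)\<close> by an inverse Dehn twist, which takes \<open>a b\<close> back to \<open>a\<close> and fixes \<open>b\<close>.\<close>

lemma marking_nielsen:
  assumes "nielsen (fundamental_group X x0) (\<alpha>, \<beta>) p" and x0: "x0 \<in> topspace X"
    and car: "\<alpha> \<in> carrier (fundamental_group X x0)" "\<beta> \<in> carrier (fundamental_group X x0)"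
    and "marking X x0 \<omega> \<alpha> \<beta>"
  shows "\<exists>\<omega>. marking X x0 \<omega> (fst p) (snd p)"
  using assms(1)
proof (induction rule: nielsen.induct)
  case refl then show ?case using assms(5) by auto
next
  case (swap x y)
  then obtain \<omega> where w: "marking X x0 \<omega> x y" by auto
  have cm: "continuous_map puncT puncT swap_map" by (rule homeomorphic_imp_continuous_map[OF homeomorphic_swap])
  have "marking X x0 (swap_map \<circ> \<omega>) y x"
    unfolding marking_def
  proof (intro conjI ballI)
    show "homeomorphic_map X puncT (swap_map \<circ> \<omega>)"
      using w homeomorphic_map_compose[OF _ homeomorphic_swap] unfolding marking_def by blast
    show "(swap_map \<circ> \<omega>) x0 = (1, 1)" using w by (simp add: marking_def swap_map_def)
    show "based_homotopic puncT (1, 1) (swap_map \<circ> \<omega> \<circ> c) loop_a" if "c \<in> y" for c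
      using based_homotopic_map[OF cm, of "(1, 1)" "\<omega> \<circ> c" loop_b "(1, 1)"] w that
      by (simp add: marking_def swap_loops o_assoc) (simp add: swap_map_def)
    show "based_homotopic puncT (1, 1) (swap_map \<circ> \<omega> \<circ> c) loop_b" if "c \<in> x" for c
      using based_homotopic_map[OF cm, of "(1, 1)" "\<omega> \<circ> c" loop_a "(1, 1)"] w that
      by (simp add: marking_def swap_loops o_assoc) (simp add: swap_map_def)
  qed
  then show ?case by auto
next
  case (inv x y)
  interpret group "fundamental_group X x0" by (rule fundamental_group_is_group[OF x0])
  obtain \<omega> where w: "marking X x0 \<omega> x y" using inv by auto
  have "x \<in> carrier (fundamental_group X x0)"
    using nielsen_carrier[OF inv.hyps car] by simp
  then obtain c where c: "x = loop_class X x0 c" "based_loop X x0 c"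
    unfolding fundamental_group_carrier by blast
  have wc: "continuous_map X puncT \<omega>" "\<omega> x0 = (1, 1)"
    using w homeomorphic_imp_continuous_map by (auto simp: marking_def)
  have cm: "continuous_map puncT puncT flip_map" by (rule homeomorphic_imp_continuous_map[OF homeomorphic_flip])
  have f1: "flip_map (1, 1) = (1, 1)" by (simp add: flip_map_def)
  have "marking X x0 (flip_map \<circ> \<omega>) (inv\<^bsub>fundamental_group X x0\<^esub> x) y"
    unfolding marking_def
  proof (intro conjI ballI)
    show "homeomorphic_map X puncT (flip_map \<circ> \<omega>)"
      using w homeomorphic_map_compose[OF _ homeomorphic_flip] unfolding marking_def by blast
    show "(flip_map \<circ> \<omega>) x0 = (1, 1)" using w by (simp add: marking_def flip_map_def)
    show "based_homotopic puncT (1, 1) (flip_map \<circ> \<omega> \<circ> d) loop_a" if "d \<in> inv\<^bsub>fundamental_group X x0\<^esub> x" for d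
    proof -
      have "based_homotopic X x0 (rev_loop c) d"
        using that unfolding c(1) fundamental_group_inv[OF c(2)] by (simp add: loop_class_def)
      from based_homotopic_map[OF wc(1) based_homotopic_sym[OF this] wc(2)]
      have 1: "based_homotopic puncT (1, 1) (\<omega> \<circ> d) (\<omega> \<circ> rev_loop c)" .
      have "based_homotopic puncT (1, 1) (\<omega> \<circ> c) loop_a"
        using w loop_class_self[OF c(2)] c(1) by (auto simp: marking_def)
      from based_homotopic_rev[OF this]
      have "based_homotopic puncT (1, 1) (\<omega> \<circ> rev_loop c) (rev_loop loop_a)"
        by (simp add: rev_loop_def o_assoc)
      from based_homotopic_map[OF cm based_homotopic_trans[OF 1 this] f1]
      show ?thesis by (simp add: flip_loops o_assoc)
    qed
    show "based_homotopic puncT (1, 1) (flip_map \<circ> \<omega> \<circ> d) loop_b" if "d \<in> y" for d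
      using based_homotopic_map[OF cm, of "(1, 1)" "\<omega> \<circ> d" loop_b "(1, 1)"] w that f1
      by (simp add: marking_def flip_loops o_assoc)
  qed
  then show ?case by auto
next
  case (mult x y)
  interpret group "fundamental_group X x0" by (rule fundamental_group_is_group[OF x0])
  obtain \<omega> where w: "marking X x0 \<omega> x y" using mult by auto
  have "x \<in> carrier (fundamental_group X x0)" "y \<in> carrier (fundamental_group X x0)"
    using nielsen_carrier[OF mult.hyps car] by auto
  then obtain c e where c: "x = loop_class X x0 c" "based_loop X x0 c"
    and e: "y = loop_class X x0 e" "based_loop X x0 e"
    unfolding fundamental_group_carrier by blast
  have wc: "continuous_map X puncT \<omega>" "\<omega> x0 = (1, 1)"
    using w homeomorphic_imp_continuous_map by (auto simp: marking_def)
  have f1: "untwist_map (1, 1) = (1, 1)" by (simp add: untwist_map_def half_turn_def)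
  have "marking X x0 (untwist_map \<circ> \<omega>) (x \<otimes>\<^bsub>fundamental_group X x0\<^esub> y) y"
    unfolding marking_def
  proof (intro conjI ballI)
    show "homeomorphic_map X puncT (untwist_map \<circ> \<omega>)"
      using w homeomorphic_map_compose[OF _ homeomorphic_untwist] unfolding marking_def by blast
    show "(untwist_map \<circ> \<omega>) x0 = (1, 1)" using w f1 by (simp add: marking_def)
    show "based_homotopic puncT (1, 1) (untwist_map \<circ> \<omega> \<circ> d) loop_a" if "d \<in> x \<otimes>\<^bsub>fundamental_group X x0\<^esub> y" for d
    proof -
      have "based_homotopic X x0 (join_loops c e) d"
        using that unfolding c(1) e(1) fundamental_group_mult[OF c(2) e(2)] by (simp add: loop_class_def)
      from based_homotopic_map[OF wc(1) based_homotopic_sym[OF this] wc(2)]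
      have 1: "based_homotopic puncT (1, 1) (\<omega> \<circ> d) (join_loops (\<omega> \<circ> c) (\<omega> \<circ> e))"
        by (simp only: map_join_loops)
      have "based_homotopic puncT (1, 1) (\<omega> \<circ> c) loop_a" "based_homotopic puncT (1, 1) (\<omega> \<circ> e) loop_b"
        using w loop_class_self[OF c(2)] c(1) loop_class_self[OF e(2)] e(1) by (auto simp: marking_def)
      from based_homotopic_map[OF continuous_map_untwist based_homotopic_trans[OF 1 based_homotopic_join[OF this]] f1]
      have "based_homotopic puncT (1, 1) (untwist_map \<circ> (\<omega> \<circ> d)) (untwist_map \<circ> join_loops loop_a loop_b)" .
      from based_homotopic_trans[OF this untwist_loops(1)] show ?thesis by (simp add: o_assoc)
    qed
    show "based_homotopic puncT (1, 1) (untwist_map \<circ> \<omega> \<circ> d) loop_b" if "d \<in> y" for d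
      using based_homotopic_map[OF continuous_map_untwist, of "(1, 1)" "\<omega> \<circ> d" loop_b "(1, 1)"] w that f1
      by (simp add: marking_def untwist_loops o_assoc)
  qed
  then show ?case by auto
qed

subsection \<open>Generators of the fundamental group of the punctured torus\<close>

abbreviation torus_gens :: "(real \<Rightarrow> complex \<times> complex) set set" where
  "torus_gens \<equiv> generate (fundamental_group puncT (1, 1))
     {loop_class puncT (1, 1) loop_a, loop_class puncT (1, 1) loop_b}"

lemma punctured_11: "(1, 1) \<in> punctured_torus"
  by (simp add: punctured_torus_def torus_set_def)

lemma group_puncT: "group (fundamental_group puncT (1, 1))"
  by (rule fundamental_group_is_group) (simp add: punctured_11)

lemma loop_b_power: "loop_class puncT (1, 1) (torus_point \<circ> (\<lambda>t. Complex 0 (of_int n * t))) \<in> torus_gens"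
proof -
  interpret group "fundamental_group puncT (1, 1)" by (rule group_puncT)
  define bn where "bn n = torus_point \<circ> (\<lambda>t. Complex 0 (of_int n * t))" for n
  have in_p: "torus_point (Complex 0 y) \<in> punctured_torus" for y
    by (simp add: torus_point_in_punctured not_half_Int)
  have bn: "based_loop puncT (1, 1) (bn n)" for n
    unfolding bn_def
  proof (rule based_loop_lift)
    show "continuous_on {0..1} (\<lambda>t. Complex 0 (of_int n * t))"
      unfolding Complex_eq by (intro continuous_intros)
  qed (use in_p torus_point_int[of 0 0] torus_point_int[of 0 n] in simp_all)
  have step: "based_homotopic puncT (1, 1) (join_loops (bn n) loop_b) (bn (n + 1))" for n
  proof -
    define p where "p t = Complex 0 (of_int n * min 1 (2 * t) + max 0 (2 * t - 1))" for t :: real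
    define q where "q t = Complex 0 (of_int (n + 1) * t)" for t :: real
    have "based_homotopic puncT (1, 1) (torus_point \<circ> p) (torus_point \<circ> q)"
    proof (rule based_homotopic_lift)
      show "continuous_on {0..1} p" "continuous_on {0..1} q"
        unfolding p_def q_def Complex_eq by (intro continuous_intros)+
      show "torus_point (p 0) = (1, 1)" "torus_point (p 1) = (1, 1)" "p 0 = q 0" "p 1 = q 1"
        using torus_point_int[of 0 0] torus_point_int[of 0 "n + 1"] by (simp_all add: p_def q_def)
      fix u t :: real
      have "(1 - u) *\<^sub>R p t + u *\<^sub>R q t = Complex 0 (Im ((1 - u) *\<^sub>R p t + u *\<^sub>R q t))"
        by (simp add: p_def q_def complex_eq_iff)
      then show "torus_point ((1 - u) *\<^sub>R p t + u *\<^sub>R q t) \<in> punctured_torus"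
        using in_p by metis
    qed
    moreover have "join_loops (bn n) loop_b t = (torus_point \<circ> p) t" for t
    proof (cases "t \<le> 1/2")
      case True
      then have "min 1 (2 * t) = 2 * t" "max 0 (2 * t - 1) = 0" by auto
      then show ?thesis using True by (simp add: join_loops_def bn_def p_def)
    next
      case False
      have "cis (2 * pi * (of_int n + (2 * t - 1))) = cis (2 * pi * (2 * t - 1))"
        by (subst cis_2pi_eq_iff) simp
      moreover have "min 1 (2 * t) = 1" "max 0 (2 * t - 1) = 2 * t - 1" using False by auto
      ultimately show ?thesis using False
        by (simp add: join_loops_def loop_b_def p_def torus_point_def)
    qed
    then have "join_loops (bn n) loop_b = torus_point \<circ> p" by blast
    ultimately show ?thesis by (simp add: bn_def q_def[abs_def])
  qed
  have mult: "loop_class puncT (1, 1) (bn n) \<otimes>\<^bsub>fundamental_group puncT (1, 1)\<^esub> loop_class puncT (1, 1) loop_b =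
      loop_class puncT (1, 1) (bn (n + 1))" for n
    using fundamental_group_mult[OF bn based_loop_b] loop_class_eqI[OF step] by simp
  have car: "loop_class puncT (1, 1) (bn n) \<in> carrier (fundamental_group puncT (1, 1))"
    "loop_class puncT (1, 1) loop_b \<in> carrier (fundamental_group puncT (1, 1))" for n
    using bn based_loop_b unfolding fundamental_group_carrier by blast+
  have "loop_class puncT (1, 1) (bn n) \<in> torus_gens"
  proof (induction n rule: int_induct[where k = 0])
    case base
    have "bn 0 = (\<lambda>_. (1, 1))" using torus_point_int[of 0 0] by (auto simp: bn_def)
    then show ?case using generate.one fundamental_group_one by metis
  next
    case (step1 i)
    have "loop_class puncT (1, 1) loop_b \<in> torus_gens" by (rule generate.incl) simp
    from generate.eng[OF step1(2) this] show ?case unfolding mult .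
  next
    case (step2 i)
    have "loop_class puncT (1, 1) (bn (i - 1)) =
      loop_class puncT (1, 1) (bn i) \<otimes>\<^bsub>fundamental_group puncT (1, 1)\<^esub> inv\<^bsub>fundamental_group puncT (1, 1)\<^esub> loop_class puncT (1, 1) loop_b"
      using mult[of "i - 1"] car by (metis inv_solve_right' diff_add_cancel)
    moreover have "inv\<^bsub>fundamental_group puncT (1, 1)\<^esub> loop_class puncT (1, 1) loop_b \<in> torus_gens"
      by (rule generate.inv) simp
    ultimately show ?case using generate.eng[OF step2(2)] by simp
  qed
  then show ?thesis by (simp add: bn_def)
qed

text \<open>The punctured torus without the circle \<open>fst x = -1\<close> is an annulus with core \<open>b\<close>. The first
  coordinate has a continuous argument between \<open>-\<pi>\<close> and \<open>\<pi>\<close>, which is contracted to zero while a lift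
  of the second coordinate is straightened.\<close>

lemma generated_fst:
  assumes c: "based_loop puncT (1, 1) c" and ne: "\<And>t. t \<in> {0..1} \<Longrightarrow> fst (c t) \<noteq> -1"
  shows "loop_class puncT (1, 1) c \<in> torus_gens"
proof -
  have cc: "continuous_on {0..1} c" and ct: "\<And>t. t \<in> {0..1} \<Longrightarrow> c t \<in> torus_set"
    using c loop_in_torus by (auto simp: based_loop_def pathin_def continuous_map_in_subtopology)
  have nf: "norm (fst (c t)) = 1" "norm (snd (c t)) = 1" if "t \<in> {0..1}" for t
    using ct[OF that] by (auto simp: torus_set_def)
  have slit: "fst (c t) \<notin> \<real>\<^sub>\<le>\<^sub>0" if "t \<in> {0..1}" for t
  proof
    assume "fst (c t) \<in> \<real>\<^sub>\<le>\<^sub>0"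
    then obtain r where r: "r \<le> 0" "fst (c t) = of_real r" by (auto elim: nonpos_Reals_cases)
    then have "r = -1" using nf(1)[OF that] by simp
    then show False using r ne[OF that] by simp
  qed
  define s where "s t = Arg (fst (c t)) / (2 * pi)" for t
  have cs: "continuous_on {0..1} s"
    unfolding s_def using slit by (intro continuous_intros cc) auto
  have s_small: "\<bar>s t\<bar> < 1/2" if "t \<in> {0..1}" for t
  proof -
    have "Arg (fst (c t)) \<noteq> pi" using slit[OF that] by (auto simp: Arg_eq_pi_iff complex_nonpos_Reals_iff complex_is_Real_iff)
    then have "\<bar>Arg (fst (c t))\<bar> < pi" using Arg_bounded[of "fst (c t)"] by auto
    then show ?thesis by (simp add: s_def field_simps abs_if split: if_splits)
  qed
  have s_cis: "cis (2 * pi * s t) = fst (c t)" if "t \<in> {0..1}" for t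
    using nf(1)[OF that] cis_Arg[of "fst (c t)"] by (cases "fst (c t) = 0") (simp_all add: s_def sgn_eq)
  have "contractible {0..1::real}" by (intro convex_imp_contractible) simp
  then obtain g where g: "continuous_on {0..1} g" "\<And>t. t \<in> {0..1} \<Longrightarrow> snd (c t) = exp (g t)"
    using continuous_logarithm_on_contractible[of "{0..1::real}" "\<lambda>t. snd (c t)"] nf(2) cc
    by (metis continuous_on_snd norm_zero zero_neq_one)
  have g_cis: "cis (Im (g t)) = snd (c t)" if "t \<in> {0..1}" for t
  proof -
    have "Re (g t) = 0" using nf(2)[OF that] g(2)[OF that] by (simp add: norm_exp_eq_Re)
    then show ?thesis using g(2)[OF that] by (simp add: exp_eq_polar)
  qed
  define \<tau> where "\<tau> t = Im (g t) / (2 * pi) - Im (g 0) / (2 * pi)" for t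
  have c01: "c 0 = (1, 1)" "c 1 = (1, 1)" using c by (auto simp: based_loop_def)
  have "cis (2 * pi * (Im (g 0) / (2 * pi))) = cis (2 * pi * 0)"
    using g_cis[of 0] c01 by simp
  then have m0: "Im (g 0) / (2 * pi) \<in> \<int>" unfolding cis_2pi_eq_iff by simp
  have \<tau>_cis: "cis (2 * pi * \<tau> t) = snd (c t)" if "t \<in> {0..1}" for t
  proof -
    have "cis (2 * pi * \<tau> t) = cis (2 * pi * (Im (g t) / (2 * pi)))"
      unfolding cis_2pi_eq_iff using m0 by (simp add: \<tau>_def)
    then show ?thesis using g_cis[OF that] by simp
  qed
  have "cis (2 * pi * \<tau> 1) = cis (2 * pi * 0)" using \<tau>_cis[of 1] c01 by simp
  then obtain n where n: "\<tau> 1 = of_int n" unfolding cis_2pi_eq_iff by (auto elim: Ints_cases)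
  define p where "p t = Complex (s t) (\<tau> t)" for t
  define q where "q t = Complex 0 (of_int n * t)" for t :: real
  have s01: "s 0 = 0" "s 1 = 0" by (simp_all add: s_def c01)
  have "based_homotopic puncT (1, 1) (torus_point \<circ> p) (torus_point \<circ> q)"
  proof (rule based_homotopic_lift)
    have "continuous_on {0..1} \<tau>"
      unfolding \<tau>_def using g(1) by (intro continuous_intros) auto
    then show "continuous_on {0..1} p"
      unfolding p_def Complex_eq by (intro continuous_intros cs)
    show "continuous_on {0..1} q"
      unfolding q_def Complex_eq by (intro continuous_intros)
    show "p 0 = q 0" "p 1 = q 1" by (simp_all add: p_def q_def s01 n) (simp add: \<tau>_def)
    then show "torus_point (p 0) = (1, 1)" "torus_point (p 1) = (1, 1)"
      using torus_point_int[of 0 0] torus_point_int[of 0 n] by (simp_all add: q_def)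
    fix u t :: real assume ut: "u \<in> {0..1}" "t \<in> {0..1}"
    have "\<bar>(1 - u) * s t\<bar> \<le> 1 * \<bar>s t\<bar>"
      unfolding abs_mult using ut by (intro mult_right_mono) auto
    then have "\<bar>(1 - u) * s t\<bar> < 1/2" using s_small[OF ut(2)] by simp
    moreover have "(1 - u) *\<^sub>R p t + u *\<^sub>R q t = Complex ((1 - u) * s t) (Im ((1 - u) *\<^sub>R p t + u *\<^sub>R q t))"
      by (simp add: p_def q_def complex_eq_iff)
    ultimately show "torus_point ((1 - u) *\<^sub>R p t + u *\<^sub>R q t) \<in> punctured_torus"
      using torus_point_in_punctured not_half_Int by metis
  qed
  moreover have "based_homotopic puncT (1, 1) c (torus_point \<circ> p)"
    by (rule based_homotopic_eqI[OF c]) (simp add: torus_point_def p_def s_cis \<tau>_cis)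
  ultimately have "based_homotopic puncT (1, 1) c (torus_point \<circ> q)"
    by (metis based_homotopic_trans)
  from loop_class_eqI[OF this] show ?thesis using loop_b_power[of n] by (simp add: q_def[abs_def])
qed

lemma generated_snd:
  assumes c: "based_loop puncT (1, 1) c" and ne: "\<And>t. t \<in> {0..1} \<Longrightarrow> snd (c t) \<noteq> -1"
  shows "loop_class puncT (1, 1) c \<in> torus_gens"
proof -
  have cm: "continuous_map puncT puncT swap_map" by (rule homeomorphic_imp_continuous_map[OF homeomorphic_swap])
  have s1: "swap_map (1, 1) = (1, 1)" by (simp add: swap_map_def)
  have l: "based_loop puncT (1, 1) (swap_map \<circ> c)" by (rule based_loop_map[OF cm c s1])
  have "loop_class puncT (1, 1) (swap_map \<circ> c) \<in> torus_gens"
    by (rule generated_fst[OF l]) (use ne in \<open>simp add: swap_map_def\<close>)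
  from fundamental_group_generate_map[OF cm s1 based_loop_a based_loop_b this loop_class_self[OF l]]
  have "loop_class puncT (1, 1) (swap_map \<circ> (swap_map \<circ> c)) \<in>
      generate (fundamental_group puncT (1, 1)) {loop_class puncT (1, 1) loop_b, loop_class puncT (1, 1) loop_a}"
    by (simp only: swap_loops)
  moreover have "swap_map \<circ> (swap_map \<circ> c) = c" by (auto simp: swap_map_def)
  ultimately show ?thesis by (simp only: insert_commute)
qed

lemma based_loop_iff_path:
  "based_loop (top_of_set S) x c \<longleftrightarrow> path c \<and> path_image c \<subseteq> S \<and> pathstart c = x \<and> pathfinish c = x"
  unfolding based_loop_def pathin_def path_def path_image_def pathstart_def pathfinish_def
  by (auto simp: continuous_map_in_subtopology Pi_iff image_subset_iff)

lemma based_homotopic_of_paths: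
  assumes "homotopic_paths S c d" "pathstart c = x" "pathfinish c = x"
  shows "based_homotopic (top_of_set S) x c d"
  using assms unfolding homotopic_paths_def based_homotopic_def pathstart_def pathfinish_def by simp

lemma join_loops_eq_joinpaths: "join_loops = (+++)"
  by (intro ext) (simp add: join_loops_def joinpaths_def)

text \<open>A path from the base point to \<open>x\<close>. It stays in each of the two annuli \<open>fst y \<noteq> -1\<close> and
  \<open>snd y \<noteq> -1\<close> that contains \<open>x\<close>, so that it can close up short pieces of a loop.\<close>

definition spoke :: "complex \<times> complex \<Rightarrow> real \<Rightarrow> complex \<times> complex" where
  "spoke x t = (cis (t * Arg (fst x)), cis (t * Arg (snd x)))"

lemma cis_scaled_Arg:
  assumes z: "norm z = 1" "z \<noteq> -1" and t: "t \<in> {0..1}"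
  shows "cis (t * Arg z) \<noteq> -1"
proof -
  have "Arg z \<noteq> pi" using z by (metis Arg_eq_pi norm_eq_1 cis_Arg cis_pi norm_zero sgn_eq zero_neq_one div_by_1 of_real_1)
  then have a: "\<bar>Arg z\<bar> < pi" using Arg_bounded[of z] by auto
  have "\<bar>t * Arg z\<bar> \<le> 1 * \<bar>Arg z\<bar>" unfolding abs_mult using t by (intro mult_right_mono) auto
  then have "\<bar>t * Arg z / (2 * pi)\<bar> < 1/2" using a by (simp add: field_simps)
  from cis_2pi_ne_minus_1[OF this] show ?thesis by simp
qed

lemma spoke:
  assumes "x \<in> punctured_torus"
  shows "path (spoke x)" "pathstart (spoke x) = (1, 1)" "pathfinish (spoke x) = x"
    and "fst x \<noteq> -1 \<Longrightarrow> y \<in> path_image (spoke x) \<Longrightarrow> fst y \<noteq> -1"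
    and "snd x \<noteq> -1 \<Longrightarrow> y \<in> path_image (spoke x) \<Longrightarrow> snd y \<noteq> -1"
    and "path_image (spoke x) \<subseteq> punctured_torus"
proof -
  have n: "norm (fst x) = 1" "norm (snd x) = 1" using assms by (auto simp: punctured_torus_def torus_set_def)
  show "path (spoke x)"
    unfolding path_def spoke_def[abs_def] cis_conv_exp by (intro continuous_intros)
  show "pathstart (spoke x) = (1, 1)" by (simp add: pathstart_def spoke_def)
  have "cis (Arg z) = z" if "norm z = 1" for z :: complex
    using that cis_Arg[of z] by (cases "z = 0") (simp_all add: sgn_eq)
  then show "pathfinish (spoke x) = x"
    using n by (simp add: pathfinish_def spoke_def)
  show A: "fst x \<noteq> -1 \<Longrightarrow> y \<in> path_image (spoke x) \<Longrightarrow> fst y \<noteq> -1" for y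
    using cis_scaled_Arg[OF n(1)] by (auto simp: path_image_def spoke_def)
  show B: "snd x \<noteq> -1 \<Longrightarrow> y \<in> path_image (spoke x) \<Longrightarrow> snd y \<noteq> -1" for y
    using cis_scaled_Arg[OF n(2)] by (auto simp: path_image_def spoke_def)
  show "path_image (spoke x) \<subseteq> punctured_torus"
  proof
    fix y assume y: "y \<in> path_image (spoke x)"
    have "fst x \<noteq> -1 \<or> snd x \<noteq> -1" using assms by (auto simp: punctured_torus_def prod_eq_iff)
    then have "y \<noteq> (-1, -1)" using A[OF _ y] B[OF _ y] by auto
    moreover have "y \<in> torus_set" using y by (auto simp: path_image_def spoke_def torus_set_def)
    ultimately show "y \<in> punctured_torus" by (simp add: punctured_torus_def)
  qed
qed

text \<open>The punctured torus is the union of the annuli \<open>fst x \<noteq> -1\<close> and \<open>snd x \<noteq> -1\<close>, and this is the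
  easy half of van Kampen's theorem: a loop is a product of short pieces, each closed up by spokes
  inside one of the annuli. The subdivision is replaced by a Bolzano argument on the parameter.\<close>

lemma puncT_generated:
  assumes c: "based_loop puncT (1, 1) c"
  shows "loop_class puncT (1, 1) c \<in> torus_gens"
proof -
  interpret group "fundamental_group puncT (1, 1)" by (rule group_puncT)
  let ?S = punctured_torus
  have c': "path c" "path_image c \<subseteq> ?S" "pathstart c = (1, 1)" "pathfinish c = (1, 1)"
    using c by (auto simp: based_loop_iff_path)
  have cS: "c t \<in> ?S" if "t \<in> {0..1}" for t using c'(2) that by (auto simp: path_image_def)
  \<comment> \<open>the initial part of the loop up to time \<open>t\<close>, and the piece between \<open>s\<close> and \<open>t\<close>, closed up by spokes\<close>
  define K where "K t = subpath 0 t c +++ reversepath (spoke (c t))" for t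
  define L where "L s t = spoke (c s) +++ (subpath s t c +++ reversepath (spoke (c t)))" for s t
  have sub: "path (subpath s t c)" "path_image (subpath s t c) \<subseteq> ?S" "pathstart (subpath s t c) = c s" "pathfinish (subpath s t c) = c t"
    if "s \<in> {0..1}" "t \<in> {0..1}" for s t
    using that c' path_image_subpath_subset[OF that] by (auto simp: path_subpath)
  have sp: "path (spoke (c t))" "pathstart (spoke (c t)) = (1, 1)" "pathfinish (spoke (c t)) = c t"
    "path_image (spoke (c t)) \<subseteq> ?S" if "t \<in> {0..1}" for t
    using spoke[OF cS[OF that]] by auto
  have Kl: "based_loop puncT (1, 1) (K t)" if "t \<in> {0..1}" for t
    using sub[of 0 t] sp[of t] that c'(3)[unfolded pathstart_def]
    by (auto simp: based_loop_iff_path K_def path_image_join)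
  have Ll: "based_loop puncT (1, 1) (L s t)" if "s \<in> {0..1}" "t \<in> {0..1}" for s t
    using sub[OF that] sp[OF that(1)] sp[OF that(2)]
    by (auto simp: based_loop_iff_path L_def path_image_join)
  have KL: "based_homotopic puncT (1, 1) (join_loops (K s) (L s t)) (K t)" if st: "s \<in> {0..1}" "t \<in> {0..1}" for s t
  proof -
    have z: "(0::real) \<in> {0..1}" by simp
    note s0 = sub[OF z st(1)] and s1 = sub[OF st] and ss = sp[OF st(1)] and tt = sp[OF st(2)]
    let ?A = "subpath 0 s c" and ?B = "subpath s t c" and ?g = "spoke (c s)" and ?h = "spoke (c t)"
    have lid: "homotopic_paths ?S (linepath (c s) (c s) +++ (?B +++ reversepath ?h)) (?B +++ reversepath ?h)"
      using s0 s1 ss tt homotopic_paths_lid[of "?B +++ reversepath ?h" ?S] by (auto simp: path_image_join)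
    have "homotopic_paths ?S ((?A +++ reversepath ?g) +++ (?g +++ (?B +++ reversepath ?h)))
        (?A +++ (reversepath ?g +++ (?g +++ (?B +++ reversepath ?h))))"
      using s0 s1 ss tt by (intro homotopic_paths_sym[OF homotopic_paths_assoc]) (auto simp: path_image_join)
    also have "homotopic_paths ?S \<dots> (?A +++ ((reversepath ?g +++ ?g) +++ (?B +++ reversepath ?h)))"
      using s0 s1 ss tt by (intro homotopic_paths_join homotopic_paths_assoc) (auto simp: path_image_join)
    also have "homotopic_paths ?S \<dots> (?A +++ (linepath (c s) (c s) +++ (?B +++ reversepath ?h)))"
      using s0 s1 ss tt homotopic_paths_linv[of ?g ?S]
      by (intro homotopic_paths_join) (auto simp: path_image_join)
    also have "homotopic_paths ?S \<dots> (?A +++ (?B +++ reversepath ?h))"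
      by (rule homotopic_paths_join[OF _ lid]) (use s0 s1 ss tt in auto)
    also have "homotopic_paths ?S \<dots> ((?A +++ ?B) +++ reversepath ?h)"
      using s0 s1 ss tt by (intro homotopic_paths_assoc) (auto simp: path_image_join)
    also have "homotopic_paths ?S \<dots> (subpath 0 t c +++ reversepath ?h)"
      using s0 s1 ss tt homotopic_join_subpaths[OF c'(1,2), of 0 s t] st
      by (intro homotopic_paths_join) auto
    finally have "homotopic_paths ?S (K s +++ L s t) (K t)" by (simp add: K_def L_def)
    then show ?thesis
      unfolding join_loops_eq_joinpaths
      using Kl[OF st(1)] Ll[OF st] by (intro based_homotopic_of_paths) (auto simp: based_loop_iff_path)
  qed
  have img: "y \<in> path_image (L s t) \<Longrightarrow> y \<in> path_image (spoke (c s)) \<or> y \<in> path_image (spoke (c t)) \<or> (\<exists>r\<in>{s..t}. y = c r)"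
    if "s \<in> {0..1}" "t \<in> {0..1}" "s \<le> t" for s t y
    using sub[OF that(1,2)] sp[OF that(1)] sp[OF that(2)] that
    by (auto simp: L_def path_image_join path_image_subpath)
  define P where "P s t \<longleftrightarrow> (0 \<le> s \<and> s \<le> t \<and> t \<le> 1 \<and> loop_class puncT (1, 1) (K s) \<in> torus_gens
     \<longrightarrow> loop_class puncT (1, 1) (K t) \<in> torus_gens)" for s t
  have "P 0 1"
  proof (rule Bolzano)
    show "P a d" if "P a b" "P b d" "a \<le> b" "b \<le> d" for a b d
      using that unfolding P_def by auto
    fix x :: real assume x: "0 \<le> x" "x \<le> 1"
    have "continuous_on {0..1} c" using c'(1) by (simp add: path_def)
    have near: "\<exists>d>0. \<forall>r\<in>{0..1}. dist r x < d \<longrightarrow> f (c r) \<noteq> -1"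
      if "continuous_on UNIV f" "f (c x) \<noteq> -1" for f :: "complex \<times> complex \<Rightarrow> complex"
    proof -
      have "continuous_on {0..1} (\<lambda>r. f (c r))"
        by (rule continuous_on_compose2[OF that(1) \<open>continuous_on {0..1} c\<close>]) simp
      from continuous_on_avoid[OF this, of x "-1"] that(2) x show ?thesis
        by (auto simp: dist_commute)
    qed
    have step: "\<exists>d>0. \<forall>a b. a \<le> x \<and> x \<le> b \<and> b - a < d \<longrightarrow> P a b"
      if f: "f = fst \<or> f = snd" "f (c x) \<noteq> -1" for f
    proof -
      have "continuous_on UNIV f" using f(1) by (auto intro!: continuous_intros)
      from near[OF this f(2)] obtain d where d: "d > 0" "\<And>r. r \<in> {0..1} \<Longrightarrow> dist r x < d \<Longrightarrow> f (c r) \<noteq> -1" by blast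
      have "P a b" if ab: "a \<le> x" "x \<le> b" "b - a < d" for a b
        unfolding P_def
      proof (intro impI, elim conjE)
        assume a: "0 \<le> a" "a \<le> b" "b \<le> 1" and Ka: "loop_class puncT (1, 1) (K a) \<in> torus_gens"
        have m: "a \<in> {0..1}" "b \<in> {0..1}" using a by auto
        have ne: "f (c r) \<noteq> -1" if "r \<in> {a..b}" for r
          using that a ab by (intro d(2)) (auto simp: dist_real_def)
        have "f y \<noteq> -1" if "y \<in> path_image (L a b)" for y
          using img[OF m a(2) that] spoke(4,5)[OF cS[OF m(1)], of y] spoke(4,5)[OF cS[OF m(2)], of y] ne[of a] ne[of b] ne f(1) a(2)
          by auto
        then have "f (L a b t) \<noteq> -1" if "t \<in> {0..1}" for t using that by (auto simp: path_image_def)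
        then have "loop_class puncT (1, 1) (L a b) \<in> torus_gens"
          using f(1) generated_fst[OF Ll[OF m]] generated_snd[OF Ll[OF m]] by blast
        from generate.eng[OF Ka this] show "loop_class puncT (1, 1) (K b) \<in> torus_gens"
          unfolding fundamental_group_mult[OF Kl[OF m(1)] Ll[OF m]] loop_class_eqI[OF KL[OF m]] .
      qed
      then show ?thesis using d(1) by blast
    qed
    have "fst (c x) \<noteq> -1 \<or> snd (c x) \<noteq> -1"
      using cS[of x] x by (auto simp: punctured_torus_def prod_eq_iff)
    then show "\<exists>d>0. \<forall>a b. a \<le> x \<and> x \<le> b \<and> b - a < d \<longrightarrow> P a b"
      using step[of fst] step[of snd] by blast
  qed simp
  have sp1: "reversepath (spoke (1, 1)) = linepath (1, 1) (1, 1)"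
    by (intro ext) (simp add: reversepath_def spoke_def linepath_def algebra_simps flip: scaleR_left.add)
  have c01: "c 0 = (1, 1)" "c 1 = (1, 1)" using c by (auto simp: based_loop_def)
  have "fst (K 0 t) \<noteq> -1" for t
    using sp1 c01 by (simp add: K_def joinpaths_def subpath_def linepath_def flip: scaleR_left.add)
  then have "loop_class puncT (1, 1) (K 0) \<in> torus_gens" by (intro generated_fst Kl) auto
  then have K1: "loop_class puncT (1, 1) (K 1) \<in> torus_gens" using \<open>P 0 1\<close> by (simp add: P_def)
  have "homotopic_paths ?S (c +++ linepath (1, 1) (1, 1)) c"
    using homotopic_paths_rid[OF c'(1,2)] c'(4) by simp
  then have "homotopic_paths ?S (K 1) c" by (simp add: K_def c01 sp1)
  then have "based_homotopic puncT (1, 1) (K 1) c"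
    using Kl[of 1] by (intro based_homotopic_of_paths) (auto simp: based_loop_iff_path)
  from loop_class_eqI[OF this] K1 show ?thesis by simp
qed

lemma initial_marking:
  assumes X: "torus_with_hole X" and x0: "x0 \<in> topspace X"
  obtains u v \<omega> where "u \<in> carrier (fundamental_group X x0)" "v \<in> carrier (fundamental_group X x0)"
    "generate (fundamental_group X x0) {u, v} = carrier (fundamental_group X x0)" "marking X x0 \<omega> u v"
proof -
  interpret group "fundamental_group X x0" by (rule fundamental_group_is_group[OF x0])
  obtain \<omega> where w: "homeomorphic_map X puncT \<omega>" "\<omega> x0 = (1, 1)"
    using torus_with_hole_homeomorphic[OF X x0] by blast
  then obtain k where k: "homeomorphic_maps X puncT \<omega> k" unfolding homeomorphic_map_maps by blast
  have cont: "continuous_map X puncT \<omega>" "continuous_map puncT X k"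
    and inv: "\<And>x. x \<in> topspace X \<Longrightarrow> k (\<omega> x) = x" "\<And>y. y \<in> punctured_torus \<Longrightarrow> \<omega> (k y) = y"
    using k by (auto simp: homeomorphic_maps_def)
  have k1: "k (1, 1) = x0" using inv(1)[OF x0] w(2) by simp
  define u where "u = loop_class X x0 (k \<circ> loop_a)"
  define v where "v = loop_class X x0 (k \<circ> loop_b)"
  have l: "based_loop X x0 (k \<circ> loop_a)" "based_loop X x0 (k \<circ> loop_b)"
    using based_loop_map[OF cont(2) based_loop_a k1] based_loop_map[OF cont(2) based_loop_b k1] by auto
  have car: "u \<in> carrier (fundamental_group X x0)" "v \<in> carrier (fundamental_group X x0)"
    using l unfolding u_def v_def fundamental_group_carrier by blast+
  have lp: "c t \<in> punctured_torus" if "based_loop puncT (1, 1) c" "t \<in> {0..1}" for c t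
    using that by (auto simp: based_loop_iff_path path_image_def)
  have lx: "c t \<in> topspace X" if "based_loop X x0 c" "t \<in> {0..1}" for c t
    using that continuous_map_image_subset_topspace[of "top_of_set {0..1}" X c]
    by (auto simp: based_loop_def pathin_def)
  have mark: "based_homotopic puncT (1, 1) (\<omega> \<circ> d) c"
    if c: "based_loop puncT (1, 1) c" and d: "d \<in> loop_class X x0 (k \<circ> c)" for c d
  proof -
    have "based_homotopic puncT (1, 1) (\<omega> \<circ> d) (\<omega> \<circ> (k \<circ> c))"
      using d based_homotopic_sym[OF based_homotopic_map[OF cont(1) _ w(2), of "k \<circ> c" d]]
      by (simp add: loop_class_def)
    moreover have "based_homotopic puncT (1, 1) c (\<omega> \<circ> (k \<circ> c))"
      by (rule based_homotopic_eqI[OF c]) (simp add: inv(2) lp[OF c])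
    ultimately show ?thesis using based_homotopic_sym based_homotopic_trans by metis
  qed
  have "carrier (fundamental_group X x0) \<subseteq> generate (fundamental_group X x0) {u, v}"
  proof
    fix \<alpha> assume "\<alpha> \<in> carrier (fundamental_group X x0)"
    then obtain c where c: "\<alpha> = loop_class X x0 c" "based_loop X x0 c"
      unfolding fundamental_group_carrier by blast
    have wc: "based_loop puncT (1, 1) (\<omega> \<circ> c)" by (rule based_loop_map[OF cont(1) c(2) w(2)])
    from fundamental_group_generate_map[OF cont(2) k1 based_loop_a based_loop_b puncT_generated[OF wc] loop_class_self[OF wc]]
    have "loop_class X x0 (k \<circ> (\<omega> \<circ> c)) \<in> generate (fundamental_group X x0) {u, v}"
      by (simp only: u_def v_def)
    moreover have "loop_class X x0 c = loop_class X x0 (k \<circ> (\<omega> \<circ> c))"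
      by (rule loop_class_eqI[OF based_homotopic_eqI[OF c(2)]]) (simp add: inv(1) lx[OF c(2)])
    ultimately show "\<alpha> \<in> generate (fundamental_group X x0) {u, v}" using c(1) by simp
  qed
  moreover have "generate (fundamental_group X x0) {u, v} \<subseteq> carrier (fundamental_group X x0)"
    using generate_incl[of "{u, v}"] car by blast
  moreover have "marking X x0 \<omega> u v"
    unfolding marking_def u_def v_def using w mark based_loop_a based_loop_b by blast
  ultimately show ?thesis using that car by blast
qed

lemma marking_of_primitive:
  assumes X: "torus_with_hole X" and x0: "x0 \<in> topspace X"
    and e: "primitive_element (fundamental_group X x0) e"
  obtains \<omega> f where "marking X x0 \<omega> e f"
proof -
  let ?G = "fundamental_group X x0"
  obtain B where B: "free_basis ?G B" "e \<in> B" using e unfolding primitive_element_def by blast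
  obtain u v \<omega> where uv: "u \<in> carrier ?G" "v \<in> carrier ?G" "generate ?G {u, v} = carrier ?G" "marking X x0 \<omega> u v"
    using initial_marking[OF X x0] by blast
  interpret G: group ?G by (rule fundamental_group_is_group[OF x0])
  interpret free_group ?G B by unfold_locales (rule B(1))
  obtain x y where xy: "nielsen ?G (u, v) (x, y)" "x \<in> carrier ?G" "y \<in> carrier ?G"
    "B \<subseteq> {x, inv\<^bsub>?G\<^esub> x, y, inv\<^bsub>?G\<^esub> y}"
    using nielsen_basis[OF uv(1-3)] by blast
  note nx = xy(1) nielsen.inv[OF xy(1)] nielsen.swap[OF xy(1)] nielsen.inv[OF nielsen.swap[OF xy(1)]]
  have "\<exists>f. nielsen ?G (u, v) (e, f)"
    using xy(4) B(2) nx by blast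
  then obtain f where "nielsen ?G (u, v) (e, f)" by blast
  from marking_nielsen[OF this x0 uv(1,2,4)] show ?thesis using that by auto
qed

lemma marking_of_basis:
  assumes X: "torus_with_hole X" and x0: "x0 \<in> topspace X"
    and ab: "a \<noteq> b" "free_basis (fundamental_group X x0) {a, b}"
  obtains \<omega> where "marking X x0 \<omega> a b"
proof -
  let ?G = "fundamental_group X x0"
  obtain u v \<omega> where uv: "u \<in> carrier ?G" "v \<in> carrier ?G" "generate ?G {u, v} = carrier ?G" "marking X x0 \<omega> u v"
    using initial_marking[OF X x0] by blast
  interpret G: group ?G by (rule fundamental_group_is_group[OF x0])
  interpret free_group ?G "{a, b}" by unfold_locales (rule ab(2))
  obtain x y where xy: "nielsen ?G (u, v) (x, y)" "x \<in> carrier ?G" "y \<in> carrier ?G"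
    "{a, b} \<subseteq> {x, inv\<^bsub>?G\<^esub> x, y, inv\<^bsub>?G\<^esub> y}"
    using nielsen_basis[OF uv(1-3)] by blast
  have abc: "a \<in> carrier ?G" "b \<in> carrier ?G" using basis_carrier by auto
  have "a \<otimes>\<^bsub>?G\<^esub> b \<noteq> \<one>\<^bsub>?G\<^esub>"
  proof
    assume 1: "a \<otimes>\<^bsub>?G\<^esub> b = \<one>\<^bsub>?G\<^esub>"
    have "word_value ?G [(a, True), (b, True)] = a \<otimes>\<^bsub>?G\<^esub> b"
      using abc by (simp add: word_value_def)
    moreover have "reduced_word [(a, True), (b, True)]" by (simp add: reduced_word_def)
    moreover have "\<And>w. w \<noteq> [] \<Longrightarrow> set w \<subseteq> {a, b} \<times> UNIV \<Longrightarrow> reduced_word w \<Longrightarrow> word_value ?G w \<noteq> \<one>\<^bsub>?G\<^esub>"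
      using ab(2) unfolding free_basis_def by blast
    from this[of "[(a, True), (b, True)]"]
    have "reduced_word [(a, True), (b, True)] \<Longrightarrow> word_value ?G [(a, True), (b, True)] \<noteq> \<one>\<^bsub>?G\<^esub>" by simp
    ultimately show False using 1 by simp
  qed
  then have ne: "a \<noteq> inv\<^bsub>?G\<^esub> b" "b \<noteq> inv\<^bsub>?G\<^esub> a"
    using abc G.l_inv G.r_inv by metis+
  have i: "inv\<^bsub>?G\<^esub> (inv\<^bsub>?G\<^esub> x) = x" "inv\<^bsub>?G\<^esub> (inv\<^bsub>?G\<^esub> y) = y" using xy by auto
  note n1 = xy(1) and n2 = nielsen.inv[OF xy(1)]
  note n3 = G.nielsen_inv2[OF n1] G.nielsen_inv2[OF n2]
  have "nielsen ?G (u, v) (a, b)"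
  proof -
    have "a \<in> {x, inv\<^bsub>?G\<^esub> x} \<and> b \<in> {y, inv\<^bsub>?G\<^esub> y} \<or> a \<in> {y, inv\<^bsub>?G\<^esub> y} \<and> b \<in> {x, inv\<^bsub>?G\<^esub> x}"
      using xy(4) ab(1) ne i by auto
    then show ?thesis
      using n1 n2 n3 nielsen.swap[OF n1] nielsen.swap[OF n2] nielsen.swap[OF n3(1)] nielsen.swap[OF n3(2)] by blast
  qed
  from marking_nielsen[OF this x0 uv(1,2,4)] show ?thesis using that by auto
qed

section \<open>Flat tori with a round hole\<close>

text \<open>The points of the flat torus are complex numbers, one in each class modulo \<open>\<int> + \<i> \<int>\<close>; the
  topology is that of the torus and not that of the half-open square.\<close>

definition unit_square :: "complex set" where
  "unit_square = {z. 0 \<le> Re z \<and> Re z < 1 \<and> 0 \<le> Im z \<and> Im z < 1}"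

definition flat_torus :: "complex topology" where
  "flat_torus = pullback_topology unit_square torus_point torus"

definition reduce :: "complex \<Rightarrow> complex" where
  "reduce z = Complex (frac (Re z)) (frac (Im z))"

lemma reduce_in: "reduce z \<in> unit_square"
  by (simp add: reduce_def unit_square_def frac_lt_1)

lemma torus_point_reduce [simp]: "torus_point (reduce z) = torus_point z"
  by (simp add: torus_point_eq_iff reduce_def frac_def)

lemma reduce_id: "z \<in> unit_square \<Longrightarrow> reduce z = z"
  by (simp add: reduce_def unit_square_def complex_eq_iff frac_eq)

lemma torus_point_inj: "inj_on torus_point unit_square"
proof (rule inj_onI, rule ccontr)
  fix z w assume zw: "z \<in> unit_square" "w \<in> unit_square" "torus_point z = torus_point w" "z \<noteq> w"
  have i: "Re z - Re w \<in> \<int>" "Im z - Im w \<in> \<int>" using zw(3) by (auto simp: torus_point_eq_iff)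
  have "\<bar>Re z - Re w\<bar> < 1" "\<bar>Im z - Im w\<bar> < 1" using zw by (auto simp: unit_square_def)
  then have "Re z - Re w = 0" "Im z - Im w = 0" using i Ints_nonzero_abs_less1 by metis+
  then show False using zw(4) by (simp add: complex_eq_iff)
qed

lemma reduce_eq_iff: "reduce z = reduce w \<longleftrightarrow> torus_point z = torus_point w"
  using torus_point_inj reduce_in by (metis inj_onD torus_point_reduce)

lemma reduce_add_int:
  assumes "Re k \<in> \<int>" "Im k \<in> \<int>" shows "reduce (z + k) = reduce z"
  using assms by (simp add: reduce_eq_iff torus_point_eq_iff)

lemma topspace_flat: "topspace flat_torus = unit_square"
  using torus_point_in by (auto simp: flat_torus_def topspace_pullback_topology topspace_torus)

lemma continuous_map_reduce: "continuous_map euclidean flat_torus reduce"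
  unfolding flat_torus_def
proof (rule continuous_map_pullback')
  have "continuous_map euclidean torus torus_point"
    using continuous_on_torus_point torus_point_in by (auto simp: torus_eq continuous_map_in_subtopology)
  then show "continuous_map euclidean torus (torus_point \<circ> reduce)" by (simp add: o_def)
  show "topspace euclidean \<subseteq> reduce -` unit_square" using reduce_in by auto
qed

lemma homeomorphic_flat_torus: "homeomorphic_map flat_torus torus torus_point"
proof -
  have 1: "continuous_map flat_torus torus torus_point"
    unfolding flat_torus_def by (rule continuous_map_pullback[of torus torus id, simplified o_id id_o]) auto
  have op: "open_map flat_torus torus torus_point"
    unfolding open_map_def
  proof (intro allI impI)
    fix V assume "openin flat_torus V"
    then obtain U where U: "openin torus U" "V = torus_point -` U \<inter> unit_square"
      by (auto simp: flat_torus_def openin_pullback_topology)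
    have "torus_point ` V = U"
    proof
      show "U \<subseteq> torus_point ` V"
      proof
        fix x assume x: "x \<in> U"
        then have "x \<in> torus_set" using U(1) openin_subset topspace_torus by blast
        then have "torus_point (reduce (torus_lift 0 x)) = x" by (simp add: torus_point_lift)
        then show "x \<in> torus_point ` V" using x U(2) reduce_in by (metis IntI image_eqI vimageI)
      qed
    qed (use U in auto)
    then show "openin torus (torus_point ` V)" using U by simp
  qed
  have "torus_point ` topspace flat_torus = topspace torus"
    unfolding topspace_flat topspace_torus
    using torus_point_in torus_point_lift torus_point_reduce reduce_in by (metis imageI image_subsetI subsetI subset_antisym)
  then show ?thesis
    using 1 op torus_point_inj by (intro bijective_open_imp_homeomorphic_map) (auto simp: topspace_flat)
qed

lemma openin_flat_reduce:
  assumes "open W" shows "openin flat_torus (reduce ` W)"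
proof -
  have "torus_point ` reduce ` W = torus_point ` W" by (auto simp: image_image)
  then have "openin torus (torus_point ` reduce ` W)"
    using torus_point_open_map[OF assms] by (simp add: torus_eq)
  moreover have "reduce ` W \<subseteq> topspace flat_torus" using reduce_in by (auto simp: topspace_flat)
  ultimately show ?thesis using homeomorphic_map_openness[OF homeomorphic_flat_torus] by blast
qed

lemma open_reduce_vimage:
  assumes "openin flat_torus V" shows "open (reduce -` V)"
  using openin_continuous_map_preimage[OF continuous_map_reduce assms] by (simp add: vimage_def)

lemma second_countable_euclidean: "second_countable (euclidean :: 'a::second_countable_topology topology)"
proof -
  obtain B :: "'a set set" where "countable B" "topological_basis B" using ex_countable_basis by blast
  show ?thesis
    unfolding second_countable_def
  proof (intro exI[of _ B] conjI allI impI ballI)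
    show "countable B" by fact
    show "openin euclidean V" if "V \<in> B" for V
      using topological_basis_open[OF \<open>topological_basis B\<close> that] by simp
    fix U :: "'a set" and x assume "openin euclidean U \<and> x \<in> U"
    then have U: "open U" "x \<in> U" by auto
    show "\<exists>V\<in>B. x \<in> V \<and> V \<subseteq> U"
      using topological_basisE[OF \<open>topological_basis B\<close> U] by metis
  qed
qed

lemma flat_torus_space: "Hausdorff_space flat_torus" "second_countable flat_torus" "compact_space flat_torus"
  "connected_space flat_torus"
proof -
  have h: "flat_torus homeomorphic_space torus"
    using homeomorphic_flat_torus homeomorphic_map_imp_homeomorphic_space by blast
  show "Hausdorff_space flat_torus"
    using homeomorphic_Hausdorff_space[OF h] by (simp add: torus_eq Hausdorff_space_subtopology)
  show "second_countable flat_torus"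
    using homeomorphic_space_second_countability[OF h] second_countable_subtopology[OF second_countable_euclidean]
    by (simp add: torus_eq)
  show "compact_space flat_torus"
    using homeomorphic_compact_space[OF h] compact_torus by (simp add: torus_eq compact_space_subtopology)
  have "connectedin flat_torus (range reduce)"
    by (rule connectedin_continuous_map_image[OF continuous_map_reduce]) (simp add: connected_UNIV)
  moreover have "range reduce = topspace flat_torus"
    unfolding topspace_flat using reduce_in reduce_id by (metis image_subsetI rangeI subsetI subset_antisym)
  ultimately show "connected_space flat_torus"
    by (simp add: connectedin_topspace)
qed

text \<open>The coordinate of \<open>\<complex> / (\<int> + \<i> L \<int>)\<close>; a negative \<open>L\<close> gives the complex conjugate of the
  structure for \<open>-L\<close>. The underlying space is the same for all \<open>L\<close>.\<close>

definition stretch :: "real \<Rightarrow> complex \<Rightarrow> complex" where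
  "stretch L z = Complex (Re z) (L * Im z)"

lemma stretch_inverse: "L \<noteq> 0 \<Longrightarrow> stretch (1 / L) (stretch L z) = z" "L \<noteq> 0 \<Longrightarrow> stretch L (stretch (1 / L) z) = z"
  by (simp_all add: stretch_def)

lemma stretch_add: "stretch L (z + w) = stretch L z + stretch L w"
  and stretch_diff: "stretch L (z - w) = stretch L z - stretch L w"
  by (simp_all add: stretch_def complex_eq_iff algebra_simps)

lemma continuous_on_stretch: "continuous_on S (stretch L)"
  unfolding stretch_def Complex_eq by (intro continuous_intros)

lemma inj_stretch: "L \<noteq> 0 \<Longrightarrow> inj (stretch L)"
  using stretch_inverse(1) by (metis injI)

lemma stretch_image: "L \<noteq> 0 \<Longrightarrow> stretch L ` W = stretch (1 / L) -` W"
  using stretch_inverse by (auto simp: image_iff) metis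

lemma open_stretch: "L \<noteq> 0 \<Longrightarrow> open W \<Longrightarrow> open (stretch L ` W)"
  by (simp add: stretch_image open_vimage continuous_on_stretch)

lemma stretch_minus: "stretch (- L) z = cnj (stretch L z)"
  by (simp add: stretch_def complex_eq_iff)

definition flat_chart :: "real \<Rightarrow> complex set \<Rightarrow> complex set \<times> (complex \<Rightarrow> complex)" where
  "flat_chart L W = (reduce ` W, stretch L \<circ> inv_into W reduce)"

definition flat_atlas :: "real \<Rightarrow> complex set \<Rightarrow> complex atlas" where
  "flat_atlas L S = {flat_chart L W | W. open W \<and> inj_on reduce W \<and> reduce ` W \<subseteq> S}"

lemma flat_chart_apply:
  assumes "inj_on reduce W" "w \<in> W"
  shows "snd (flat_chart L W) (reduce w) = stretch L w"
  using assms by (simp add: flat_chart_def)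

lemma flat_chart_image: "inj_on reduce W \<Longrightarrow> snd (flat_chart L W) ` fst (flat_chart L W) = stretch L ` W"
  by (auto simp: flat_chart_def image_image)

lemma inj_on_reduce_ball: "inj_on reduce (ball z (1/2))"
proof (rule inj_onI, rule ccontr)
  fix x y assume xy: "x \<in> ball z (1/2)" "y \<in> ball z (1/2)" "reduce x = reduce y" "x \<noteq> y"
  then have "torus_point x = torus_point y" by (simp add: reduce_eq_iff)
  then have "norm (x - y) \<ge> 1"
    using xy(4) by (intro norm_period_ge_1) (auto simp: torus_point_eq_iff)
  moreover have "norm (x - y) < 1"
    using xy(1,2) dist_triangle2[of x y z] by (simp add: dist_norm norm_minus_commute)
  ultimately show False by simp
qed

lemma flat_chart_homeomorphic:
  assumes L: "L \<noteq> 0" and W: "open W" "inj_on reduce W"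
  shows "homeomorphic_map (subtopology flat_torus (reduce ` W)) (top_of_set (stretch L ` W)) (snd (flat_chart L W))"
proof -
  let ?A = "top_of_set (stretch L ` W)" and ?B = "subtopology flat_torus (reduce ` W)"
  let ?k = "\<lambda>w. reduce (stretch (1 / L) w)"
  have sub: "reduce ` W \<subseteq> topspace flat_torus" using reduce_in by (auto simp: topspace_flat)
  have kW: "?k (stretch L w) = reduce w" for w using L by (simp add: stretch_inverse)
  have "homeomorphic_map ?A ?B ?k"
  proof (rule bijective_open_imp_homeomorphic_map)
    have "continuous_map euclidean flat_torus (reduce \<circ> stretch (1 / L))"
      by (rule continuous_map_compose[OF _ continuous_map_reduce]) (simp add: continuous_on_stretch)
    then have "continuous_map ?A flat_torus ?k"
      by (simp add: o_def continuous_map_from_subtopology)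
    then show "continuous_map ?A ?B ?k" using kW by (auto simp: continuous_map_in_subtopology)
    show "open_map ?A ?B ?k"
      unfolding open_map_def
    proof (intro allI impI)
      fix V assume V: "openin ?A V"
      then have oV: "open V" "V \<subseteq> stretch L ` W"
        using open_stretch[OF L W(1)] openin_open_trans openin_imp_subset by blast+
      have "open (stretch (1 / L) ` V)" using L oV(1) by (intro open_stretch) auto
      from openin_flat_reduce[OF this] have "openin flat_torus (?k ` V)" by (simp add: image_image)
      moreover have "?k ` V \<subseteq> reduce ` W" using oV(2) kW by force
      ultimately show "openin ?B (?k ` V)" by (simp add: openin_subtopology_alt image_iff) (metis Int_absorb1 openin_subtopology)
    qed
    show "?k ` topspace ?A = topspace ?B" using kW sub by (auto simp: image_image Int_absorb1)
    show "inj_on ?k (topspace ?A)"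
      using W(2) kW by (auto simp: inj_on_def)
  qed
  then obtain g where g: "homeomorphic_maps ?A ?B ?k g" unfolding homeomorphic_map_maps by blast
  then have "homeomorphic_map ?B ?A g" unfolding homeomorphic_maps_map by blast
  then show ?thesis
  proof (rule homeomorphic_map_eq)
    fix x assume "x \<in> topspace ?B"
    then obtain w where w: "w \<in> W" "x = reduce w" by auto
    have "g (?k (stretch L w)) = stretch L w" using g w(1) unfolding homeomorphic_maps_def by simp
    then show "g x = snd (flat_chart L W) x" using w W(2) kW by (simp add: flat_chart_apply)
  qed
qed

text \<open>The transition maps are translations by periods, locally.\<close>

lemma flat_transition_holomorphic:
  assumes L: "L \<noteq> 0" and c: "c \<in> flat_atlas L S" and d: "d \<in> flat_atlas L S'"
  shows "local_rep c id d holomorphic_on local_dom c id d"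
proof -
  obtain W where W: "c = flat_chart L W" "open W" "inj_on reduce W" using c by (auto simp: flat_atlas_def)
  obtain W' where W': "d = flat_chart L W'" "open W'" "inj_on reduce W'" using d by (auto simp: flat_atlas_def)
  have rep: "local_rep c id d (stretch L w) = stretch L w'"
    if "w \<in> W" "w' \<in> W'" "reduce w = reduce w'" for w w'
  proof -
    have "inj_on (snd c) (fst c)"
      using W(3) inj_stretch[OF L] unfolding W(1) flat_chart_def by (auto simp: inj_on_def)
    then have "inv_into (fst c) (snd c) (snd c (reduce w)) = reduce w"
      using that(1) by (intro inv_into_f_f) (auto simp: W(1) flat_chart_def)
    moreover have "snd c (reduce w) = stretch L w" unfolding W(1) by (rule flat_chart_apply[OF W(3) that(1)])
    moreover have "snd d (reduce w') = stretch L w'" unfolding W'(1) by (rule flat_chart_apply[OF W'(3) that(2)])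
    ultimately show ?thesis by (simp add: local_rep_def that(3))
  qed
  have dom: "local_dom c id d = {stretch L w | w. w \<in> W \<and> (\<exists>w'\<in>W'. reduce w = reduce w')}"
  proof -
    have "local_dom c id d = {snd c (reduce w) | w. w \<in> W \<and> (\<exists>w'\<in>W'. reduce w = reduce w')}"
      by (auto simp: local_dom_def W(1) W'(1) flat_chart_def)
    also have "\<dots> = {stretch L w | w. w \<in> W \<and> (\<exists>w'\<in>W'. reduce w = reduce w')}"
      using flat_chart_apply[OF W(3), of _ L] unfolding W(1) by (metis (no_types, lifting))
    finally show ?thesis .
  qed
  have "local_rep c id d field_differentiable (at \<zeta> within local_dom c id d)" if \<zeta>: "\<zeta> \<in> local_dom c id d" for \<zeta>
  proof -
    obtain w0 w1 where w: "\<zeta> = stretch L w0" "w0 \<in> W" "w1 \<in> W'" "reduce w0 = reduce w1"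
      using \<zeta> unfolding dom by blast
    define k where "k = w1 - w0"
    have k: "reduce (w + k) = reduce w" for w
      using w(4) by (intro reduce_add_int) (auto simp: k_def reduce_eq_iff torus_point_eq_iff, metis Ints_minus minus_diff_eq, metis Ints_minus minus_diff_eq)
    define O1 where "O1 = W \<inter> (\<lambda>w. w + k) -` W'"
    have "open O1" unfolding O1_def using W(2) W'(2) by (intro open_Int open_vimage continuous_intros) auto
    then have oO: "open (stretch L ` O1)" by (rule open_stretch[OF L])
    have eq: "z + stretch L k = local_rep c id d z" if z: "z \<in> stretch L ` O1" for z
    proof -
      obtain v where v: "v \<in> O1" "z = stretch L v" using z by blast
      then have "local_rep c id d (stretch L v) = stretch L (v + k)"
        using k by (intro rep) (auto simp: O1_def)
      then show ?thesis using v by (simp add: stretch_add)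
    qed
    have "((\<lambda>z. z + stretch L k) has_field_derivative 1) (at \<zeta>)"
      by (auto intro!: derivative_eq_intros)
    then have "(local_rep c id d has_field_derivative 1) (at \<zeta>)"
      by (rule has_field_derivative_transform_within_open[OF _ oO]) (use w eq in \<open>auto simp: O1_def k_def\<close>)
    then show ?thesis
      using field_differentiable_at_within field_differentiable_def by blast
  qed
  then show ?thesis by (simp add: holomorphic_on_def)
qed

lemma flat_riemann_surface:
  assumes L: "L \<noteq> 0" and S: "openin flat_torus S" "connected_space (subtopology flat_torus S)"
  shows "riemann_surface (subtopology flat_torus S) (flat_atlas L S)"
  unfolding riemann_surface_def surface_def
proof (intro conjI)
  have SP: "S \<subseteq> unit_square" using S(1) openin_subset topspace_flat by blast
  show "Hausdorff_space (subtopology flat_torus S)" "second_countable (subtopology flat_torus S)"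
    using flat_torus_space by (auto intro: Hausdorff_space_subtopology second_countable_subtopology)
  show "(\<Union>(U, \<phi>)\<in>flat_atlas L S. U) = topspace (subtopology flat_torus S)"
  proof
    show "(\<Union>(U, \<phi>)\<in>flat_atlas L S. U) \<subseteq> topspace (subtopology flat_torus S)"
      using reduce_in by (fastforce simp: flat_atlas_def flat_chart_def topspace_flat)
    show "topspace (subtopology flat_torus S) \<subseteq> (\<Union>(U, \<phi>)\<in>flat_atlas L S. U)"
    proof
      fix u assume "u \<in> topspace (subtopology flat_torus S)"
      then have u: "u \<in> S" "reduce u = u" using SP reduce_id by auto
      define W where "W = ball u (1/2) \<inter> reduce -` S"
      have "open W" unfolding W_def by (intro open_Int open_ball open_reduce_vimage S(1))
      moreover have "inj_on reduce W" unfolding W_def by (rule inj_on_subset[OF inj_on_reduce_ball]) auto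
      moreover have "reduce ` W \<subseteq> S" by (auto simp: W_def)
      ultimately have "flat_chart L W \<in> flat_atlas L S" by (auto simp: flat_atlas_def)
      moreover have "u \<in> reduce ` W" using u by (intro image_eqI[of _ _ u]) (auto simp: W_def)
      ultimately show "u \<in> (\<Union>(U, \<phi>)\<in>flat_atlas L S. U)"
        by (intro UN_I[of "flat_chart L W"]) (auto simp: flat_chart_def)
    qed
  qed
  have chart: "openin (subtopology flat_torus S) (fst c) \<and> open (snd c ` fst c) \<and>
      homeomorphic_map (subtopology (subtopology flat_torus S) (fst c)) (top_of_set (snd c ` fst c)) (snd c)"
    if c: "c \<in> flat_atlas L S" for c
  proof -
    obtain W where W: "c = flat_chart L W" "open W" "inj_on reduce W" "reduce ` W \<subseteq> S"
      using c by (auto simp: flat_atlas_def)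
    have f: "fst c = reduce ` W" by (simp add: W(1) flat_chart_def)
    have i: "snd c ` fst c = stretch L ` W" unfolding W(1) by (rule flat_chart_image[OF W(3)])
    have "openin flat_torus (reduce ` W)" by (rule openin_flat_reduce[OF W(2)])
    then have "openin (subtopology flat_torus S) (reduce ` W)"
      using W(4) S(1) by (simp add: openin_open_subtopology)
    moreover have "subtopology (subtopology flat_torus S) (reduce ` W) = subtopology flat_torus (reduce ` W)"
      using W(4) by (simp add: subtopology_subtopology Int_absorb1)
    ultimately show ?thesis
      unfolding i unfolding f unfolding W(1)
      using open_stretch[OF L W(2)] flat_chart_homeomorphic[OF L W(2,3)] by simp
  qed
  then show "\<forall>(U, \<phi>)\<in>flat_atlas L S. openin (subtopology flat_torus S) U \<and> open (\<phi> ` U) \<and>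
      homeomorphic_map (subtopology (subtopology flat_torus S) U) (top_of_set (\<phi> ` U)) \<phi>"
    by (auto simp: case_prod_beta)
  show "\<forall>c\<in>flat_atlas L S. \<forall>d\<in>flat_atlas L S. local_rep c id d holomorphic_on local_dom c id d"
    using flat_transition_holomorphic[OF L] by blast
qed (rule S(2))

text \<open>Passing from \<open>L\<close> to \<open>-L\<close> conjugates the charts, which is the remedy for homeomorphisms that
  reverse the orientation.\<close>

lemma flat_atlas_cnj:
  "d \<in> flat_atlas (- L) S \<Longrightarrow> \<exists>d'\<in>flat_atlas L S. local_dom c h d = local_dom c h d' \<and>
     local_rep c h d = cnj \<circ> local_rep c h d'"
proof -
  assume "d \<in> flat_atlas (- L) S"
  then obtain W where W: "d = flat_chart (- L) W" "open W" "inj_on reduce W" "reduce ` W \<subseteq> S"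
    by (auto simp: flat_atlas_def)
  have "flat_chart L W \<in> flat_atlas L S" using W by (auto simp: flat_atlas_def)
  moreover have "local_dom c h d = local_dom c h (flat_chart L W)"
    by (simp add: W(1) local_dom_def flat_chart_def)
  moreover have "local_rep c h d = cnj \<circ> local_rep c h (flat_chart L W)"
    by (auto simp: W(1) local_rep_def flat_chart_def stretch_minus)
  ultimately show ?thesis by blast
qed

lemma conformal_structure_some_sign:
  assumes X: "smooth_oriented_surface X A" and L: "L \<noteq> 0" and S: "openin flat_torus S"
    and \<omega>: "homeomorphic_map X (subtopology flat_torus S) \<omega>"
  obtains L' where "L' = L \<or> L' = - L" "conformal_structure X A (subtopology flat_torus S) (flat_atlas L' S) \<omega>"
proof -
  have "connected_space X" using X by (simp add: smooth_oriented_surface_def surface_def)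
  then have conn: "connected_space (subtopology flat_torus S)"
    using \<omega> homeomorphic_connected_space homeomorphic_map_imp_homeomorphic_space by blast
  have R: "riemann_surface (subtopology flat_torus S) (flat_atlas L' S)" if "L' \<noteq> 0" for L'
    by (rule flat_riemann_surface[OF that S conn])
  have "conformal_structure X A (subtopology flat_torus S) (flat_atlas L S) \<omega> \<or>
      conformal_structure X A (subtopology flat_torus S) (flat_atlas (- L) S) \<omega>"
    using orientation_dichotomy[OF X R[OF L] \<omega>]
  proof
    assume "\<forall>c\<in>A. \<forall>d\<in>flat_atlas L S. orientation_preserving_on (local_dom c \<omega> d) (local_rep c \<omega> d)"
    then show ?thesis using R[OF L] \<omega> by (simp add: conformal_structure_def)
  next
    assume o: "\<forall>c\<in>A. \<forall>d\<in>flat_atlas L S. orientation_preserving_on (local_dom c \<omega> d) (cnj \<circ> local_rep c \<omega> d)"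
    have "orientation_preserving_on (local_dom c \<omega> d) (local_rep c \<omega> d)"
      if "c \<in> A" "d \<in> flat_atlas (- L) S" for c d
      using flat_atlas_cnj[OF that(2), of c \<omega>] o that(1) by fastforce
    then show ?thesis using R[of "- L"] L \<omega> by (simp add: conformal_structure_def)
  qed
  then show ?thesis using that by blast
qed

subsection \<open>The round hole\<close>

definition hole_centre :: complex where "hole_centre = Complex (1/2) (1/2)"

text \<open>The distance from the centre of the hole in the flat metric of the torus of height \<open>L\<close>, for
  points near it.\<close>

definition hole_dist :: "real \<Rightarrow> complex \<Rightarrow> real" where
  "hole_dist L z = norm (stretch L z - stretch L hole_centre)"

definition round_hole :: "real \<Rightarrow> real \<Rightarrow> complex set" where
  "round_hole L \<delta> = {z. hole_dist L z \<le> \<delta>}"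

definition open_square :: "complex set" where
  "open_square = {z. 0 < Re z \<and> Re z < 1 \<and> 0 < Im z \<and> Im z < 1}"

lemma open_open_square: "open open_square"
  unfolding open_square_def by (intro open_Collect_conj open_Collect_less continuous_intros)

lemma open_square_sub: "open_square \<subseteq> unit_square"
  by (auto simp: open_square_def unit_square_def)

lemma reduce_open_square: "z \<in> open_square \<Longrightarrow> reduce z = z"
  using open_square_sub reduce_id by blast

lemma inj_on_reduce_square: "inj_on reduce open_square"
  using reduce_open_square by (auto simp: inj_on_def)

lemma reduce_image_square: "W \<subseteq> open_square \<Longrightarrow> reduce ` W = W"
  using reduce_open_square by (force simp: subset_iff)

lemma hole_dist_minus: "hole_dist (- L) z = hole_dist L z"
  unfolding hole_dist_def stretch_minus by (metis complex_cnj_diff complex_mod_cnj)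

lemma hole_dist_small:
  assumes "\<bar>L\<bar> \<ge> 1" "hole_dist L z < 1/2" shows "z \<in> open_square"
proof -
  define v where "v = stretch L z - stretch L hole_centre"
  have v: "norm v < 1/2" using assms(2) by (simp add: hole_dist_def v_def)
  have "Re v = Re z - 1/2" "Im v = L * (Im z - 1/2)"
    by (simp_all add: v_def stretch_def hole_centre_def algebra_simps)
  then have 1: "\<bar>Re z - 1/2\<bar> < 1/2" "\<bar>L * (Im z - 1/2)\<bar> < 1/2"
    using v abs_Re_le_cmod[of v] abs_Im_le_cmod[of v] by auto
  have "\<bar>Im z - 1/2\<bar> \<le> \<bar>L\<bar> * \<bar>Im z - 1/2\<bar>"
    using assms(1) mult_right_mono[of 1 "\<bar>L\<bar>" "\<bar>Im z - 1/2\<bar>"] by simp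
  then have "\<bar>Im z - 1/2\<bar> < 1/2" using 1(2) by (simp add: abs_mult)
  then show ?thesis using 1(1) by (auto simp: open_square_def abs_if split: if_splits)
qed

lemma continuous_on_hole_dist: "continuous_on S (hole_dist L)"
  unfolding hole_dist_def by (intro continuous_intros continuous_on_stretch)

lemma hole_dist_centre [simp]: "hole_dist L hole_centre = 0"
  by (simp add: hole_dist_def)

lemma hole_dist_eq_0: "L \<noteq> 0 \<Longrightarrow> hole_dist L z = 0 \<longleftrightarrow> z = hole_centre"
  unfolding hole_dist_def using inj_stretch[of L] by (auto dest: injD)

lemma compact_round_hole: "L \<noteq> 0 \<Longrightarrow> compact (round_hole L \<delta>)"
proof -
  assume L: "L \<noteq> 0"
  have "round_hole L \<delta> = stretch (1 / L) ` cball (stretch L hole_centre) \<delta>"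
    unfolding round_hole_def hole_dist_def using L stretch_image[of "1 / L"]
    by (simp add: vimage_def dist_norm norm_minus_commute)
  then show ?thesis
    by (simp add: compact_continuous_image continuous_on_stretch)
qed

lemma subtopology_flat_square:
  assumes "W \<subseteq> open_square" shows "subtopology flat_torus W = top_of_set W"
proof (rule topology_eq[THEN iffD2], intro allI)
  fix V
  have "openin (subtopology flat_torus open_square) U \<longleftrightarrow> openin (top_of_set open_square) U" for U
  proof
    assume "openin (subtopology flat_torus open_square) U"
    then obtain T where T: "openin flat_torus T" "U = T \<inter> open_square" by (auto simp: openin_subtopology)
    have "U = open_square \<inter> reduce -` T" using T(2) reduce_open_square by auto
    then show "openin (top_of_set open_square) U"
      using open_reduce_vimage[OF T(1)] by (auto simp: openin_open)
  next
    assume U: "openin (top_of_set open_square) U"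
    then have "open U" "U \<subseteq> open_square" using open_open_square openin_open_trans openin_imp_subset by blast+
    then have "openin flat_torus U" using openin_flat_reduce[of U] reduce_image_square by simp
    then show "openin (subtopology flat_torus open_square) U"
      using \<open>U \<subseteq> open_square\<close> by (auto simp: openin_subtopology intro!: exI[of _ U])
  qed
  then have "subtopology flat_torus open_square = top_of_set open_square" by (simp add: topology_eq)
  then have "subtopology (subtopology flat_torus open_square) W = subtopology (top_of_set open_square) W" by simp
  then show "openin (subtopology flat_torus W) V = openin (top_of_set W) V"
    using assms by (simp add: subtopology_subtopology Int_absorb1)
qed

lemma closedin_round_hole:
  assumes "\<bar>L\<bar> \<ge> 1" "\<delta> < 1/2"
  shows "closedin flat_torus (round_hole L \<delta>)" "round_hole L \<delta> \<subseteq> open_square"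
proof -
  show sub: "round_hole L \<delta> \<subseteq> open_square"
    using hole_dist_small[OF assms(1)] assms(2) by (auto simp: round_hole_def)
  have "compact (round_hole L \<delta>)" using assms(1) by (intro compact_round_hole) auto
  then have "compactin euclidean (round_hole L \<delta>)" by simp
  from image_compactin[OF this continuous_map_reduce]
  have "compactin flat_torus (round_hole L \<delta>)" using reduce_image_square[OF sub] by simp
  then show "closedin flat_torus (round_hole L \<delta>)"
    using flat_torus_space(1) compactin_imp_closedin by blast
qed

definition holed_square :: "real \<Rightarrow> real \<Rightarrow> complex set" where
  "holed_square L \<delta> = unit_square - round_hole L \<delta>"

lemma openin_holed_square:
  assumes "\<bar>L\<bar> \<ge> 1" "\<delta> < 1/2" shows "openin flat_torus (holed_square L \<delta>)"
  using openin_diff[OF openin_topspace closedin_round_hole(1)[OF assms]]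
  by (simp add: holed_square_def topspace_flat)

lemma holed_square_minus: "holed_square (- L) \<delta> = holed_square L \<delta>"
  by (simp add: holed_square_def round_hole_def hole_dist_minus)

lemma Ck_on_const: "Ck_on k S (\<lambda>_. c)"
  by (induction k arbitrary: c) auto

text \<open>The defining function of the boundary of the hole.\<close>

lemma smooth_on_dist_square:
  assumes "open S" shows "smooth_on S (\<lambda>z. (z - a) \<bullet> (z - a) - c :: real)"
  unfolding smooth_on_def
proof
  fix k
  have d: "((\<lambda>z. (z - a) \<bullet> (z - a) - c) has_derivative (\<lambda>v. 2 * ((z - a) \<bullet> v))) (at z)" for z
    by (auto intro!: derivative_eq_intros simp: inner_commute)
  have d2: "((\<lambda>z. 2 * ((z - a) \<bullet> v)) has_derivative (\<lambda>w. 2 * (w \<bullet> v))) (at z)" for z v :: complex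
    by (auto intro!: derivative_eq_intros)
  have f: "frechet_derivative (\<lambda>z. (z - a) \<bullet> (z - a) - c) (at z) = (\<lambda>v. 2 * ((z - a) \<bullet> v))" for z
    using frechet_derivative_at[OF d] by simp
  have f2: "frechet_derivative (\<lambda>z. 2 * ((z - a) \<bullet> v)) (at z) = (\<lambda>w. 2 * (w \<bullet> v))" for z v
    using frechet_derivative_at[OF d2] by simp
  have diff: "(\<lambda>z. (z - a) \<bullet> (z - a) - c) differentiable_on S"
    using d by (auto simp: differentiable_on_def intro!: differentiableI has_derivative_at_withinI)
  have diff2: "(\<lambda>z. 2 * ((z - a) \<bullet> v)) differentiable_on S" for v
    using d2 by (auto simp: differentiable_on_def intro!: differentiableI has_derivative_at_withinI)
  have C2: "Ck_on k S (\<lambda>z. 2 * ((z - a) \<bullet> v))" for k v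
    by (cases k) (use diff2 f2 Ck_on_const in \<open>auto intro!: continuous_intros\<close>)
  show "Ck_on k S (\<lambda>z. (z - a) \<bullet> (z - a) - c)"
    by (cases k) (use diff f C2 in \<open>auto intro!: continuous_intros\<close>)
qed

lemma round_hole_closed_disc:
  assumes L: "\<bar>L\<bar> \<ge> 1" and \<delta>: "0 < \<delta>" "\<delta> < 1/2"
  shows "closed_disc_in flat_torus (round_hole L \<delta>)"
proof -
  note sub = closedin_round_hole(2)[OF L \<delta>(2)]
  have L0: "L \<noteq> 0" using L by auto
  let ?f = "\<lambda>z. (stretch L z - stretch L hole_centre) / of_real \<delta>"
  let ?g = "\<lambda>w. stretch (1 / L) (stretch L hole_centre + of_real \<delta> * w)"
  have "homeomorphism (round_hole L \<delta>) (cball 0 1) ?f ?g"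
  proof (rule homeomorphismI)
    show "continuous_on (round_hole L \<delta>) ?f"
      using \<delta> by (intro continuous_intros continuous_on_stretch) auto
    show "continuous_on (cball 0 1) ?g"
      by (rule continuous_on_compose2[OF continuous_on_stretch[of UNIV]]) (auto intro!: continuous_intros)
    show "?f ` round_hole L \<delta> \<subseteq> cball 0 1"
      using \<delta> by (auto simp: round_hole_def hole_dist_def norm_divide)
    show "?g ` cball 0 1 \<subseteq> round_hole L \<delta>"
      using \<delta> L0 by (auto simp: round_hole_def hole_dist_def stretch_inverse norm_mult)
    show "?g (?f z) = z" if "z \<in> round_hole L \<delta>" for z
      using \<delta> L0 by (simp add: stretch_inverse)
    show "?f (?g w) = w" if "w \<in> cball 0 1" for w
      using \<delta> L0 by (simp add: stretch_inverse)
  qed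
  from homeomorphism_imp_homeomorphic_map[OF this]
  have "top_of_set (round_hole L \<delta>) homeomorphic_space top_of_set (cball (0::complex) 1)"
    by (rule homeomorphic_map_imp_homeomorphic_space)
  then show ?thesis
    unfolding closed_disc_in_def subtopology_flat_square[OF sub]
    using sub open_square_sub by (auto simp: topspace_flat)
qed

lemma round_hole_smooth:
  assumes L: "\<bar>L\<bar> \<ge> 1" and \<delta>: "0 < \<delta>" "\<delta> < 1/2"
  shows "smooth_boundary_in flat_torus (flat_atlas L unit_square) (round_hole L \<delta>)"
  unfolding smooth_boundary_in_def
proof
  fix p assume p: "p \<in> flat_torus frontier_of round_hole L \<delta>"
  note hole = closedin_round_hole[OF L \<delta>(2)]
  have L0: "L \<noteq> 0" using L by auto
  have pK: "p \<in> round_hole L \<delta>"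
    using p hole(1) by (metis closedin_def frontier_of_subset_closedin subsetD)
  have pS: "p \<in> open_square" using pK hole(2) by blast
  let ?I = "{z. hole_dist L z < \<delta>}"
  have "open ?I" by (intro open_Collect_less continuous_on_hole_dist continuous_intros)
  moreover have "?I \<subseteq> open_square" using hole_dist_small[OF L] \<delta> by auto
  ultimately have "openin flat_torus ?I" using openin_flat_reduce[of ?I] reduce_image_square by simp
  moreover have "?I \<subseteq> round_hole L \<delta>" by (auto simp: round_hole_def)
  ultimately have "?I \<subseteq> flat_torus interior_of round_hole L \<delta>" by (rule interior_of_maximal[rotated])
  then have "p \<notin> ?I" using p by (auto simp: frontier_of_def)
  then have pc: "p \<noteq> hole_centre" using \<delta> by auto
  let ?c = "flat_chart L open_square"
  let ?a = "stretch L hole_centre"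
  let ?W = "stretch L ` open_square - {?a}"
  let ?s = "\<lambda>z::complex. (z - ?a) \<bullet> (z - ?a) - \<delta>\<^sup>2"
  have fc: "fst ?c = open_square" by (simp add: flat_chart_def reduce_image_square)
  have sc: "snd ?c z = stretch L z" if "z \<in> open_square" for z
    using flat_chart_apply[OF inj_on_reduce_square that, of L] reduce_open_square[OF that] by simp
  have sci: "snd ?c ` V = stretch L ` V" if "V \<subseteq> open_square" for V using sc that by force
  have c_in: "?c \<in> flat_atlas L unit_square"
    using open_open_square inj_on_reduce_square open_square_sub
    by (auto simp: flat_atlas_def reduce_in intro!: exI[of _ open_square])
  have oW: "open ?W" using open_stretch[OF L0 open_open_square] by auto
  have "frechet_derivative ?s (at z) (z - ?a) \<noteq> 0" if "z \<in> ?W" for z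
  proof -
    have "(?s has_derivative (\<lambda>v. 2 * ((z - ?a) \<bullet> v))) (at z)"
      by (auto intro!: derivative_eq_intros simp: inner_commute)
    then have "frechet_derivative ?s (at z) = (\<lambda>v. 2 * ((z - ?a) \<bullet> v))"
      using frechet_derivative_at by metis
    then show ?thesis using that by simp
  qed
  moreover have "snd ?c ` (fst ?c \<inter> round_hole L \<delta>) \<inter> ?W = {z \<in> ?W. ?s z \<le> 0}"
  proof -
    have h: "z \<in> round_hole L \<delta> \<longleftrightarrow> ?s (stretch L z) \<le> 0" for z
      using \<delta>(1) by (simp add: round_hole_def hole_dist_def power2_norm_eq_inner[symmetric] abs_le_square_iff[symmetric])
    show ?thesis unfolding fc using sci[of "open_square \<inter> round_hole L \<delta>"] h by auto
  qed
  moreover have "snd ?c p \<in> ?W"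
    using pS pc sc[OF pS] inj_stretch[OF L0] by (auto dest: injD)
  moreover have "?W \<subseteq> snd ?c ` fst ?c" unfolding fc using sci[of open_square] by auto
  moreover have "smooth_on ?W ?s" by (rule smooth_on_dist_square[OF oW])
  ultimately have core: "open ?W \<and> ?W \<subseteq> snd ?c ` fst ?c \<and> snd ?c p \<in> ?W \<and> smooth_on ?W ?s \<and>
      (\<forall>z\<in>?W. \<exists>v. frechet_derivative ?s (at z) v \<noteq> 0) \<and>
      snd ?c ` (fst ?c \<inter> round_hole L \<delta>) \<inter> ?W = {z\<in>?W. ?s z \<le> 0}"
    using oW by blast
  have "p \<in> fst ?c" using pS fc by simp
  then have "p \<in> fst ?c \<and> (\<exists>W (s :: complex \<Rightarrow> real). open W \<and> W \<subseteq> snd ?c ` fst ?c \<and> snd ?c p \<in> W \<and> smooth_on W s \<and>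
           (\<forall>z\<in>W. \<exists>v. frechet_derivative s (at z) v \<noteq> 0) \<and>
           snd ?c ` (fst ?c \<inter> round_hole L \<delta>) \<inter> W = {z\<in>W. s z \<le> 0})"
    by (intro conjI[OF _ exI[of _ ?W]] exI[of _ ?s] core)
  then show "\<exists>(U, \<phi>)\<in>flat_atlas L unit_square. p \<in> U \<and>
        (\<exists>W (s :: complex \<Rightarrow> real). open W \<and> W \<subseteq> \<phi> ` U \<and> \<phi> p \<in> W \<and> smooth_on W s \<and>
           (\<forall>z\<in>W. \<exists>v. frechet_derivative s (at z) v \<noteq> 0) \<and>
           \<phi> ` (U \<inter> round_hole L \<delta>) \<inter> W = {z\<in>W. s z \<le> 0})"
    by (intro bexI[OF _ c_in]) (simp only: case_prod_beta)
qed

text \<open>The flat torus itself is the compact surface, and the complement is one round disc.\<close>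

lemma holed_torus_thick_ends:
  assumes L: "\<bar>L\<bar> \<ge> 1" and \<delta>: "0 < \<delta>" "\<delta> < 1/2"
  shows "only_thick_ends (subtopology flat_torus (holed_square L \<delta>)) (flat_atlas L (holed_square L \<delta>))"
  unfolding only_thick_ends_def
proof (intro exI[of _ flat_torus] exI[of _ "flat_atlas L unit_square"] exI[of _ id] conjI)
  have L0: "L \<noteq> 0" using L by auto
  note hole = closedin_round_hole[OF L \<delta>(2)]
  have whole: "subtopology flat_torus unit_square = flat_torus"
    using topspace_flat subtopology_topspace by metis
  show "riemann_surface flat_torus (flat_atlas L unit_square)"
    using flat_riemann_surface[OF L0, of unit_square] openin_topspace[of flat_torus] flat_torus_space(4)
    by (simp add: whole topspace_flat)
  show "compact_space flat_torus" by (rule flat_torus_space)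
  have op: "openin flat_torus (holed_square L \<delta>)" by (rule openin_holed_square[OF L \<delta>(2)])
  have top: "topspace (subtopology flat_torus (holed_square L \<delta>)) = holed_square L \<delta>"
    by (auto simp: topspace_flat holed_square_def)
  show "conformal_embedding (subtopology flat_torus (holed_square L \<delta>)) (flat_atlas L (holed_square L \<delta>))
      flat_torus (flat_atlas L unit_square) id"
    unfolding conformal_embedding_def
  proof (intro conjI)
    show "embedding_map (subtopology flat_torus (holed_square L \<delta>)) flat_torus id"
      unfolding embedding_map_def image_id id_apply top by (simp flip: id_def)
    show "openin flat_torus (id ` topspace (subtopology flat_torus (holed_square L \<delta>)))"
      unfolding image_id id_apply top by (rule op)
    show "\<forall>c\<in>flat_atlas L (holed_square L \<delta>). \<forall>d\<in>flat_atlas L unit_square. local_rep c id d holomorphic_on local_dom c id d"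
      using flat_transition_holomorphic[OF L0] by blast
  qed
  have compl: "topspace flat_torus - id ` topspace (subtopology flat_torus (holed_square L \<delta>)) = round_hole L \<delta>"
    unfolding image_id id_apply top using hole(2) open_square_sub by (auto simp: topspace_flat holed_square_def)
  have ne: "hole_centre \<in> round_hole L \<delta>" using \<delta> by (simp add: round_hole_def)
  have disc: "closed_disc_in flat_torus (round_hole L \<delta>)" by (rule round_hole_closed_disc[OF L \<delta>])
  then have "connected_space (subtopology flat_torus (round_hole L \<delta>))"
    unfolding closed_disc_in_def using homeomorphic_connected_space
    by (metis connectedin_def connectedin_iff_connected convex_cball convex_connected)
  moreover have "topspace (subtopology flat_torus (round_hole L \<delta>)) = round_hole L \<delta>"
    using hole(2) open_square_sub by (auto simp: topspace_flat)
  ultimately have comp: "connected_components_of (subtopology flat_torus (round_hole L \<delta>)) = {round_hole L \<delta>}"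
    using ne by (metis connected_components_of_eq_singleton empty_iff null_topspace_iff_trivial)
  show "let holes = connected_components_of (subtopology flat_torus (topspace flat_torus - id ` topspace (subtopology flat_torus (holed_square L \<delta>))))
     in finite holes \<and> (\<forall>K\<in>holes. closed_disc_in flat_torus K \<and> smooth_boundary_in flat_torus (flat_atlas L unit_square) K)"
    unfolding compl comp Let_def using disc round_hole_smooth[OF L \<delta>] by simp
qed

section \<open>Opening the puncture\<close>

text \<open>A radial map of the flat torus about the centre of the hole, with profile \<open>\<phi>\<close>. It is used for
  profiles that are the identity for distances above 3/8, that is, outside a disc in the open square.\<close>

definition radial :: "(real \<Rightarrow> real) \<Rightarrow> real \<Rightarrow> complex \<Rightarrow> complex" where
  "radial \<phi> L z = stretch (1 / L) (stretch L hole_centre +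
     of_real (\<phi> (hole_dist L z) / hole_dist L z) * (stretch L z - stretch L hole_centre))"

lemma hole_dist_pos: "L \<noteq> 0 \<Longrightarrow> z \<noteq> hole_centre \<Longrightarrow> 0 < hole_dist L z"
  using hole_dist_eq_0[of L z] by (simp add: hole_dist_def)

lemma radial_id:
  assumes "L \<noteq> 0" "z \<noteq> hole_centre" "\<phi> (hole_dist L z) = hole_dist L z" shows "radial \<phi> L z = z"
  using assms hole_dist_pos[OF assms(1,2)] by (simp add: radial_def stretch_inverse)

lemma hole_dist_radial:
  assumes "L \<noteq> 0" "z \<noteq> hole_centre" "0 \<le> \<phi> (hole_dist L z)"
  shows "hole_dist L (radial \<phi> L z) = \<phi> (hole_dist L z)"
proof -
  have p: "0 < hole_dist L z" by (rule hole_dist_pos[OF assms(1,2)])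
  have "hole_dist L (radial \<phi> L z) = norm (of_real (\<phi> (hole_dist L z) / hole_dist L z) * (stretch L z - stretch L hole_centre))"
    unfolding radial_def hole_dist_def[of L "stretch (1 / L) w" for w] by (simp add: stretch_inverse assms(1))
  also have "\<dots> = \<phi> (hole_dist L z) / hole_dist L z * hole_dist L z"
    unfolding norm_mult norm_of_real hole_dist_def[symmetric] using p assms(3) by simp
  finally show ?thesis using p by simp
qed

lemma radial_radial:
  assumes L: "L \<noteq> 0" and z: "z \<noteq> hole_centre" and \<phi>: "0 < \<phi> (hole_dist L z)"
    and \<psi>: "\<psi> (\<phi> (hole_dist L z)) = hole_dist L z"
  shows "radial \<psi> L (radial \<phi> L z) = z"
proof -
  have p: "0 < hole_dist L z" by (rule hole_dist_pos[OF L z])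
  have d: "hole_dist L (radial \<phi> L z) = \<phi> (hole_dist L z)" using \<phi> by (intro hole_dist_radial L z) simp
  have s: "stretch L (radial \<phi> L z) - stretch L hole_centre =
      of_real (\<phi> (hole_dist L z) / hole_dist L z) * (stretch L z - stretch L hole_centre)"
    by (simp add: radial_def stretch_inverse L)
  have "radial \<psi> L (radial \<phi> L z) = stretch (1 / L) (stretch L hole_centre + (stretch L z - stretch L hole_centre))"
    unfolding radial_def[of \<psi>] d s \<psi> using \<phi> p by simp
  then show ?thesis by (simp add: stretch_inverse L)
qed

lemma continuous_map_two_open:
  assumes "openin X U" "openin X V" "topspace X \<subseteq> U \<union> V"
    and "continuous_map (subtopology X U) Y f" "continuous_map (subtopology X V) Y f"
  shows "continuous_map X Y f"
proof (rule pasting_lemma[of UNIV X "\<lambda>b. if b then U else V" Y "\<lambda>_. f"])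
  show "\<exists>j. j \<in> UNIV \<and> x \<in> (if j then U else V) \<and> f x = f x" if "x \<in> topspace X" for x
    using assms(3) that by (cases "x \<in> U") (auto intro: exI[of _ True] exI[of _ False])
qed (use assms in auto)

lemma radial_in_unit_square:
  assumes L: "\<bar>L\<bar> \<ge> 1" and \<phi>: "\<And>\<rho>. \<rho> \<ge> 3/8 \<Longrightarrow> \<phi> \<rho> = \<rho>" "\<And>\<rho>. 0 < \<rho> \<Longrightarrow> \<rho> < 3/8 \<Longrightarrow> \<bar>\<phi> \<rho>\<bar> < 1/2"
    and z: "z \<in> unit_square" "z \<noteq> hole_centre" "0 \<le> \<phi> (hole_dist L z)"
  shows "radial \<phi> L z \<in> unit_square"
proof (cases "hole_dist L z \<ge> 3/8")
  case True
  then show ?thesis using radial_id[of L z \<phi>] \<phi>(1) z L by auto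
next
  case False
  have L0: "L \<noteq> 0" using L by auto
  have "\<phi> (hole_dist L z) < 1/2" using \<phi>(2)[OF hole_dist_pos[OF L0 z(2)]] False by auto
  then have "hole_dist L (radial \<phi> L z) < 1/2" using hole_dist_radial[OF L0 z(2), of \<phi>] z(3) by simp
  from hole_dist_small[OF L this] show ?thesis using open_square_sub by blast
qed

text \<open>Near the centre of the square the topology is that of the plane, and elsewhere the map is the
  identity.\<close>

lemma continuous_map_radial:
  assumes L: "\<bar>L\<bar> \<ge> 1" and S: "openin flat_torus S" "hole_centre \<notin> S"
    and \<phi>: "\<And>\<rho>. \<rho> \<ge> 3/8 \<Longrightarrow> \<phi> \<rho> = \<rho>" "\<And>\<rho>. 0 < \<rho> \<Longrightarrow> \<rho> < 3/8 \<Longrightarrow> \<bar>\<phi> \<rho>\<bar> < 1/2"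
    and pos: "\<And>z. z \<in> S \<Longrightarrow> 0 \<le> \<phi> (hole_dist L z)" and cont: "continuous_on UNIV \<phi>"
  shows "continuous_map (subtopology flat_torus S) flat_torus (radial \<phi> L)"
proof (rule continuous_map_two_open)
  have L0: "L \<noteq> 0" using L by auto
  have SP: "S \<subseteq> unit_square" using openin_subset[OF S(1)] by (simp add: topspace_flat)
  let ?U = "S \<inter> open_square" and ?V = "S - round_hole L (3/8)"
  have "openin flat_torus open_square"
    using openin_flat_reduce[OF open_open_square] reduce_image_square[of open_square] by simp
  then have oU: "openin flat_torus ?U" using S(1) by blast
  have cl: "closedin flat_torus (round_hole L (3/8))" "round_hole L (3/8) \<subseteq> open_square"
    using closedin_round_hole[OF L, of "3/8"] by auto
  have oV: "openin flat_torus ?V" by (rule openin_diff[OF S(1) cl(1)])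
  show "openin (subtopology flat_torus S) ?U" "openin (subtopology flat_torus S) ?V"
    using oU oV S(1) by (auto simp: openin_open_subtopology)
  show "topspace (subtopology flat_torus S) \<subseteq> ?U \<union> ?V" using cl(2) by auto
  have ne: "z \<noteq> hole_centre" if "z \<in> S" for z using that S(2) by auto
  have "continuous_on ?U (radial \<phi> L)"
  proof -
    have "continuous_on ?U (\<lambda>z. \<phi> (hole_dist L z))"
      by (rule continuous_on_compose2[OF cont continuous_on_hole_dist]) simp
    moreover have "hole_dist L z \<noteq> 0" if "z \<in> ?U" for z using hole_dist_eq_0[OF L0] ne that by blast
    ultimately have "continuous_on ?U (\<lambda>z. stretch L hole_centre +
       of_real (\<phi> (hole_dist L z) / hole_dist L z) * (stretch L z - stretch L hole_centre))"
      by (intro continuous_intros continuous_on_hole_dist continuous_on_stretch) auto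
    from continuous_on_compose2[OF continuous_on_stretch[of UNIV] this]
    show ?thesis unfolding radial_def[abs_def] by simp
  qed
  then have "continuous_map (top_of_set ?U) euclidean (radial \<phi> L)" by simp
  from continuous_map_compose[OF this continuous_map_reduce]
  have "continuous_map (top_of_set ?U) flat_torus (reduce \<circ> radial \<phi> L)" .
  moreover have "(reduce \<circ> radial \<phi> L) z = radial \<phi> L z" if "z \<in> ?U" for z
    using radial_in_unit_square[OF L \<phi>, of z] SP ne[of z] pos[of z] that reduce_id by auto
  ultimately have "continuous_map (top_of_set ?U) flat_torus (radial \<phi> L)"
    by (auto intro: continuous_map_eq)
  moreover have "subtopology (subtopology flat_torus S) ?U = top_of_set ?U"
    using subtopology_flat_square[of ?U] by (simp add: subtopology_subtopology Int_absorb1)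
  ultimately show "continuous_map (subtopology (subtopology flat_torus S) ?U) flat_torus (radial \<phi> L)"
    by simp
  have "continuous_map (subtopology (subtopology flat_torus S) ?V) flat_torus id"
    by (intro continuous_map_from_subtopology continuous_map_id)
  moreover have "id z = radial \<phi> L z" if "z \<in> ?V" for z
    using that radial_id[OF L0 ne[of z]] \<phi>(1) by (auto simp: round_hole_def)
  ultimately show "continuous_map (subtopology (subtopology flat_torus S) ?V) flat_torus (radial \<phi> L)"
    by (auto elim: continuous_map_eq)
qed

lemma openin_flat_minus_centre: "openin flat_torus (unit_square - {hole_centre})"
proof -
  have "hole_centre \<in> topspace flat_torus" by (simp add: topspace_flat unit_square_def hole_centre_def)
  then have "closedin flat_torus {hole_centre}"
    using flat_torus_space(1) by (simp add: closedin_Hausdorff_singleton)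
  from openin_diff[OF openin_topspace this] show ?thesis by (simp add: topspace_flat)
qed

text \<open>The profile is affine from \<open>\<delta>\<close> at 0 to 3/8 at 3/8, and the identity beyond. Written as a
  maximum, and its inverse as a minimum, both are visibly continuous.\<close>

lemma flat_minus_centre_homeomorphic:
  assumes L: "\<bar>L\<bar> \<ge> 1" and \<delta>: "0 < \<delta>" "\<delta> < 1/4"
  shows "homeomorphic_map (subtopology flat_torus (unit_square - {hole_centre}))
    (subtopology flat_torus (holed_square L \<delta>)) (radial (\<lambda>\<rho>. max \<rho> (\<delta> + \<rho> * (1 - 8 * \<delta> / 3))) L)"
proof -
  define k where "k = 1 - 8 * \<delta> / 3"
  define \<phi> where "\<phi> \<rho> = max \<rho> (\<delta> + \<rho> * k)" for \<rho> :: real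
  define \<psi> where "\<psi> \<rho> = min \<rho> ((\<rho> - \<delta>) / k)" for \<rho> :: real
  have L0: "L \<noteq> 0" using L by auto
  have k: "1/3 < k" "k < 1" "\<delta> = 3/8 * (1 - k)" using \<delta> by (auto simp: k_def field_simps)
  have \<phi>1: "\<phi> \<rho> = \<rho>" if "\<rho> \<ge> 3/8" for \<rho>
  proof -
    have "3/8 * (1 - k) \<le> \<rho> * (1 - k)" using k that by (intro mult_right_mono) auto
    moreover have "\<rho> * (1 - k) = \<rho> - \<rho> * k" by (simp add: algebra_simps)
    ultimately have "\<delta> + \<rho> * k \<le> \<rho>" using k(3) by linarith
    then show ?thesis by (simp add: \<phi>_def)
  qed
  have \<phi>2: "\<phi> \<rho> = \<delta> + \<rho> * k" if "\<rho> \<le> 3/8" for \<rho>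
  proof -
    have "\<rho> * (1 - k) \<le> 3/8 * (1 - k)" using k that by (intro mult_right_mono) auto
    moreover have "\<rho> * (1 - k) = \<rho> - \<rho> * k" by (simp add: algebra_simps)
    ultimately have "\<rho> \<le> \<delta> + \<rho> * k" using k(3) by linarith
    then show ?thesis by (simp add: \<phi>_def)
  qed
  have \<psi>1: "\<psi> \<rho> = \<rho>" if "\<rho> \<ge> 3/8" for \<rho>
  proof -
    have "3/8 * (1 - k) \<le> \<rho> * (1 - k)" using k that by (intro mult_right_mono) auto
    moreover have "\<rho> * (1 - k) = \<rho> - \<rho> * k" by (simp add: algebra_simps)
    ultimately have "\<rho> * k \<le> \<rho> - \<delta>" using k(3) by linarith
    then show ?thesis using k(1) by (simp add: \<psi>_def pos_le_divide_eq)
  qed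
  have \<psi>2: "\<psi> \<rho> = (\<rho> - \<delta>) / k" if "\<rho> \<le> 3/8" for \<rho>
  proof -
    have "\<rho> * (1 - k) \<le> 3/8 * (1 - k)" using k that by (intro mult_right_mono) auto
    moreover have "\<rho> * (1 - k) = \<rho> - \<rho> * k" by (simp add: algebra_simps)
    ultimately have "\<rho> - \<delta> \<le> \<rho> * k" using k(3) by linarith
    then show ?thesis using k(1) by (simp add: \<psi>_def pos_divide_le_eq)
  qed
  have \<phi>_gt: "\<phi> \<rho> > \<delta>" if "\<rho> > 0" for \<rho> using that k(1) by (simp add: \<phi>_def less_max_iff_disj)
  have \<psi>_gt: "\<psi> \<rho> > 0" if "\<rho> > \<delta>" for \<rho> using that k(1) \<delta> by (simp add: \<psi>_def)
  have \<psi>\<phi>: "\<psi> (\<phi> \<rho>) = \<rho>" for \<rho>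
  proof (cases "\<rho> \<ge> 3/8")
    case True then show ?thesis using \<phi>1 \<psi>1 by simp
  next
    case False
    then have "\<rho> * k \<le> 3/8 * k" using k(1) by (intro mult_right_mono) auto
    then have "\<delta> + \<rho> * k \<le> 3/8" using k(3) by (simp add: algebra_simps)
    then show ?thesis using \<phi>2[of \<rho>] \<psi>2[of "\<delta> + \<rho> * k"] False k(1) by simp
  qed
  have \<phi>\<psi>: "\<phi> (\<psi> \<rho>) = \<rho>" for \<rho>
  proof (cases "\<rho> \<ge> 3/8")
    case True then show ?thesis using \<phi>1 \<psi>1 by simp
  next
    case False
    then have "\<rho> - \<delta> \<le> 3/8 * k" using k(3) by (simp add: algebra_simps)
    then have "(\<rho> - \<delta>) / k \<le> 3/8" using k(1) by (simp add: pos_divide_le_eq)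
    then show ?thesis using \<psi>2[of \<rho>] \<phi>2[of "(\<rho> - \<delta>) / k"] False k(1) by simp
  qed
  have \<phi>_small: "\<bar>\<phi> \<rho>\<bar> < 1/2" if "0 < \<rho>" "\<rho> < 3/8" for \<rho>
  proof -
    have "\<rho> * k \<le> 3/8 * k" using k(1) that by (intro mult_right_mono) auto
    moreover have "\<phi> \<rho> = \<delta> + \<rho> * k" using that by (intro \<phi>2) simp
    moreover have "\<delta> + 3/8 * k = 3/8" by (simp add: k_def field_simps)
    ultimately have "\<phi> \<rho> \<le> 3/8" by linarith
    then show ?thesis using \<phi>_gt[OF that(1)] \<delta> by simp
  qed
  have cont: "continuous_on UNIV \<phi>" "continuous_on UNIV \<psi>"
    using k(1) unfolding \<phi>_def \<psi>_def by (auto intro!: continuous_intros)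
  have hs: "hole_dist L z > \<delta>" "z \<in> unit_square" "z \<noteq> hole_centre" if "z \<in> holed_square L \<delta>" for z
    using that \<delta> by (auto simp: holed_square_def round_hole_def)
  let ?A = "unit_square - {hole_centre}" and ?B = "holed_square L \<delta>"
  let ?f = "radial \<phi> L" and ?g = "radial \<psi> L"
  have f_in: "?f z \<in> ?B" if "z \<in> ?A" for z
  proof -
    have "\<phi> (hole_dist L z) > \<delta>" using that by (intro \<phi>_gt hole_dist_pos L0) auto
    then show ?thesis
      using radial_in_unit_square[OF L \<phi>1 \<phi>_small, of z] hole_dist_radial[OF L0, of z \<phi>] that \<delta>
      by (auto simp: holed_square_def round_hole_def)
  qed
  \<comment> \<open>Below \<open>\<delta>\<close> the inverse profile is negative. These distances do not occur outside the hole, so the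
    values there may be replaced by zero.\<close>
  define \<psi>' where "\<psi>' \<rho> = max 0 (\<psi> \<rho>)" for \<rho>
  have \<psi>'_eq: "\<psi>' (hole_dist L z) = \<psi> (hole_dist L z)" if "z \<in> ?B" for z
    using \<psi>_gt[OF hs(1)[OF that]] by (simp add: \<psi>'_def)
  have g_eq: "radial \<psi>' L z = ?g z" if "z \<in> ?B" for z
    unfolding radial_def \<psi>'_eq[OF that] ..
  have \<psi>'1: "\<psi>' \<rho> = \<rho>" if "\<rho> \<ge> 3/8" for \<rho> using \<psi>1[OF that] that by (simp add: \<psi>'_def)
  have \<psi>'_small: "\<bar>\<psi>' \<rho>\<bar> < 1/2" if "0 < \<rho>" "\<rho> < 3/8" for \<rho>
    using that by (auto simp: \<psi>'_def \<psi>_def)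
  have g_in: "?g z \<in> ?A" if "z \<in> ?B" for z
  proof -
    have p: "\<psi> (hole_dist L z) > 0" by (rule \<psi>_gt[OF hs(1)[OF that]])
    have "radial \<psi>' L z \<in> unit_square"
      using hs[OF that] by (intro radial_in_unit_square L \<psi>'1 \<psi>'_small) (auto simp: \<psi>'_def)
    moreover have "hole_dist L (?g z) > 0" using p hole_dist_radial[OF L0 hs(3)[OF that], of \<psi>] by simp
    then have "?g z \<noteq> hole_centre" by auto
    ultimately show ?thesis using g_eq[OF that] by simp
  qed
  have cf: "continuous_map (subtopology flat_torus ?A) flat_torus ?f"
  proof (rule continuous_map_radial[OF L openin_flat_minus_centre _ \<phi>1 \<phi>_small _ cont(1)])
    show "0 \<le> \<phi> (hole_dist L z)" if "z \<in> ?A" for z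
      using \<phi>_gt[OF hole_dist_pos[OF L0, of z]] that \<delta>(1) by auto
  qed auto
  have "continuous_map (subtopology flat_torus ?B) flat_torus (radial \<psi>' L)"
  proof (rule continuous_map_radial[OF L openin_holed_square[OF L] _ \<psi>'1 \<psi>'_small])
    show "continuous_on UNIV \<psi>'" unfolding \<psi>'_def using cont(2) by (intro continuous_intros)
  qed (use \<delta> in \<open>auto simp: holed_square_def round_hole_def \<psi>'_def\<close>)
  then have cg: "continuous_map (subtopology flat_torus ?B) flat_torus ?g"
    by (rule continuous_map_eq) (use g_eq in auto)
  have "homeomorphic_maps (subtopology flat_torus ?A) (subtopology flat_torus ?B) ?f ?g"
    unfolding homeomorphic_maps_def
  proof (intro conjI ballI)
    show "continuous_map (subtopology flat_torus ?A) (subtopology flat_torus ?B) ?f"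
      using cf f_in by (auto simp: continuous_map_in_subtopology)
    show "continuous_map (subtopology flat_torus ?B) (subtopology flat_torus ?A) ?g"
      using cg g_in by (auto simp: continuous_map_in_subtopology)
    fix z
    show "?g (?f z) = z" if "z \<in> topspace (subtopology flat_torus ?A)"
      using that \<phi>_gt[OF hole_dist_pos[OF L0, of z]] \<delta>(1) by (intro radial_radial L0 \<psi>\<phi>) auto
    show "?f (?g z) = z" if "z \<in> topspace (subtopology flat_torus ?B)"
      using that \<psi>_gt hs by (intro radial_radial L0 \<phi>\<psi>) auto
  qed
  then show ?thesis unfolding homeomorphic_map_maps \<phi>_def[abs_def] k_def by blast
qed

lemma torus_point_centre: "torus_point hole_centre = (-1, -1)"
  by (simp add: torus_point_def hole_centre_def)

lemma holed_torus_homeomorphic: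
  assumes L: "\<bar>L\<bar> \<ge> 1" and \<delta>: "0 < \<delta>" "\<delta> < 1/4"
  obtains E where "homeomorphic_map puncT (subtopology flat_torus (holed_square L \<delta>)) E"
    and "\<And>z. hole_dist L (reduce z) \<ge> 3/8 \<Longrightarrow> E (torus_point z) = reduce z"
proof -
  let ?A = "unit_square - {hole_centre}"
  let ?\<phi> = "\<lambda>\<rho>. max \<rho> (\<delta> + \<rho> * (1 - 8 * \<delta> / 3))"
  obtain k where k: "homeomorphic_maps flat_torus torus torus_point k"
    using homeomorphic_flat_torus unfolding homeomorphic_map_maps by blast
  have inv: "k (torus_point z) = reduce z" for z
  proof -
    have "k (torus_point (reduce z)) = reduce z"
      using k reduce_in[of z] by (auto simp: homeomorphic_maps_def topspace_flat)
    then show ?thesis by simp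
  qed
  have hk: "homeomorphic_map torus flat_torus k" using k by (simp add: homeomorphic_maps_map)
  have "torus_point ` ?A = punctured_torus"
  proof -
    have "inj_on torus_point (unit_square \<union> {hole_centre})"
      using torus_point_inj by (rule inj_on_subset) (auto simp: unit_square_def hole_centre_def)
    then have "torus_point ` ?A = torus_point ` unit_square - torus_point ` {hole_centre}"
      by (intro inj_on_image_set_diff[where C = "unit_square \<union> {hole_centre}"]) auto
    moreover have "torus_point ` unit_square = torus_set"
      using homeomorphic_imp_surjective_map[OF homeomorphic_flat_torus] by (simp add: topspace_flat topspace_torus)
    ultimately show ?thesis by (simp add: torus_point_centre punctured_torus_def)
  qed
  then have "k ` punctured_torus = (\<lambda>z. k (torus_point z)) ` ?A" by (metis image_image)
  also have "\<dots> = (\<lambda>z. z) ` ?A" by (rule image_cong) (auto simp: inv reduce_id)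
  finally have "k ` punctured_torus = ?A" by simp
  moreover have "punctured_torus \<subseteq> topspace torus" by (auto simp: punctured_torus_def topspace_torus)
  ultimately have "homeomorphic_map (subtopology torus punctured_torus) (subtopology flat_torus ?A) k"
    using hk by (intro homeomorphic_map_subtopologies[OF hk]) (auto simp: topspace_flat topspace_torus punctured_torus_def)
  moreover have "subtopology torus punctured_torus = puncT"
    by (simp add: torus_eq subtopology_subtopology punctured_torus_def Int_absorb1)
  ultimately have "homeomorphic_map puncT (subtopology flat_torus ?A) k" by simp
  from homeomorphic_map_compose[OF this flat_minus_centre_homeomorphic[OF assms]]
  have "homeomorphic_map puncT (subtopology flat_torus (holed_square L \<delta>)) (radial ?\<phi> L \<circ> k)" .
  moreover have "(radial ?\<phi> L \<circ> k) (torus_point z) = reduce z" if z: "hole_dist L (reduce z) \<ge> 3/8" for z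
  proof -
    let ?\<rho> = "hole_dist L (reduce z)"
    have "3/8 * (8 * \<delta> / 3) \<le> ?\<rho> * (8 * \<delta> / 3)" using z \<delta> by (intro mult_right_mono) auto
    then have "?\<phi> ?\<rho> = ?\<rho>" by (simp add: algebra_simps)
    moreover have "reduce z \<noteq> hole_centre" using z by auto
    ultimately show ?thesis using L inv radial_id[of L "reduce z" ?\<phi>] by auto
  qed
  ultimately show ?thesis by (rule that)
qed

section \<open>Holomorphic maps of flat tori and annuli\<close>

text \<open>A holomorphic family on a flat torus is lifted to the universal covering, where it can be
  restricted to plane domains.\<close>

lemma holomorphic_to_config_lift:
  assumes L: "L \<noteq> 0" and S: "openin flat_torus S"
    and g: "holomorphic_to_config n Y (flat_atlas L S) g"
  shows "holomorphic_family n {\<zeta>. reduce (stretch (1 / L) \<zeta>) \<in> S} (\<lambda>\<zeta>. g (reduce (stretch (1 / L) \<zeta>)))"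
proof -
  let ?\<Omega> = "{\<zeta>. reduce (stretch (1 / L) \<zeta>) \<in> S}" and ?\<Gamma> = "\<lambda>\<zeta>. g (reduce (stretch (1 / L) \<zeta>))"
  have loc: "\<exists>D. open D \<and> \<zeta>0 \<in> D \<and> holomorphic_family n D ?\<Gamma>" if z: "\<zeta>0 \<in> ?\<Omega>" for \<zeta>0
  proof -
    define W where "W = ball (stretch (1 / L) \<zeta>0) (1/2) \<inter> reduce -` S"
    have oW: "open W" unfolding W_def by (intro open_Int open_ball open_reduce_vimage S)
    have iW: "inj_on reduce W" unfolding W_def by (rule inj_on_subset[OF inj_on_reduce_ball]) auto
    have "flat_chart L W \<in> flat_atlas L S" using oW iW by (auto simp: flat_atlas_def W_def)
    then have h: "holomorphic_family n (snd (flat_chart L W) ` fst (flat_chart L W))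
        (g \<circ> inv_into (fst (flat_chart L W)) (snd (flat_chart L W)))"
      using g unfolding holomorphic_to_config_def by (auto simp: case_prod_beta)
    have inj: "inj_on (snd (flat_chart L W)) (fst (flat_chart L W))"
      using iW inj_stretch[OF L] unfolding flat_chart_def by (auto simp: inj_on_def)
    have eq: "(g \<circ> inv_into (fst (flat_chart L W)) (snd (flat_chart L W))) \<zeta> = ?\<Gamma> \<zeta>"
      if \<zeta>: "\<zeta> \<in> stretch L ` W" for \<zeta>
    proof -
      obtain w where w: "w \<in> W" "\<zeta> = stretch L w" using \<zeta> by blast
      have "reduce w \<in> fst (flat_chart L W)" using w(1) by (simp add: flat_chart_def)
      from inv_into_f_f[OF inj this] show ?thesis
        using flat_chart_apply[OF iW w(1), of L] w L by (simp add: stretch_inverse)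
    qed
    have "holomorphic_family n (stretch L ` W) ?\<Gamma>"
      using h eq unfolding flat_chart_image[OF iW] holomorphic_family_def
      by (auto cong: holomorphic_cong)
    moreover have "\<zeta>0 \<in> stretch L ` W"
      using z L by (intro image_eqI[of _ _ "stretch (1 / L) \<zeta>0"]) (auto simp: W_def stretch_inverse)
    ultimately show ?thesis using open_stretch[OF L oW] by blast
  qed
  show ?thesis
    unfolding holomorphic_family_def
  proof (intro conjI allI)
    show "?\<Gamma> ` ?\<Omega> \<subseteq> config_polys n"
      using loc unfolding holomorphic_family_def by (auto simp: image_subset_iff)
    fix i
    have "(\<lambda>z. coeff (?\<Gamma> z) i) field_differentiable (at \<zeta>0)" if "\<zeta>0 \<in> ?\<Omega>" for \<zeta>0
      using loc[OF that] unfolding holomorphic_family_def by (auto dest: holomorphic_on_imp_differentiable_at)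
    then show "(\<lambda>z. coeff (?\<Gamma> z) i) holomorphic_on ?\<Omega>"
      by (simp add: holomorphic_on_def field_differentiable_at_within)
  qed
qed

lemma holomorphic_family_compose:
  assumes "holomorphic_family n \<Omega> g" "u holomorphic_on S" "u ` S \<subseteq> \<Omega>"
  shows "holomorphic_family n S (\<lambda>z. g (u z))"
proof -
  have "(\<lambda>z. coeff (g (u z)) i) holomorphic_on S" for i
    using holomorphic_on_compose_gen[OF assms(2), of "\<lambda>z. coeff (g z) i" \<Omega>] assms(1,3)
    by (auto simp: holomorphic_family_def o_def)
  then show ?thesis using assms(1,3) by (auto simp: holomorphic_family_def)
qed

text \<open>A periodic family on a strip is a family on an annulus: near each point the principal branch of
  the logarithm may be replaced by a holomorphic branch, which differs from it by periods.\<close>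

lemma holomorphic_family_log:
  assumes g: "holomorphic_family n \<Omega> g" and per: "\<And>\<zeta> m. g (\<zeta> + of_int m) = g \<zeta>"
    and S: "open S" "0 \<notin> S" and \<Omega>: "\<And>\<zeta>. exp (2 * pi * \<i> * \<zeta>) \<in> S \<Longrightarrow> \<zeta> \<in> \<Omega>"
  shows "holomorphic_family n S (\<lambda>w. g (Ln w / (2 * pi * \<i>)))"
proof -
  let ?h = "\<lambda>w. g (Ln w / (2 * pi * \<i>))"
  have per': "g (a / (2 * pi * \<i>)) = g (b / (2 * pi * \<i>))" if ab: "exp a = exp b" for a b
  proof -
    obtain m :: int where "a = b + of_int (2 * m) * pi * \<i>" using ab unfolding exp_eq by blast
    then have "a / (2 * pi * \<i>) = b / (2 * pi * \<i>) + of_int m" by (simp add: field_simps)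
    then show ?thesis using per by simp
  qed
  have in\<Omega>: "a / (2 * pi * \<i>) \<in> \<Omega>" if "exp a \<in> S" for a
    using that by (intro \<Omega>) simp
  have loc: "\<exists>D. open D \<and> w0 \<in> D \<and> holomorphic_family n D ?h" if w0: "w0 \<in> S" for w0
  proof -
    have w0': "w0 \<noteq> 0" using w0 S(2) by auto
    define D where "D = S \<inter> (\<lambda>w. w / w0) -` (- \<real>\<^sub>\<le>\<^sub>0)"
    define l where "l w = Ln (w / w0) + Ln w0" for w
    have oD: "open D" unfolding D_def using S(1) w0'
      by (intro open_Int open_vimage continuous_intros) (auto intro: closed_nonpos_Reals_complex)
    have el: "exp (l w) = w" if "w \<in> D" for w
      using that w0' S(2) by (cases "w = 0") (auto simp: l_def exp_add D_def)
    have "(\<lambda>w. l w / (2 * pi * \<i>)) holomorphic_on D"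
      unfolding l_def using w0' by (intro holomorphic_intros) (auto simp: D_def)
    moreover have "(\<lambda>w. l w / (2 * pi * \<i>)) ` D \<subseteq> \<Omega>"
      using el in\<Omega> by (auto simp: D_def)
    ultimately have "holomorphic_family n D (\<lambda>w. g (l w / (2 * pi * \<i>)))"
      by (rule holomorphic_family_compose[OF g])
    moreover have "g (l w / (2 * pi * \<i>)) = ?h w" if "w \<in> D" for w
      using el[OF that] that S(2) by (intro per', cases "w = 0") (auto simp: D_def)
    ultimately have "holomorphic_family n D ?h"
      unfolding holomorphic_family_def by (auto cong: holomorphic_cong)
    moreover have "w0 \<in> D" using w0 w0' by (simp add: D_def)
    ultimately show ?thesis using oD by blast
  qed
  show ?thesis
    unfolding holomorphic_family_def
  proof (intro conjI allI)
    show "?h ` S \<subseteq> config_polys n"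
      using loc unfolding holomorphic_family_def by (auto simp: image_subset_iff)
    fix i
    have "(\<lambda>z. coeff (?h z) i) field_differentiable (at w0)" if "w0 \<in> S" for w0
      using loc[OF that] unfolding holomorphic_family_def by (auto dest: holomorphic_on_imp_differentiable_at)
    then show "(\<lambda>z. coeff (?h z) i) holomorphic_on S"
      by (simp add: holomorphic_on_def field_differentiable_at_within)
  qed
qed

section \<open>Loops on the holed torus\<close>

lemma freely_homotopic_loops:
  "freely_homotopic (top_of_set S) p q \<longleftrightarrow> homotopic_loops S p q"
  unfolding freely_homotopic_def homotopic_loops_def pathstart_def pathfinish_def
  by (simp add: eq_commute)

lemma freely_homotopic_trans:
  "freely_homotopic X c d \<Longrightarrow> freely_homotopic X d e \<Longrightarrow> freely_homotopic X c e"
  unfolding freely_homotopic_def by (rule homotopic_with_trans)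

definition commutator_loop :: "(real \<Rightarrow> 'a) \<Rightarrow> (real \<Rightarrow> 'a) \<Rightarrow> real \<Rightarrow> 'a" where
  "commutator_loop c d = join_loops (join_loops (join_loops c d) (rev_loop c)) (rev_loop d)"

lemma group_commutator_loop:
  assumes "based_loop X x c" "based_loop X x d"
  shows "group_commutator (fundamental_group X x) (loop_class X x c) (loop_class X x d) =
    loop_class X x (commutator_loop c d)"
  using assms
  by (simp add: group_commutator_def commutator_loop_def fundamental_group_mult fundamental_group_inv
      based_loop_join based_loop_rev)

lemma based_homotopic_commutator_loop:
  assumes "based_homotopic X x c c'" "based_homotopic X x d d'"
  shows "based_homotopic X x (commutator_loop c d) (commutator_loop c' d')"
  unfolding commutator_loop_def by (intro based_homotopic_join based_homotopic_rev assms)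

lemma map_commutator_loop: "h \<circ> commutator_loop c d = commutator_loop (h \<circ> c) (h \<circ> d)"
  by (simp add: commutator_loop_def map_join_loops rev_loop_def o_assoc)

text \<open>The commutator lifts to the boundary of the unit square, which winds once around the centre and
  stays in the disc of radius 3/4 about it. This disc contains no other lift of the puncture.\<close>

lemma freely_homotopic_commutator_circle:
  assumes \<rho>: "0 < \<rho>" "\<rho> \<le> 3/4"
  shows "freely_homotopic puncT (commutator_loop loop_a loop_b) (torus_point \<circ> circlepath hole_centre \<rho>)"
proof -
  define l1 where "l1 = linepath 0 (1::complex)"
  define l2 where "l2 = linepath 1 (1 + \<i>)"
  define l3 where "l3 = linepath (1 + \<i>) \<i>"
  define l4 where "l4 = linepath \<i> 0"
  note ldefs = l1_def l2_def l3_def l4_def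
  define q where "q = ((l1 +++ l2) +++ l3) +++ l4"
  let ?c = hole_centre
  let ?D = "cball ?c (3/4) - {?c}"
  have ends: "path l1" "path l2" "path l3" "path l4" "pathfinish l1 = pathstart l2" "pathfinish l2 = pathstart l3"
    "pathfinish l3 = pathstart l4" "pathfinish l4 = pathstart l1"
    by (simp_all add: ldefs)
  \<comment> \<open>Half the diagonal of the unit square is less than 3/4.\<close>
  have corner: "z \<in> cball ?c (3/4)" if "\<bar>Re z - 1/2\<bar> = 1/2" "\<bar>Im z - 1/2\<bar> = 1/2" for z
  proof -
    have "(norm (?c - z))\<^sup>2 = \<bar>Re z - 1/2\<bar>\<^sup>2 + \<bar>Im z - 1/2\<bar>\<^sup>2"
      by (simp add: cmod_power2 hole_centre_def power2_commute)
    also have "\<dots> \<le> (3/4)\<^sup>2" unfolding that by (simp add: power2_eq_square)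
    finally have "norm (?c - z) \<le> 3/4" by (rule power2_le_imp_le) simp
    then show ?thesis by (simp add: dist_norm)
  qed
  have corners: "0 \<in> cball ?c (3/4)" "1 \<in> cball ?c (3/4)" "1 + \<i> \<in> cball ?c (3/4)" "\<i> \<in> cball ?c (3/4)"
    by (rule corner; simp)+
  have img: "path_image l1 \<subseteq> ?D" "path_image l2 \<subseteq> ?D" "path_image l3 \<subseteq> ?D" "path_image l4 \<subseteq> ?D"
    unfolding ldefs path_image_linepath
    using closed_segment_subset[OF corners(1,2) convex_cball] closed_segment_subset[OF corners(2,3) convex_cball]
      closed_segment_subset[OF corners(3,4) convex_cball] closed_segment_subset[OF corners(4,1) convex_cball]
    by (auto simp: closed_segment_def complex_eq_iff hole_centre_def algebra_simps)
  have avoid: "?c \<notin> path_image l1" "?c \<notin> path_image l2" "?c \<notin> path_image l3" "?c \<notin> path_image l4"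
    using img by blast+
  have "rectpath 0 (1 + \<i>) = l1 +++ (l2 +++ (l3 +++ l4))"
  proof -
    have "Complex (Re (1 + \<i>)) (Im 0) = 1" "Complex (Re 0) (Im (1 + \<i>)) = \<i>" by (simp_all add: complex_eq_iff)
    then show ?thesis by (simp only: rectpath_def Let_def ldefs)
  qed
  then have "winding_number q ?c = winding_number (rectpath 0 (1 + \<i>)) ?c"
    unfolding q_def using ends avoid
    by (simp add: winding_number_join path_image_join)
  also have "\<dots> = 1"
    by (rule winding_number_rectpath) (simp add: in_box_complex_iff hole_centre_def)
  finally have w: "winding_number q ?c = 1" .
  have q: "path q" "pathfinish q = pathstart q" "path_image q \<subseteq> ?D"
    unfolding q_def using ends img by (auto simp: path_image_join)
  have "homotopic_loops ?D q (circlepath ?c (3/4))"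
    by (rule homotopic_circlepath_punctured_disc[OF q w]) simp
  moreover have "homotopic_loops ?D (circlepath ?c \<rho>) (circlepath ?c (3/4))"
  proof (rule homotopic_circlepath_punctured_disc)
    show "path_image (circlepath ?c \<rho>) \<subseteq> ?D" using \<rho> by (auto simp: path_image_circlepath_pos)
    show "winding_number (circlepath ?c \<rho>) ?c = 1" using \<rho> by (intro winding_number_circlepath) auto
  qed auto
  ultimately have "homotopic_loops ?D q (circlepath ?c \<rho>)"
    using homotopic_loops_sym homotopic_loops_trans by blast
  then have "homotopic_loops punctured_torus (torus_point \<circ> q) (torus_point \<circ> circlepath ?c \<rho>)"
  proof (rule homotopic_loops_continuous_image[OF _ continuous_on_torus_point])
    show "torus_point \<in> ?D \<rightarrow> punctured_torus"
    proof
      fix z assume z: "z \<in> ?D"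
      have "torus_point z \<noteq> torus_point ?c"
      proof
        assume "torus_point z = torus_point ?c"
        then have "norm (z - ?c) \<ge> 1"
          using z by (intro norm_period_ge_1) (auto simp: torus_point_eq_iff)
        then show False using z by (simp add: dist_norm norm_minus_commute)
      qed
      then show "torus_point z \<in> punctured_torus"
        using torus_point_in[of z] by (simp add: punctured_torus_def torus_point_centre)
    qed
  qed
  moreover have "torus_point \<circ> q = commutator_loop loop_a loop_b"
  proof -
    have l: "l1 t = Complex t 0" "l2 t = Complex 1 t" "l3 t = Complex (1 - t) 1" "l4 t = Complex 0 (1 - t)" for t
      by (simp_all add: ldefs linepath_def complex_eq_iff)
    have "torus_point \<circ> l1 = loop_a" "torus_point \<circ> l2 = loop_b"
      "torus_point \<circ> l3 = rev_loop loop_a" "torus_point \<circ> l4 = rev_loop loop_b"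
      by (auto simp: l torus_point_def loop_a_def loop_b_def rev_loop_def)
    then show ?thesis
      by (simp add: q_def commutator_loop_def map_join_loops flip: join_loops_eq_joinpaths)
  qed
  ultimately show ?thesis by (simp add: freely_homotopic_loops)
qed

section \<open>Conformal modules\<close>

lemma conformal_module_ge:
  assumes "holomorphic_family n (round_annulus r (ereal R)) g" "0 < r" "r < \<rho>" "\<rho> < R"
    and "g \<circ> circlepath 0 \<rho> \<in> b"
  shows "ereal (ln (R / r) / (2 * pi)) \<le> conformal_module n b"
proof -
  have "annulus_module r (ereal R) \<in> {annulus_module r R | r R. 0 \<le> r \<and> ereal r < R \<and>
            (\<exists>g. holomorphic_family n (round_annulus r R) g \<and>
               (\<exists>\<rho>. r < \<rho> \<and> ereal \<rho> < R \<and> g \<circ> circlepath 0 \<rho> \<in> b))}"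
    using assms by (intro CollectI exI[of _ r] exI[of _ "ereal R"] conjI exI[of _ g] exI[of _ \<rho>]) auto
  from Sup_upper[OF this] show ?thesis
    using assms(2) by (simp add: conformal_module_def annulus_module_def)
qed

text \<open>The free homotopy class of \<open>f\<close> along \<open>c\<close> may be computed on the surface \<open>Y\<close>, with any map
  homotopic to \<open>f\<close> and any loop homotopic to the image of \<open>c\<close>.\<close>

lemma braid_classI:
  assumes \<omega>: "homeomorphic_map X Y \<omega>" and c: "c \<in> e" "pathin X c" "c 0 = c 1"
    and hom: "homotopic_with (\<lambda>_. True) Y (config_space n) (f \<circ> inv_into (topspace X) \<omega>) g"
    and l: "freely_homotopic Y (\<omega> \<circ> c) l"
  shows "g \<circ> l \<in> braid_class n X f e"
proof -
  let ?k = "inv_into (topspace X) \<omega>"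
  have inj: "inj_on \<omega> (topspace X)" using \<omega> homeomorphic_imp_injective_map by blast
  obtain k where k: "homeomorphic_maps X Y \<omega> k" using \<omega> unfolding homeomorphic_map_maps by blast
  have "k y = ?k y" if "y \<in> topspace Y" for y
  proof -
    have "k y \<in> topspace X" "\<omega> (k y) = y"
      using k that continuous_map_image_subset_topspace[of Y X k] by (auto simp: homeomorphic_maps_def)
    then show ?thesis using inv_into_f_f[OF inj] by metis
  qed
  then have ck: "continuous_map Y X ?k"
    using k unfolding homeomorphic_maps_def by (metis continuous_map_eq)
  have cX: "c t \<in> topspace X" if "t \<in> {0..1}" for t
    using c(2) that continuous_map_image_subset_topspace[of "top_of_set {0..1}" X c] by (auto simp: pathin_def)
  have "freely_homotopic X c (?k \<circ> (\<omega> \<circ> c))"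
    unfolding freely_homotopic_def
    using c(2,3) cX inv_into_f_f[OF inj] by (intro homotopic_with_equal) (auto simp: pathin_def)
  then have 1: "freely_homotopic X c (?k \<circ> l)"
    by (rule freely_homotopic_trans[OF _ freely_homotopic_map[OF ck l]])
  have "continuous_map (top_of_set {0..1}) Y l" "l 0 = l 1"
    using l homotopic_with_imp_continuous_maps homotopic_with_imp_property unfolding freely_homotopic_def by blast+
  then have "freely_homotopic (config_space n) ((f \<circ> ?k) \<circ> l) (g \<circ> l)"
    unfolding freely_homotopic_def by (intro homotopic_with_compose_continuous_map_right[OF hom]) auto
  then show ?thesis
    unfolding braid_class_def using 1
    by (intro CollectI bexI[OF _ c(1)] exI[of _ "?k \<circ> l"] conjI) (simp_all add: o_assoc)
qed

text \<open>The Gromov-Oka property applied to a flat torus with a round hole, in terms of the lift to the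
  plane. The sign of \<open>L'\<close> depends on the orientation of \<open>h\<close>. Loops at distance at least 3/8 from the
  centre of the hole are not moved when the puncture is opened, so the braids along them can be read off from their
  lifts \<open>z\<close>.\<close>

lemma gromov_oka_flat:
  assumes X: "smooth_oriented_surface X A" and go: "gromov_oka n X A f"
    and h: "homeomorphic_map X puncT h" and L: "\<bar>L\<bar> \<ge> 1" and \<delta>: "0 < \<delta>" "\<delta> < 1/4"
  obtains L' g where "L' = L \<or> L' = - L"
    and "holomorphic_family n {\<zeta>. reduce (stretch (1 / L') \<zeta>) \<in> holed_square L \<delta>}
      (\<lambda>\<zeta>. g (reduce (stretch (1 / L') \<zeta>)))"
    and "\<And>c e l z. c \<in> e \<Longrightarrow> pathin X c \<Longrightarrow> c 0 = c 1 \<Longrightarrow> freely_homotopic puncT (h \<circ> c) (torus_point \<circ> z) \<Longrightarrow>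
      (\<And>t. hole_dist L (reduce (z t)) \<ge> 3/8) \<Longrightarrow> (\<lambda>t. g (reduce (z t))) \<in> braid_class n X f e"
proof -
  let ?Y = "subtopology flat_torus (holed_square L \<delta>)"
  obtain E where E: "homeomorphic_map puncT ?Y E" "\<And>z. hole_dist L (reduce z) \<ge> 3/8 \<Longrightarrow> E (torus_point z) = reduce z"
    using holed_torus_homeomorphic[OF L \<delta>] by blast
  have \<omega>: "homeomorphic_map X ?Y (E \<circ> h)" by (rule homeomorphic_map_compose[OF h E(1)])
  have op: "openin flat_torus (holed_square L \<delta>)" using \<delta> by (intro openin_holed_square L) simp
  have L0: "L \<noteq> 0" using L by auto
  obtain L' where L': "L' = L \<or> L' = - L" "conformal_structure X A ?Y (flat_atlas L' (holed_square L \<delta>)) (E \<circ> h)"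
    using conformal_structure_some_sign[OF X L0 op \<omega>] by blast
  have same: "holed_square L \<delta> = holed_square L' \<delta>" using L'(1) holed_square_minus by auto
  have "only_thick_ends ?Y (flat_atlas L' (holed_square L \<delta>))"
    unfolding same using L L'(1) \<delta> by (intro holed_torus_thick_ends) auto
  with L'(2) go obtain g where g: "holomorphic_to_config n ?Y (flat_atlas L' (holed_square L \<delta>)) g"
    "homotopic_with (\<lambda>_. True) ?Y (config_space n) (f \<circ> inv_into (topspace X) (E \<circ> h)) g"
    unfolding gromov_oka_def by blast
  show ?thesis
  proof
    show "L' = L \<or> L' = - L" by (rule L'(1))
    show "holomorphic_family n {\<zeta>. reduce (stretch (1 / L') \<zeta>) \<in> holed_square L \<delta>}
      (\<lambda>\<zeta>. g (reduce (stretch (1 / L') \<zeta>)))"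
      using L'(1) L0 by (intro holomorphic_to_config_lift[OF _ op g(1)]) auto
    fix c :: "real \<Rightarrow> 'a" and e and z :: "real \<Rightarrow> complex"
    assume c: "c \<in> e" "pathin X c" "c 0 = c 1" and hz: "freely_homotopic puncT (h \<circ> c) (torus_point \<circ> z)"
      and far: "\<And>t. hole_dist L (reduce (z t)) \<ge> 3/8"
    have "freely_homotopic ?Y (E \<circ> (h \<circ> c)) (E \<circ> (torus_point \<circ> z))"
      by (rule freely_homotopic_map[OF homeomorphic_imp_continuous_map[OF E(1)] hz])
    moreover have "E \<circ> (torus_point \<circ> z) = (\<lambda>t. reduce (z t))" using E(2)[OF far] by auto
    ultimately have "freely_homotopic ?Y ((E \<circ> h) \<circ> c) (\<lambda>t. reduce (z t))" by (simp add: o_assoc)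
    from braid_classI[OF \<omega> c g(2) this] show "(\<lambda>t. g (reduce (z t))) \<in> braid_class n X f e"
      by (simp add: o_def)
  qed
qed

lemma reduce_of_real_circle:
  obtains m :: int where "Ln (circlepath 0 1 t) / (2 * pi * \<i>) = of_real t + of_int m"
proof -
  have "exp (Ln (circlepath 0 1 t)) = exp (2 * pi * \<i> * t)"
    by (simp add: circlepath mult_ac)
  then obtain m :: int where "Ln (circlepath 0 1 t) = 2 * pi * \<i> * t + of_int (2 * m) * pi * \<i>"
    unfolding exp_eq by blast
  then have "Ln (circlepath 0 1 t) / (2 * pi * \<i>) = of_real t + of_int m"
    by (simp add: field_simps)
  then show ?thesis by (rule that)
qed

text \<open>The strip \<open>|Im \<zeta>| < s/4\<close> of the torus of height \<open>s\<close> avoids the hole of radius 1/8, whose centre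
  is at height \<open>s/2\<close>, and the map \<open>exp (2 \<pi> \<i> \<zeta>)\<close> identifies the strip modulo 1 with an annulus of module
  \<open>s/2\<close>. The unit circle corresponds to the real axis, which is \<open>a\<close>, for both orientations.\<close>

lemma module_primitive:
  assumes X: "smooth_oriented_surface X A" and go: "gromov_oka n X A f"
    and h: "homeomorphic_map X puncT h" and c: "c \<in> e" "based_loop X x0 c"
    and hc: "freely_homotopic puncT (h \<circ> c) loop_a" and s: "s \<ge> 1"
  shows "ereal (s / 2) \<le> conformal_module n (braid_class n X f e)"
proof -
  have s': "\<bar>s\<bar> \<ge> 1" using s by simp
  obtain L g where L: "L = s \<or> L = - s"
    and hol: "holomorphic_family n {\<zeta>. reduce (stretch (1 / L) \<zeta>) \<in> holed_square s (1/8)}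
      (\<lambda>\<zeta>. g (reduce (stretch (1 / L) \<zeta>)))"
    and br: "\<And>c e l z. c \<in> e \<Longrightarrow> pathin X c \<Longrightarrow> c 0 = c 1 \<Longrightarrow> freely_homotopic puncT (h \<circ> c) (torus_point \<circ> z) \<Longrightarrow>
      (\<And>t. hole_dist s (reduce (z t)) \<ge> 3/8) \<Longrightarrow> (\<lambda>t. g (reduce (z t))) \<in> braid_class n X f e"
    using gromov_oka_flat[OF X go h s', of "1/8"] by auto
  define \<Gamma> where "\<Gamma> \<zeta> = g (reduce (stretch (1 / L) \<zeta>))" for \<zeta>
  have abs_L: "\<bar>L\<bar> = s" using L s by auto
  define r where "r = exp (- (pi * s / 2))"
  define R where "R = exp (pi * s / 2)"
  let ?S = "round_annulus r (ereal R)"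
  have dist: "s * \<bar>Im z - 1/2\<bar> \<le> hole_dist s z" for z
  proof -
    have "s * \<bar>Im z - 1/2\<bar> = \<bar>s * (Im z - 1/2)\<bar>" using s by (simp add: abs_mult)
    also have "s * (Im z - 1/2) = Im (stretch s z - stretch s hole_centre)"
      by (simp add: stretch_def hole_centre_def algebra_simps)
    finally show ?thesis using abs_Im_le_cmod[of "stretch s z - stretch s hole_centre"] by (simp add: hole_dist_def)
  qed
  have per: "\<Gamma> (\<zeta> + of_int m) = \<Gamma> \<zeta>" for \<zeta> m
  proof -
    have "stretch (1 / L) (\<zeta> + of_int m) = stretch (1 / L) \<zeta> + of_int m"
      by (simp add: stretch_def complex_eq_iff)
    then show ?thesis by (simp add: \<Gamma>_def reduce_add_int)
  qed
  have "holomorphic_family n ?S (\<lambda>w. \<Gamma> (Ln w / (2 * pi * \<i>)))"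
  proof (rule holomorphic_family_log[OF hol[folded \<Gamma>_def] per])
    have "?S = - cball 0 r \<inter> ball 0 R" by (auto simp: round_annulus_def)
    then show "open ?S" by (simp add: open_Int open_Compl)
    show "0 \<notin> ?S" by (simp add: round_annulus_def r_def)
    fix \<zeta> assume "exp (2 * pi * \<i> * \<zeta>) \<in> ?S"
    then have "exp (- (pi * s / 2)) < exp (- (2 * pi * Im \<zeta>))" "exp (- (2 * pi * Im \<zeta>)) < exp (pi * s / 2)"
      by (simp_all add: round_annulus_def norm_exp_eq_Re r_def R_def)
    then have "- (pi * (s / 2)) < - (pi * (2 * Im \<zeta>))" "- (pi * (2 * Im \<zeta>)) < pi * (s / 2)"
      by simp_all
    then have "pi * (2 * Im \<zeta>) < pi * (s / 2)" "pi * (- (2 * Im \<zeta>)) < pi * (s / 2)" by simp_all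
    then have "\<bar>Im \<zeta>\<bar> < s / 4" by (simp only: mult_less_cancel_left_pos[OF pi_gt_zero])
    then have "\<bar>Im \<zeta> / L\<bar> < 1 / 4" using s by (simp add: abs_L field_simps)
    moreover define x where "x = Im \<zeta> / L"
    ultimately have x: "\<bar>x\<bar> < 1/4" by simp
    have f: "\<bar>frac x - 1/2\<bar> \<ge> 1/4"
    proof (cases "x \<ge> 0")
      case True
      then have "frac x = x" using x by (subst frac_eq) auto
      then show ?thesis using x True by simp
    next
      case False
      then have "frac x = x + 1" using x by (subst frac_unique_iff) auto
      then show ?thesis using x False by simp
    qed
    have "Im (reduce (stretch (1 / L) \<zeta>)) = frac x" by (simp add: reduce_def stretch_def x_def)
    then have "s * \<bar>frac x - 1/2\<bar> \<le> hole_dist s (reduce (stretch (1 / L) \<zeta>))"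
      using dist[of "reduce (stretch (1 / L) \<zeta>)"] by simp
    moreover have "s * (1/4) \<le> s * \<bar>frac x - 1/2\<bar>" using f s by (intro mult_left_mono) auto
    ultimately have "s * (1/4) \<le> hole_dist s (reduce (stretch (1 / L) \<zeta>))" by linarith
    then show "\<zeta> \<in> {\<zeta>. reduce (stretch (1 / L) \<zeta>) \<in> holed_square s (1/8)}"
      using s reduce_in by (simp add: holed_square_def round_hole_def)
  qed
  moreover have "(\<lambda>w. \<Gamma> (Ln w / (2 * pi * \<i>))) \<circ> circlepath 0 1 \<in> braid_class n X f e"
  proof -
    have "\<Gamma> (Ln (circlepath 0 1 t) / (2 * pi * \<i>)) = g (reduce (of_real t))" for t
    proof -
      obtain m :: int where "Ln (circlepath 0 1 t) / (2 * pi * \<i>) = of_real t + of_int m"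
        by (rule reduce_of_real_circle)
      then have "\<Gamma> (Ln (circlepath 0 1 t) / (2 * pi * \<i>)) = \<Gamma> (of_real t)" using per by simp
      moreover have "stretch (1 / L) (of_real t) = of_real t" by (simp add: stretch_def complex_eq_iff)
      ultimately show ?thesis by (simp add: \<Gamma>_def)
    qed
    then have "(\<lambda>w. \<Gamma> (Ln w / (2 * pi * \<i>))) \<circ> circlepath 0 1 = (\<lambda>t. g (reduce (of_real t)))" by auto
    moreover have "(\<lambda>t. g (reduce (of_real t))) \<in> braid_class n X f e"
    proof (rule br[OF c(1)])
      show "pathin X c" "c 0 = c 1" using c(2) by (auto simp: based_loop_def)
      have "torus_point \<circ> of_real = loop_a" by (auto simp: torus_point_def loop_a_def)
      then show "freely_homotopic puncT (h \<circ> c) (torus_point \<circ> of_real)" using hc by simp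
      show "3/8 \<le> hole_dist s (reduce (of_real t))" for t
        using dist[of "reduce (of_real t)"] s by (simp add: reduce_def)
    qed
    ultimately show ?thesis by simp
  qed
  ultimately have "ereal (ln (R / r) / (2 * pi)) \<le> conformal_module n (braid_class n X f e)"
    using s by (intro conformal_module_ge[where \<rho> = 1]) (auto simp: r_def R_def)
  moreover have "R / r = exp (pi * s)" by (simp add: R_def r_def flip: exp_diff)
  ultimately show ?thesis by simp
qed

text \<open>The annulus around the hole. If the orientation is reversed, then its parametrisation is composed
  with a conjugation, which would reverse the circles; the inversion \<open>w \<mapsto> \<delta> / (2 w)\<close>, which maps the
  annulus to itself, corrects this.\<close>

lemma module_commutator:
  assumes X: "smooth_oriented_surface X A" and go: "gromov_oka n X A f"
    and h: "homeomorphic_map X puncT h" and c: "c \<in> e" "based_loop X x0 c"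
    and hc: "freely_homotopic puncT (h \<circ> c) (commutator_loop loop_a loop_b)" and \<delta>: "0 < \<delta>" "\<delta> < 1/4"
  shows "ereal (ln (1 / (2 * \<delta>)) / (2 * pi)) \<le> conformal_module n (braid_class n X f e)"
proof -
  obtain L g where L: "L = 1 \<or> L = - 1"
    and hol: "holomorphic_family n {\<zeta>. reduce (stretch (1 / L) \<zeta>) \<in> holed_square 1 \<delta>}
      (\<lambda>\<zeta>. g (reduce (stretch (1 / L) \<zeta>)))"
    and br: "\<And>c e l z. c \<in> e \<Longrightarrow> pathin X c \<Longrightarrow> c 0 = c 1 \<Longrightarrow> freely_homotopic puncT (h \<circ> c) (torus_point \<circ> z) \<Longrightarrow>
      (\<And>t. hole_dist 1 (reduce (z t)) \<ge> 3/8) \<Longrightarrow> (\<lambda>t. g (reduce (z t))) \<in> braid_class n X f e"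
    using gromov_oka_flat[OF X go h _ \<delta>, of 1] by auto
  let ?c = hole_centre
  have id1: "stretch 1 z = z" for z by (simp add: stretch_def)
  have hd: "hole_dist 1 (?c + v) = norm v" for v by (simp add: hole_dist_def id1)
  have red: "reduce (?c + v) = ?c + v" if "norm v < 1/2" for v
    using hole_dist_small[of 1 "?c + v"] that by (intro reduce_open_square) (simp add: hd)
  have in_sq: "?c + v \<in> holed_square 1 \<delta>" if "\<delta> < norm v" "norm v < 1/2" for v
    using that reduce_in[of "?c + v"] red[OF that(2)] by (simp add: holed_square_def round_hole_def hd)
  let ?S = "round_annulus \<delta> (ereal (1/2))"
  \<comment> \<open>a radius between 3/8, from where on points are fixed when the puncture is opened, and 1/2\<close>
  define z where "z = circlepath ?c (7/16)"
  have zt: "z t = ?c + 7/16 * exp (2 * of_real pi * \<i> * of_real t)" for t by (simp add: z_def circlepath)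
  have red_z: "reduce (z t) = z t" for t
    unfolding zt by (rule red) (simp add: norm_mult)
  have zb: "(\<lambda>t. g (reduce (z t))) \<in> braid_class n X f e"
  proof (rule br[OF c(1)])
    show "pathin X c" "c 0 = c 1" using c(2) by (auto simp: based_loop_def)
    have "freely_homotopic puncT (commutator_loop loop_a loop_b) (torus_point \<circ> z)"
      unfolding z_def by (rule freely_homotopic_commutator_circle) auto
    then show "freely_homotopic puncT (h \<circ> c) (torus_point \<circ> z)" by (rule freely_homotopic_trans[OF hc])
    show "3/8 \<le> hole_dist 1 (reduce (z t))" for t
      unfolding red_z unfolding zt hd by (simp add: norm_mult)
  qed
  obtain G \<rho> where G: "holomorphic_family n ?S G" "\<delta> < \<rho>" "\<rho> < 1/2" "G \<circ> circlepath 0 \<rho> = (\<lambda>t. g (reduce (z t)))"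
  proof (cases "L = 1")
    case True
    let ?u = "\<lambda>w. ?c + w"
    have "holomorphic_family n ?S (\<lambda>w. g (reduce (stretch (1 / L) (?u w))))"
    proof (rule holomorphic_family_compose[OF hol])
      show "?u holomorphic_on ?S" by (intro holomorphic_intros)
      show "?u ` ?S \<subseteq> {\<zeta>. reduce (stretch (1 / L) \<zeta>) \<in> holed_square 1 \<delta>}"
        using in_sq by (auto simp: True id1 round_annulus_def red)
    qed
    moreover have "(\<lambda>w. g (reduce (stretch (1 / L) (?u w)))) \<circ> circlepath 0 (7/16) = (\<lambda>t. g (reduce (z t)))"
      by (auto simp: True id1 zt circlepath)
    ultimately show ?thesis using \<delta> that[of _ "7/16"] by simp
  next
    case False
    then have L1: "L = -1" using L by simp
    have st: "stretch (1 / L) \<zeta> = cnj \<zeta>" for \<zeta> by (simp add: L1 stretch_def complex_eq_iff)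
    let ?u = "\<lambda>w. cnj ?c + of_real (\<delta> / 2) / w"
    have cu: "cnj (?u w) = ?c + cnj (of_real (\<delta> / 2) / w)" for w by simp
    have nu: "\<delta> < norm (cnj (of_real (\<delta> / 2) / w))" "norm (cnj (of_real (\<delta> / 2) / w)) < 1/2" if w: "w \<in> ?S" for w
    proof -
      have b: "\<delta> < norm w" "norm w < 1/2" using w by (auto simp: round_annulus_def)
      have "norm (cnj (of_real (\<delta> / 2) / w)) = \<delta> / 2 / norm w"
        unfolding complex_mod_cnj norm_divide norm_of_real using \<delta>(1) by simp
      moreover have "\<delta> * norm w < \<delta> * (1/2)" using b(2) \<delta>(1) by (rule mult_strict_left_mono)
      then have "\<delta> < \<delta> / 2 / norm w" using b \<delta>(1) by (subst pos_less_divide_eq) auto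
      moreover have "\<delta> / 2 / norm w < 1/2" using b \<delta>(1) by (subst pos_divide_less_eq) auto
      ultimately show "\<delta> < norm (cnj (of_real (\<delta> / 2) / w))" "norm (cnj (of_real (\<delta> / 2) / w)) < 1/2"
        by simp_all
    qed
    have "holomorphic_family n ?S (\<lambda>w. g (reduce (stretch (1 / L) (?u w))))"
    proof (rule holomorphic_family_compose[OF hol])
      show "?u holomorphic_on ?S" using \<delta> by (intro holomorphic_intros) (auto simp: round_annulus_def)
      show "?u ` ?S \<subseteq> {\<zeta>. reduce (stretch (1 / L) \<zeta>) \<in> holed_square 1 \<delta>}"
        unfolding st using in_sq[OF nu] red[OF nu(2)] by (auto simp only: cu image_subset_iff mem_Collect_eq)
    qed
    moreover have "(\<lambda>w. g (reduce (stretch (1 / L) (?u w)))) \<circ> circlepath 0 (8 * \<delta> / 7) = (\<lambda>t. g (reduce (z t)))"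
    proof
      fix t
      have "cnj (of_real (\<delta> / 2) / circlepath 0 (8 * \<delta> / 7) t) = 7/16 * exp (2 * of_real pi * \<i> * of_real t)"
        using \<delta> by (simp add: circlepath exp_cnj exp_minus field_simps)
      then show "((\<lambda>w. g (reduce (stretch (1 / L) (?u w)))) \<circ> circlepath 0 (8 * \<delta> / 7)) t = g (reduce (z t))"
        by (simp only: o_def st cu zt)
    qed
    \<comment> \<open>The inversion takes the radius \<open>8 \<delta> / 7\<close> to \<open>7/16\<close>.\<close>
    ultimately show ?thesis using \<delta> that[of _ "8 * \<delta> / 7"] by simp
  qed
  have "ereal (ln ((1/2) / \<delta>) / (2 * pi)) \<le> conformal_module n (braid_class n X f e)"
    using G zb by (intro conformal_module_ge[OF G(1) \<delta>(1) G(2,3)]) simp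
  then show ?thesis by simp
qed

lemma ereal_eq_infinity:
  assumes "\<And>M. 0 < M \<Longrightarrow> ereal M \<le> x" shows "x = \<infinity>"
proof (rule ereal_top)
  fix B
  have "ereal B \<le> ereal (max 1 B)" by simp
  also have "\<dots> \<le> x" by (rule assms) simp
  finally show "ereal B \<le> x" .
qed

theorem lemma2:
  fixes X :: "'a topology" and A :: "'a atlas" and x0 :: 'a
    and f :: "'a \<Rightarrow> complex poly" and e :: "(real \<Rightarrow> 'a) set"
  defines "G \<equiv> fundamental_group X x0"
  assumes "smooth_oriented_surface X A" and "torus_with_hole X" and "x0 \<in> topspace X"
    and "continuous_map X (config_space 3) f"
    and "gromov_oka 3 X A f"
    and "e \<in> carrier G"
    and "primitive_element G e \<or>
         (\<exists>a b. a \<noteq> b \<and> free_basis G {a, b} \<and> e = group_commutator G a b)"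
  shows "conformal_module 3 (braid_class 3 X f e) = \<infinity>"
  using assms(8)
proof (elim disjE exE conjE)
  assume "primitive_element G e"
  then obtain h d where m: "marking X x0 h e d"
    using marking_of_primitive[OF assms(3,4)] unfolding G_def by blast
  obtain c where "e = loop_class X x0 c" "based_loop X x0 c"
    using assms(7) unfolding G_def fundamental_group_carrier by blast
  then have c: "c \<in> e" "based_loop X x0 c" using loop_class_self by auto
  have h: "homeomorphic_map X puncT h" and "\<forall>c\<in>e. based_homotopic puncT (1, 1) (h \<circ> c) loop_a"
    using m by (simp_all add: marking_def)
  then have hc: "freely_homotopic puncT (h \<circ> c) loop_a"
    using based_homotopic_imp_freely c(1) by metis
  show ?thesis
  proof (rule ereal_eq_infinity)
    fix M :: real
    have "ereal M \<le> ereal (max 1 (2 * M) / 2)" by simp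
    also have "\<dots> \<le> conformal_module 3 (braid_class 3 X f e)"
      by (rule module_primitive[OF assms(2,6) h c hc]) simp
    finally show "ereal M \<le> conformal_module 3 (braid_class 3 X f e)" .
  qed
next
  fix a b assume ab: "a \<noteq> b" "free_basis G {a, b}" and e: "e = group_commutator G a b"
  obtain h where m: "marking X x0 h a b"
    using marking_of_basis[OF assms(3,4) ab(1)] ab(2) unfolding G_def by blast
  have "a \<in> carrier G" "b \<in> carrier G" using ab(2) by (auto simp: free_basis_def)
  then obtain ca cb where ca: "a = loop_class X x0 ca" "based_loop X x0 ca"
    and cb: "b = loop_class X x0 cb" "based_loop X x0 cb"
    unfolding G_def fundamental_group_carrier by blast
  let ?c = "commutator_loop ca cb"
  have bl: "based_loop X x0 ?c"
    unfolding commutator_loop_def by (intro based_loop_join based_loop_rev ca cb)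
  have "e = loop_class X x0 ?c"
    unfolding e G_def ca(1) cb(1) by (rule group_commutator_loop[OF ca(2) cb(2)])
  then have c: "?c \<in> e" using loop_class_self[OF bl] by simp
  have h: "homeomorphic_map X puncT h" and ha: "based_homotopic puncT (1, 1) (h \<circ> ca) loop_a"
    and hb: "based_homotopic puncT (1, 1) (h \<circ> cb) loop_b"
    using m loop_class_self[OF ca(2)] loop_class_self[OF cb(2)] by (simp_all add: marking_def ca(1) cb(1))
  have hc: "freely_homotopic puncT (h \<circ> ?c) (commutator_loop loop_a loop_b)"
    unfolding map_commutator_loop by (intro based_homotopic_imp_freely[OF based_homotopic_commutator_loop[OF ha hb]])
  show ?thesis
  proof (rule ereal_eq_infinity)
    fix M :: real assume M: "0 < M"
    define \<delta> where "\<delta> = min (1/8) (exp (- (2 * pi * M)) / 2)"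
    have \<delta>: "0 < \<delta>" "\<delta> < 1/4" by (auto simp: \<delta>_def)
    have "2 * \<delta> \<le> exp (- (2 * pi * M))" by (auto simp: \<delta>_def min_def)
    then have "exp (2 * pi * M) \<le> 1 / (2 * \<delta>)" using \<delta>(1) by (simp add: exp_minus field_simps)
    then have "2 * pi * M \<le> ln (1 / (2 * \<delta>))" using \<delta>(1) by (subst ln_ge_iff) auto
    then have "ereal M \<le> ereal (ln (1 / (2 * \<delta>)) / (2 * pi))" by (simp add: field_simps)
    also have "\<dots> \<le> conformal_module 3 (braid_class 3 X f e)"
      by (rule module_commutator[OF assms(2,6) h c bl hc \<delta>])
    finally show "ereal M \<le> conformal_module 3 (braid_class 3 X f e)" .
  qed
qed

end
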